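(* Let $\mathcal{T}$ be a self-affine tiling of $\mathbb{R}^d$ with expansion map $Q$ and a primitive substitution rule with finite local complexity, where $Q$ is diagonalizable over $\mathbb{C}$ and all eigenvalues of $Q$ are algebraic conjugates of one another with the same multiplicity, and assume the set $\operatorname{spec}(Q)$ of eigenvalues of $Q$ is a Pisot family. Then for every finite $\mathcal{T}$-legal patch $\mathcal{P}$ and every $n>0$ there is a basis $\{b_1,\dots,b_d\}$ of $\mathbb{R}^d$ such that the patch $\bigcup_{(l_1,\dots,l_d)\in\{1,\dots,n\}^d}\left(\mathcal{P}+\sum_{j=1}^d l_jb_j\right)$ is $\mathcal{T}$-legal.
   Context: A tile in $\mathbb{R}^d$ is a compact set equal to the closure of its interior, possibly labeled from a finite set. Patches: sets of tiles with pairwise disjoint interiors; tilings: patches with support $\mathbb{R}^d$; $\mathcal{P}$ is $\mathcal{T}$-legal if $\mathcal{P}+y\subset\mathcal{T}$ for some $y$. $\mathcal{P}\sqcap S=\{T\in\mathcal{P}:\operatorname{supp}T\cap S\neq\emptyset\}$. Substitution rule: finite prototile set $\mathcal{A}$, linear $Q$ with all eigenvalues of modulus $>1$, map $\omega$ sending $P\in\mathcal{A}$ to a finite patch of translates of prototiles with $\operatorname{supp}\omega(P)=Q(\operatorname{supp}P)$, extended by $\omega(P+x)=\omega(P)+Qx$ and unions; primitive if some power of the substitution matrix is positive; FLC if $\{\omega^n(P)\sqcap(K+x)\}_{n>0,P,x}$ is finite up to translation for each compact $K$. A self-affine tiling for $\omega$ is a tiling $\mathcal{T}$ of translates of prototiles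 with $\omega(\mathcal{T})=\mathcal{T}$, having finite local complexity and being repetitive (each finite legal patch occurs as a translate in every ball of some fixed radius). A set $\Lambda$ of algebraic integers is a Pisot family if for every $\lambda\in\Lambda$ and every algebraic conjugate $\mu$ of $\lambda$ with $|\mu|\ge1$ we have $\mu\in\Lambda$. *)

theory Defs
  imports "HOL-Analysis.Analysis" "HOL-Computational_Algebra.Polynomial"
begin

text \<open>A (labelled) tile in R^d is a pair (support, label). The dimension d is
the cardinality of the finite index type 'n.\<close>
type_synonym ('n, 'l) tile = "(real^'n) set \<times> 'l"

definition supp_tile :: "('n::finite, 'l) tile \<Rightarrow> (real^'n) set" where
  "supp_tile T = fst T"

definition supp :: "('n::finite, 'l) tile set \<Rightarrow> (real^'n) set" where
  "supp P = (\<Union>T\<in>P. supp_tile T)"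

definition is_tile :: "('n::finite, 'l) tile \<Rightarrow> bool" where
  "is_tile T \<longleftrightarrow> compact (supp_tile T) \<and> supp_tile T \<noteq> {} \<and>
     supp_tile T = closure (interior (supp_tile T))"

definition translate :: "real^'n \<Rightarrow> ('n::finite, 'l) tile \<Rightarrow> ('n, 'l) tile" where
  "translate x T = ((\<lambda>y. y + x) ` fst T, snd T)"

definition translate_patch :: "real^'n \<Rightarrow> ('n::finite, 'l) tile set \<Rightarrow> ('n, 'l) tile set" where
  "translate_patch x P = translate x ` P"

definition is_patch :: "('n::finite, 'l) tile set \<Rightarrow> bool" where
  "is_patch P \<longleftrightarrow> (\<forall>T\<in>P. is_tile T) \<and>
     (\<forall>T\<in>P. \<forall>T'\<in>P. T \<noteq> T' \<longrightarrow> interior (supp_tile T) \<inter> interior (supp_tile T') = {})"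

definition is_tiling :: "('n::finite, 'l) tile set \<Rightarrow> bool" where
  "is_tiling \<T> \<longleftrightarrow> is_patch \<T> \<and> supp \<T> = UNIV"

definition legal :: "('n::finite, 'l) tile set \<Rightarrow> ('n, 'l) tile set \<Rightarrow> bool" where
  "legal \<T> P \<longleftrightarrow> (\<exists>y. translate_patch y P \<subseteq> \<T>)"

definition patch_meet :: "('n::finite, 'l) tile set \<Rightarrow> (real^'n) set \<Rightarrow> ('n, 'l) tile set" where
  "patch_meet P S = {T\<in>P. supp_tile T \<inter> S \<noteq> {}}"

definition finite_up_to_translation :: "('n::finite, 'l) tile set set \<Rightarrow> bool" where
  "finite_up_to_translation F \<longleftrightarrow>
     (\<exists>G. finite G \<and> (\<forall>P\<in>F. \<exists>P0\<in>G. \<exists>y. P = translate_patch y P0))"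

definition complex_mat :: "real^'n^'n \<Rightarrow> complex^'n^'n" where
  "complex_mat Q = (\<chi> i j. complex_of_real (Q $ i $ j))"

definition charpoly :: "real^'n::finite^'n \<Rightarrow> real poly" where
  "charpoly Q = det (\<chi> i j. (if i = j then [:0, 1:] else 0) - [: Q $ i $ j :])"

definition spec :: "real^'n::finite^'n \<Rightarrow> complex set" where
  "spec Q = {\<mu>. poly (map_poly complex_of_real (charpoly Q)) \<mu> = 0}"

definition eig_mult :: "real^'n::finite^'n \<Rightarrow> complex \<Rightarrow> nat" where
  "eig_mult Q \<mu> = order \<mu> (map_poly complex_of_real (charpoly Q))"

definition diagonalizable_over_C :: "real^'n::finite^'n \<Rightarrow> bool" where
  "diagonalizable_over_C Q \<longleftrightarrow>
     (\<exists>S S' :: complex^'n^'n. S ** S' = mat 1 \<and> S' ** S = mat 1 \<and>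
        (\<forall>i j. i \<noteq> j \<longrightarrow> (S' ** complex_mat Q ** S) $ i $ j = 0))"

definition expansive :: "real^'n::finite^'n \<Rightarrow> bool" where
  "expansive Q \<longleftrightarrow> (\<forall>\<mu>\<in>spec Q. cmod \<mu> > 1)"

definition omega_tile ::
  "('n::finite, 'l) tile set \<Rightarrow> real^'n^'n \<Rightarrow> (('n, 'l) tile \<Rightarrow> ('n, 'l) tile set)
     \<Rightarrow> ('n, 'l) tile \<Rightarrow> ('n, 'l) tile set" where
  "omega_tile A Q \<omega> T =
     (\<Union>{translate_patch (Q *v x) (\<omega> P) | P x. P \<in> A \<and> T = translate x P})"

definition omega_patch ::
  "('n::finite, 'l) tile set \<Rightarrow> real^'n^'n \<Rightarrow> (('n, 'l) tile \<Rightarrow> ('n, 'l) tile set)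
     \<Rightarrow> ('n, 'l) tile set \<Rightarrow> ('n, 'l) tile set" where
  "omega_patch A Q \<omega> P = (\<Union>T\<in>P. omega_tile A Q \<omega> T)"

definition omega_iter ::
  "('n::finite, 'l) tile set \<Rightarrow> real^'n^'n \<Rightarrow> (('n, 'l) tile \<Rightarrow> ('n, 'l) tile set)
     \<Rightarrow> nat \<Rightarrow> ('n, 'l) tile \<Rightarrow> ('n, 'l) tile set" where
  "omega_iter A Q \<omega> n P = (omega_patch A Q \<omega> ^^ n) {P}"

definition substitution_rule ::
  "('n::finite, 'l) tile set \<Rightarrow> real^'n^'n \<Rightarrow> (('n, 'l) tile \<Rightarrow> ('n, 'l) tile set) \<Rightarrow> bool" where
  "substitution_rule A Q \<omega> \<longleftrightarrow>
     finite A \<and> (\<forall>P\<in>A. is_tile P) \<and> expansive Q \<and>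
     (\<forall>P\<in>A. finite (\<omega> P) \<and> is_patch (\<omega> P) \<and>
        (\<forall>T\<in>\<omega> P. \<exists>P'\<in>A. \<exists>x. T = translate x P') \<and>
        supp (\<omega> P) = (\<lambda>y. Q *v y) ` supp_tile P)"

definition subst_matrix ::
  "(('n::finite, 'l) tile \<Rightarrow> ('n, 'l) tile set) \<Rightarrow> ('n, 'l) tile \<Rightarrow> ('n, 'l) tile \<Rightarrow> nat" where
  "subst_matrix \<omega> P P' = card {x. translate x P' \<in> \<omega> P}"

fun mat_pow_on :: "'a set \<Rightarrow> ('a \<Rightarrow> 'a \<Rightarrow> nat) \<Rightarrow> nat \<Rightarrow> 'a \<Rightarrow> 'a \<Rightarrow> nat" where
  "mat_pow_on A M 0 = (\<lambda>i j. if i = j then 1 else 0)"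
| "mat_pow_on A M (Suc k) = (\<lambda>i j. \<Sum>l\<in>A. mat_pow_on A M k i l * M l j)"

definition primitive ::
  "('n::finite, 'l) tile set \<Rightarrow> (('n, 'l) tile \<Rightarrow> ('n, 'l) tile set) \<Rightarrow> bool" where
  "primitive A \<omega> \<longleftrightarrow>
     (\<exists>k\<ge>1. \<forall>P\<in>A. \<forall>P'\<in>A. mat_pow_on A (subst_matrix \<omega>) k P P' > 0)"

definition subst_FLC ::
  "('n::finite, 'l) tile set \<Rightarrow> real^'n^'n \<Rightarrow> (('n, 'l) tile \<Rightarrow> ('n, 'l) tile set) \<Rightarrow> bool" where
  "subst_FLC A Q \<omega> \<longleftrightarrow>
     (\<forall>K. compact K \<longrightarrow> finite_up_to_translation
        {patch_meet (omega_iter A Q \<omega> n P) ((\<lambda>y. y + x) ` K) | n P x. n > 0 \<and> P \<in> A})"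

definition tiling_FLC :: "('n::finite, 'l) tile set \<Rightarrow> bool" where
  "tiling_FLC \<T> \<longleftrightarrow>
     (\<forall>K. compact K \<longrightarrow> finite_up_to_translation
        {patch_meet \<T> ((\<lambda>y. y + x) ` K) | x. True})"

definition repetitive :: "('n::finite, 'l) tile set \<Rightarrow> bool" where
  "repetitive \<T> \<longleftrightarrow>
     (\<forall>P. finite P \<and> legal \<T> P \<longrightarrow>
        (\<exists>R>0. \<forall>z. \<exists>y. translate_patch y P \<subseteq> \<T> \<and> supp (translate_patch y P) \<subseteq> ball z R))"

definition self_affine_tiling ::
  "('n::finite, 'l) tile set \<Rightarrow> real^'n^'n \<Rightarrow> (('n, 'l) tile \<Rightarrow> ('n, 'l) tile set)
     \<Rightarrow> ('n, 'l) tile set \<Rightarrow> bool" where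
  "self_affine_tiling A Q \<omega> \<T> \<longleftrightarrow>
     substitution_rule A Q \<omega> \<and> is_tiling \<T> \<and>
     (\<forall>T\<in>\<T>. \<exists>P\<in>A. \<exists>x. T = translate x P) \<and>
     omega_patch A Q \<omega> \<T> = \<T> \<and> tiling_FLC \<T> \<and> repetitive \<T>"

definition algebraic_integer :: "complex \<Rightarrow> bool" where
  "algebraic_integer z \<longleftrightarrow>
     (\<exists>p :: int poly. lead_coeff p = 1 \<and> poly (map_poly of_int p) z = 0)"

text \<open>mu and nu are algebraic conjugates: they are roots of a common irreducible
  polynomial over Q (i.e. they share the minimal polynomial over Q).\<close>
definition alg_conjugate :: "complex \<Rightarrow> complex \<Rightarrow> bool" where
  "alg_conjugate \<mu> \<nu> \<longleftrightarrow>
     (\<exists>p :: rat poly. irreducible p \<and>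
        poly (map_poly of_rat p) \<mu> = 0 \<and> poly (map_poly of_rat p) \<nu> = 0)"

definition pisot_family :: "complex set \<Rightarrow> bool" where
  "pisot_family \<Lambda> \<longleftrightarrow>
     (\<forall>z\<in>\<Lambda>. algebraic_integer z) \<and>
     (\<forall>z\<in>\<Lambda>. \<forall>\<mu>. alg_conjugate z \<mu> \<and> cmod \<mu> \<ge> 1 \<longrightarrow> \<mu> \<in> \<Lambda>)"

end

(* The tiles are marked by control points C with Q C inside C. Differences of control points generate
   a finitely generated Q-invariant group, which spans a vector space over the number field of an
   eigenvalue of Q; its coordinates over that field, evaluated at a conjugate m of the eigenvalue,
   are additive functions f_m with f_m(Q x) = m f_m(x). For an eigenvalue m of largest modulus, f_m is
   Lipschitz on C. Take two control points whose slope for f_m is nearly maximal: scaling up by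
   powers of Q and subdividing, one finds arbitrarily large balls on which f_m is nearly linear, since
   a function of slope at most M that gains almost M times the length of a long segment is squeezed
   near its midpoint between two nearly linear functions. By repetitivity and compactness f_m is
   linear. This bounds the dimension over the number field by the multiplicity of m; as all
   eigenvalues have the same multiplicity, f_m is linear for every eigenvalue m. The other conjugates
   have modulus less than 1 by the Pisot property, and there f_m is bounded on C. Hence, if the points
   of a box in the lattice spanned by Q^k v_1, ..., Q^k v_d are matched with nearby occurrences of the
   patch, the offsets lie in a finite set that depends neither on the size of the box nor on k, as
   long as k is large enough for that size. Gallai's theorem, applied to the colouring by offsets,
   gives the result. *)

theory Submission
  imports Defs "HOL-Computational_Algebra.Fundamental_Theorem_Algebra"
begin

text \<open>The functions f_m come from Galois conjugation, so nothing makes them continuous a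
  priori; finite local complexity only bounds them on short differences. For an eigenvalue m of
  largest modulus the decisive point is a comparison of factors: in coordinates that diagonalize Q,
  distances grow by at most |m| while differences of f_m grow by exactly |m|, so slopes never
  decrease under Q. For smaller eigenvalues this comparison fails, hence the detour through
  dimensions: a linear f_m with f_m(Q x) = m f_m(x) sees only the m-component of x, so the basis
  vectors over the number field have independent m-components; at any other eigenvalue the
  components of these vectors span the eigenspace and, by the count, form a basis of it. An offset
  bounded at every conjugate is one of finitely many because coordinates in the group have a common
  denominator. The order of choices matters: the number of colours precedes the window in Gallai's
  theorem, and the window precedes k. Powers of Q make the contracting conjugates negligible on a
  window of any size.\<close>

section \<open>Gallai's theorem\<close>

text \<open>The induction on \<open>S\<close> treats all numbers of colours at once, since its step
  colours points by whole patterns on a window. The finite set \<open>H\<close> of homotheties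
  (translation \<open>a\<close>, dilation \<open>k\<close>) serves every colouring, so only finitely
  many images of \<open>S\<close> will have to be controlled later.\<close>

lemma gallai_pairs:
  fixes S :: "'a::comm_ring_1 set"
  assumes "finite S"
  shows "\<exists>H. finite H \<and> (\<forall>(a,k)\<in>H. k > 0) \<and>
    (\<forall>c :: 'a \<Rightarrow> nat. (\<forall>x. c x < r) \<longrightarrow>
      (\<exists>(a,k)\<in>H. \<forall>s\<in>S. \<forall>t\<in>S. c (a + of_nat k * s) = c (a + of_nat k * t)))"
  using assms
proof (induction S arbitrary: r rule: finite_induct)
  case empty
  show ?case by (rule exI[of _ "{(0,1)}"]) auto
next
  case (insert s0 S)
  show ?case
  proof (cases "S = {}")
    case True
    then show ?thesis by (intro exI[of _ "{(0,1)}"]) auto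
  next
    case False
    then obtain s1 where s1: "s1 \<in> S" by auto
    define mono :: "('a \<Rightarrow> nat) \<Rightarrow> 'a set \<Rightarrow> 'a \<times> nat \<Rightarrow> bool" where
      "mono = (\<lambda>c T (a,k). \<forall>s\<in>T. \<forall>t\<in>T. c (a + of_nat k * s) = c (a + of_nat k * t))"
    let ?I = "insert s0 S"
    define focused where
      "focused = (\<lambda>(c :: 'a \<Rightarrow> nat) H m f. \<exists>p col. inj_on col {..<m::nat} \<and>
         (\<forall>i<m. p i \<in> H \<and> fst (p i) + of_nat (snd (p i)) * s0 = f \<and> col i < r \<and>
            (\<forall>s\<in>S. c (fst (p i) + of_nat (snd (p i)) * s) = col i)))"
    (* Colour focusing: either some homothet of the enlarged set is monochromatic, or m monochromatic
       homothets of S with pairwise distinct colours have the same image f of s0. *)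
    have claim: "\<exists>H W. finite H \<and> finite W \<and> (\<forall>(a,k)\<in>H. k > 0) \<and>
        (\<forall>(a,k)\<in>H. \<forall>s\<in>?I. a + of_nat k * s \<in> W) \<and>
        (\<forall>c. (\<forall>x. c x < r) \<longrightarrow> (\<exists>h\<in>H. mono c ?I h) \<or> (\<exists>f\<in>W. focused c H m f))" for m
    proof (induction m)
      case 0
      show ?case
        by (rule exI[of _ "{}"], rule exI[of _ "{0}"]) (auto simp: focused_def)
    next
      case (Suc m)
      then obtain H W where HW: "finite H" "finite W" "\<forall>(a,k)\<in>H. k > 0"
        and HW4: "\<forall>(a,k)\<in>H. \<forall>s\<in>?I. a + of_nat k * s \<in> W"
        and foc0: "\<forall>c. (\<forall>x. c x < r) \<longrightarrow> (\<exists>h\<in>H. mono c ?I h) \<or> (\<exists>f\<in>W. focused c H m f)"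
        by (elim exE conjE)
      have inW: "a + of_nat k * s \<in> W" if "(a,k)\<in>H" "s\<in>?I" for a k s
        using HW4 that by blast
      \<comment> \<open>Colouring \<open>x\<close> by the pattern that a colouring shows on the
        translate of \<open>W\<close> by \<open>x\<close> takes \<open>card ?X\<close> colours;
        \<open>V\<close> is obtained for these pattern colourings.\<close>
      let ?X = "PiE W (\<lambda>_. {..<r})"
      have "finite ?X" using HW(2) by (simp add: finite_PiE)
      then obtain e :: "('a \<Rightarrow> nat) \<Rightarrow> nat" where e: "bij_betw e ?X {..<card ?X}"
        using ex_bij_betw_finite_nat[of ?X] by (auto simp: atLeast0LessThan)
      obtain V where V: "finite V" "\<forall>(a,k)\<in>V. k > 0"
        and Vm: "\<And>c. (\<forall>x. c x < card ?X) \<Longrightarrow> \<exists>h\<in>V. mono c S h"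
        using insert.IH[of "card ?X"] unfolding mono_def by (auto simp: case_prod_beta)
      \<comment> \<open>The three families: old homotheties stretched by a pattern homothety, a new
        copy placed at an old focus, and translates of old homotheties for the case that a larger
        monochromatic copy is already at hand.\<close>
      define H' where "H' = (\<lambda>((a,k),(y,k')). (a + y, k + k')) ` (H \<times> V)
         \<union> (\<lambda>(f,(y,k')). (f + y, k')) ` (W \<times> V)
         \<union> (\<lambda>((a,k),((y,k'),s)). (a + (y + of_nat k' * s), k)) ` (H \<times> (V \<times> S))"
      define W' where "W' = (\<lambda>(w,((y,k'),s)). w + (y + of_nat k' * s)) ` (W \<times> (V \<times> ?I))"
      have fin: "finite H'" "finite W'"
        unfolding H'_def W'_def using HW V insert.hyps by auto
      have W'I: "w + (y + of_nat k' * s) \<in> W'" if "w \<in> W" "(y,k') \<in> V" "s \<in> ?I" for w y k' s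
        unfolding W'_def using that by (intro image_eqI[of _ _ "(w,((y,k'),s))"]) auto
      have H'1: "(a + y, k + k') \<in> H'" if "(a,k) \<in> H" "(y,k') \<in> V" for a k y k'
        unfolding H'_def using that by (intro UnI1 image_eqI[of _ _ "((a,k),(y,k'))"]) auto
      have H'2: "(f + y, k') \<in> H'" if "f \<in> W" "(y,k') \<in> V" for f y k'
        unfolding H'_def using that
        by (intro UnI1 UnI2 image_eqI[of _ _ "(f,(y,k'))"]) auto
      have H'3: "(a + (y + of_nat k' * s), k) \<in> H'" if "(a,k) \<in> H" "(y,k') \<in> V" "s \<in> S"
        for a k y k' s
        unfolding H'_def using that
        by (intro UnI2 image_eqI[of _ _ "((a,k),((y,k'),s))"]) auto
      have pos: "\<forall>(a,k)\<in>H'. k > 0"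
        unfolding H'_def using HW(3) V(2) by auto
      have cov: "a + of_nat k * s \<in> W'" if "(a,k) \<in> H'" "s \<in> ?I" for a k s
      proof -
        from that(1) consider
            (1) b l y k' where "(b,l) \<in> H" "(y,k') \<in> V" "a = b + y" "k = l + k'"
          | (2) f y where "f \<in> W" "(y,k) \<in> V" "a = f + y"
          | (3) b y k' t where "(b,k) \<in> H" "(y,k') \<in> V" "t \<in> S" "a = b + (y + of_nat k' * t)"
          unfolding H'_def by auto
        then show ?thesis
        proof cases
          case 1
          have "a + of_nat k * s = (b + of_nat l * s) + (y + of_nat k' * s)"
            using 1 by (simp add: algebra_simps)
          then show ?thesis using W'I[OF inW[OF 1(1) that(2)] 1(2) that(2)] by simp
        next
          case 2
          then show ?thesis using W'I[OF 2(1,2) that(2)] by (simp add: algebra_simps)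
        next
          case 3
          have "a + of_nat k * s = (b + of_nat k * s) + (y + of_nat k' * t)"
            using 3 by (simp add: algebra_simps)
          then show ?thesis using W'I[OF inW[OF 3(1) that(2)] 3(2), of t] 3(3) by (metis insertI2)
        qed
      qed
      have main: "(\<exists>h\<in>H'. mono c ?I h) \<or> (\<exists>f\<in>W'. focused c H' (Suc m) f)"
        if c: "\<forall>x. c x < r" for c
      proof (rule disjCI)
        assume nf: "\<not> (\<exists>f\<in>W'. focused c H' (Suc m) f)"
        define c' where "c' = (\<lambda>x. e (restrict (\<lambda>w. c (w + x)) W))"
        have inX: "restrict (\<lambda>w. c (w + x)) W \<in> ?X" for x using c by auto
        have "c' x < card ?X" for x
          using bij_betwE[OF e, rule_format, OF inX[of x]] by (simp add: c'_def)
        then have "\<exists>h\<in>V. mono c' S h" by (intro Vm allI)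
        then obtain h0 where h0: "h0 \<in> V" "mono c' S h0" by blast
        obtain y k' where "h0 = (y,k')" by (cases h0)
        with h0 have yk: "(y,k') \<in> V" "mono c' S (y,k')" by blast+
        have same: "c (w + (y + of_nat k' * s)) = c (w + (y + of_nat k' * t))"
          if "s \<in> S" "t \<in> S" "w \<in> W" for s t w
        proof -
          have "e (restrict (\<lambda>w. c (w + (y + of_nat k' * s))) W)
              = e (restrict (\<lambda>w. c (w + (y + of_nat k' * t))) W)"
            using yk(2) that(1,2) unfolding mono_def c'_def case_prod_conv by blast
          then have "restrict (\<lambda>w. c (w + (y + of_nat k' * s))) W
              = restrict (\<lambda>w. c (w + (y + of_nat k' * t))) W"
            using e inX by (meson bij_betw_def inj_onD)
          from fun_cong[OF this, of w] show ?thesis using that(3) by simp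
        qed
        let ?v = "y + of_nat k' * s1"
        define d where "d = (\<lambda>x. c (x + ?v))"
        have "\<forall>x. d x < r" using c by (simp add: d_def)
        from mp[OF spec[OF foc0, of d] this] show "\<exists>h\<in>H'. mono c ?I h"
        proof
          assume "\<exists>h\<in>H. mono d ?I h"
          then obtain h0 where h0: "h0 \<in> H" "mono d ?I h0" by blast
          obtain a k where "h0 = (a,k)" by (cases h0)
          with h0 have h: "(a,k) \<in> H" "mono d ?I (a,k)" by blast+
          have "(a + ?v, k) \<in> H'" by (rule H'3[OF h(1) yk(1) s1])
          moreover have eq: "a + ?v + of_nat k * s = a + of_nat k * s + ?v" for s
            by (simp add: add_ac)
          have "mono c ?I (a + ?v, k)"
            using h(2) unfolding mono_def d_def case_prod_conv eq .
          ultimately show ?thesis by blast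
        next
          assume "\<exists>f\<in>W. focused d H m f"
          then obtain f p col where f: "f \<in> W" and col: "inj_on col {..<m}"
            and p: "\<And>i. i < m \<Longrightarrow> p i \<in> H"
              "\<And>i. i < m \<Longrightarrow> fst (p i) + of_nat (snd (p i)) * s0 = f"
              "\<And>i. i < m \<Longrightarrow> col i < r"
              "\<And>i s. i < m \<Longrightarrow> s \<in> S \<Longrightarrow> d (fst (p i) + of_nat (snd (p i)) * s) = col i"
            unfolding focused_def by blast
          show ?thesis
          proof (cases "\<exists>i<m. col i = d f")
            case True
            then obtain i where i: "i < m" "col i = d f" by blast
            obtain a k where ak: "p i = (a,k)" by (cases "p i")
            have m: "d (a + of_nat k * s) = d f" if "s \<in> ?I" for s
              using that p(2)[OF i(1)] p(4)[OF i(1)] i(2) ak by auto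
            have "(a + ?v, k) \<in> H'"
              using H'3[OF _ yk(1) s1] p(1)[OF i(1)] ak by metis
            moreover have "mono c ?I (a + ?v, k)"
            proof -
              have "c (a + ?v + of_nat k * s) = d f" if "s \<in> ?I" for s
                using m[OF that] by (simp add: d_def add_ac)
              then show ?thesis unfolding mono_def by simp
            qed
            ultimately show ?thesis by blast
          next
            case False
            \<comment> \<open>The pattern on \<open>W\<close> is the same at all translates by
              \<open>y + of_nat k' * s\<close> with \<open>s \<in> S\<close>, so stretching keeps
              the colours of the copies \<open>p i\<close> and only moves their focus. The copy
              \<open>(f + y, k')\<close> has the colour of the old focus, which is new in this
              case.\<close>
            define q where "q = (\<lambda>i. if i < m then (fst (p i) + y, snd (p i) + k') else (f + y, k'))"
            define col' where "col' = (\<lambda>i. if i < m then col i else d f)"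
            have "focused c H' (Suc m) (f + (y + of_nat k' * s0))"
              unfolding focused_def
            proof (intro exI[of _ q] exI[of _ col'] conjI allI impI ballI)
              show "inj_on col' {..<Suc m}"
                using col False unfolding inj_on_def col'_def by (auto simp: less_Suc_eq)
            next
              fix i assume i: "i < Suc m"
              show "q i \<in> H'"
              proof (cases "i < m")
                case True
                then have "p i \<in> H" using p by blast
                moreover obtain a k where "p i = (a,k)" by (cases "p i")
                ultimately show ?thesis
                  using H'1[OF _ yk(1)] True unfolding q_def by simp
              next
                case False
                then show ?thesis
                  using H'2[OF f yk(1)] unfolding q_def by simp
              qed
              show "fst (q i) + of_nat (snd (q i)) * s0 = f + (y + of_nat k' * s0)"
                using p(2)[of i] by (auto simp: q_def algebra_simps)
              show "col' i < r" using p(3) c by (auto simp: col'_def d_def)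
              fix s assume s: "s \<in> S"
              show "c (fst (q i) + of_nat (snd (q i)) * s) = col' i"
              proof (cases "i < m")
                case True
                let ?w = "fst (p i) + of_nat (snd (p i)) * s"
                have "(fst (p i), snd (p i)) \<in> H" using p(1)[OF True] by simp
                then have w: "?w \<in> W" using inW s by blast
                have "fst (q i) + of_nat (snd (q i)) * s = ?w + (y + of_nat k' * s)"
                  using True by (simp add: q_def algebra_simps)
                then have "c (fst (q i) + of_nat (snd (q i)) * s) = c (?w + ?v)"
                  using same[OF s s1 w] by simp
                also have "\<dots> = col i" using p(4)[OF True s] by (simp add: d_def)
                finally show ?thesis using True by (simp add: col'_def)
              next
                case False
                then show ?thesis
                  using same[OF s s1 f] by (simp add: q_def col'_def d_def add_ac)
              qed
            qed
            moreover have "f + (y + of_nat k' * s0) \<in> W'" using W'I f yk(1) by blast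
            ultimately show ?thesis using nf by blast
          qed
        qed
      qed
      show ?case
        using fin pos cov main by (intro exI[of _ H'] exI[of _ W'] conjI) blast+
    qed
    from claim[of r] obtain H W where H: "finite H" "\<forall>(a,k)\<in>H. k > 0"
      and foc0: "\<forall>c. (\<forall>x. c x < r) \<longrightarrow> (\<exists>h\<in>H. mono c ?I h) \<or> (\<exists>f\<in>W. focused c H r f)"
      by (elim exE conjE)
    have "\<exists>h\<in>H. mono c ?I h" if c: "\<forall>x. c x < r" for c
      using mp[OF spec[OF foc0, of c] c]
    proof
      assume "\<exists>f\<in>W. focused c H r f"
      then obtain f p col where col: "inj_on col {..<r}"
        and p: "\<And>i. i < r \<Longrightarrow> p i \<in> H"
          "\<And>i. i < r \<Longrightarrow> fst (p i) + of_nat (snd (p i)) * s0 = f"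
          "\<And>i. i < r \<Longrightarrow> col i < r"
          "\<And>i s. i < r \<Longrightarrow> s \<in> S \<Longrightarrow> c (fst (p i) + of_nat (snd (p i)) * s) = col i"
        unfolding focused_def by blast
      \<comment> \<open>All \<open>r\<close> colours occur among the copies, so the focus shares the
        colour of one of them, and \<open>s0\<close> completes that copy.\<close>
      have "col ` {..<r} = {..<r}"
        using col p(3) by (intro endo_inj_surj) auto
      then obtain i where i: "i < r" "col i = c f" using c by (metis imageE lessThan_iff)
      have "c (fst (p i) + of_nat (snd (p i)) * s) = c f" if "s \<in> ?I" for s
        using that p(2)[OF i(1)] p(4)[OF i(1)] i(2) by auto
      then have "mono c ?I (p i)" unfolding mono_def by (simp add: case_prod_beta)
      then show ?thesis using p(1)[OF i(1)] by blast
    qed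
    then show ?thesis using H unfolding mono_def by (intro exI[of _ H]) auto
  qed
qed

section \<open>Self-similar cocycles are affine\<close>

text \<open>A second-order expansion. The linear term is kept exact because it sums to zero along a
  subdivided segment and is the affine part near a midpoint.\<close>

lemma norm_add_scaleR_unit_le:
  fixes v e :: "'a::real_inner"
  assumes "norm v = 1" "norm e \<le> A / 2" "A > 0"
  shows "norm (A *\<^sub>R v + e) \<le> A + e \<bullet> v + (norm e)\<^sup>2 / A"
proof -
  define p q where "p = e \<bullet> v" and "q = (norm e)\<^sup>2 / A"
  have p: "\<bar>p\<bar> \<le> A / 2"
    using Cauchy_Schwarz_ineq2[of e v] assms by (simp add: p_def)
  have q: "q \<ge> 0" "A * q = (norm e)\<^sup>2" using assms by (simp_all add: q_def)
  have "(norm (A *\<^sub>R v + e))\<^sup>2 = A\<^sup>2 * (norm v)\<^sup>2 + 2 * A * p + (norm e)\<^sup>2"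
    unfolding power2_norm_eq_inner p_def
    by (simp add: inner_left_distrib inner_right_distrib inner_commute power2_eq_square algebra_simps)
  also have "\<dots> \<le> (A + p)\<^sup>2 + A * q"
    using assms(1) q(2) by (simp add: power2_eq_square algebra_simps)
  also have "\<dots> \<le> (A + p)\<^sup>2 + 2 * (A + p) * q"
  proof -
    have "- (A / 2) \<le> p" using p by (simp add: abs_le_iff)
    then have "A \<le> 2 * (A + p)" by (simp add: field_simps)
    from mult_right_mono[OF this q(1)] show ?thesis by simp
  qed
  also have "\<dots> \<le> (A + p + q)\<^sup>2"
    by (simp add: power2_sum)
  finally have sq: "(norm (A *\<^sub>R v + e))\<^sup>2 \<le> (A + p + q)\<^sup>2" .
  have "0 \<le> A + p + q" using p q(1) assms(3) by linarith
  with sq have "norm (A *\<^sub>R v + e) \<le> A + p + q" by (rule power2_le_imp_le)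
  then show ?thesis by (simp add: p_def q_def)
qed

lemma norm_diff_le_via:
  fixes a b p q :: "'a::real_normed_vector"
  shows "norm (a - b) \<le> norm (p - q) + norm (a - p) + norm (b - q)"
proof -
  have "a - b = ((p - q) + (a - p)) - (b - q)" by simp
  then have "norm (a - b) = norm (((p - q) + (a - p)) - (b - q))" by (rule arg_cong)
  also have "\<dots> \<le> norm ((p - q) + (a - p)) + norm (b - q)" by (rule norm_triangle_ineq4)
  also have "\<dots> \<le> norm (p - q) + norm (a - p) + norm (b - q)"
    by (intro add_right_mono norm_triangle_ineq)
  finally show ?thesis .
qed

lemma exists_le_average:
  fixes g :: "nat \<Rightarrow> real"
  assumes "sum g {..<n} \<le> real n * x" "n > 0"
  shows "\<exists>i<n. g i \<le> x"
proof (rule ccontr)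
  assume "\<not> ?thesis"
  then have "(\<Sum>i<n. x) < sum g {..<n}"
    using assms(2) by (intro sum_strict_mono) auto
  then show False using assms by simp
qed

text \<open>Only differences of \<open>f\<close> matter. Distances are measured through
  \<open>\<psi>\<close>, where \<open>Q\<close> expands by at most \<open>\<rho>\<close> while
  \<open>f\<close> is expanded by exactly \<open>\<rho>\<close>; the target is an inner product
  space for the sake of the second-order estimate. \<open>rep\<close> moves a finite set near any
  point, and \<open>f_translate\<close> carries information back.\<close>

locale self_similar_cocycle =
  fixes C :: "'v::real_vector set" and \<psi> :: "'v \<Rightarrow> 'a::euclidean_space"
    and Q :: "'v \<Rightarrow> 'v" and f :: "'v \<Rightarrow> complex" and \<rho> R :: real
  assumes lin: "linear \<psi>"
    and Q_closed: "\<And>x. x \<in> C \<Longrightarrow> Q x \<in> C"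
    and Q_expansion: "\<And>x y. x \<in> C \<Longrightarrow> y \<in> C \<Longrightarrow>
        norm (\<psi> (Q x) - \<psi> (Q y)) \<le> \<rho> * norm (\<psi> x - \<psi> y)"
    and rho: "\<rho> > 1"
    and f_Q: "\<And>x y. x \<in> C \<Longrightarrow> y \<in> C \<Longrightarrow>
        cmod (f (Q x) - f (Q y)) = \<rho> * cmod (f x - f y)"
    and R: "R > 0"
    and dense: "\<And>x y t. x \<in> C \<Longrightarrow> y \<in> C \<Longrightarrow> 0 \<le> t \<Longrightarrow> t \<le> 1 \<Longrightarrow>
        \<exists>c\<in>C. norm (\<psi> c - (\<psi> x + t *\<^sub>R (\<psi> y - \<psi> x))) \<le> R"
    and bounded_variation: "\<And>r. \<exists>K. \<forall>x\<in>C. \<forall>y\<in>C. norm (\<psi> x - \<psi> y) \<le> r \<longrightarrow> cmod (f x - f y) \<le> K"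
    and rep: "\<And>F. finite F \<Longrightarrow> F \<subseteq> C \<Longrightarrow>
        \<exists>R'. \<forall>c\<in>C. \<exists>y. \<forall>x\<in>F. x + y \<in> C \<and> norm (\<psi> (x + y) - \<psi> c) \<le> R'"
    and f_translate: "\<And>x x' y. x \<in> C \<Longrightarrow> x' \<in> C \<Longrightarrow> x + y \<in> C \<Longrightarrow> x' + y \<in> C \<Longrightarrow>
        f (x + y) - f (x' + y) = f x - f x'"
begin

section \<open>Lipschitz bounds along chains of points\<close>

lemma subdivide:
  assumes "x \<in> C" "y \<in> C" "n > (0::nat)"
  obtains u where "u 0 = x" "u n = y" "\<And>i. i \<le> n \<Longrightarrow> u i \<in> C"
    "\<And>i. i \<le> n \<Longrightarrow> norm (\<psi> (u i) - (\<psi> x + (real i / real n) *\<^sub>R (\<psi> y - \<psi> x))) \<le> R"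
proof -
  have "\<exists>c\<in>C. norm (\<psi> c - (\<psi> x + (real i / real n) *\<^sub>R (\<psi> y - \<psi> x))) \<le> R" if "i \<le> n" for i
    using dense[OF assms(1,2), of "real i / real n"] that assms(3) by simp
  then obtain w where w: "\<And>i. i \<le> n \<Longrightarrow> w i \<in> C \<and>
      norm (\<psi> (w i) - (\<psi> x + (real i / real n) *\<^sub>R (\<psi> y - \<psi> x))) \<le> R" by metis
  \<comment> \<open>The end points are kept exact, so that sums along \<open>u\<close> telescope to
    the full differences of \<open>\<psi>\<close> and \<open>f\<close>.\<close>
  define u where "u i = (if i = 0 then x else if i = n then y else w i)" for i
  show ?thesis
    by (rule that[of u]) (use assms w R in \<open>auto simp: u_def\<close>)
qed

text \<open>Steps of length at most 1 on the segment become pairs in \<open>C\<close> at distance at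
  most \<open>1 + 2 * R\<close>, to which \<open>bounded_variation\<close> gives one constant; the
  number of steps is at most the distance plus 1.\<close>

lemma coarse_lipschitz:
  obtains K where "K > 0" "\<And>x y. x \<in> C \<Longrightarrow> y \<in> C \<Longrightarrow> cmod (f x - f y) \<le> K * (norm (\<psi> x - \<psi> y) + 2)"
proof -
  obtain K0 where K0: "\<forall>x\<in>C. \<forall>y\<in>C. norm (\<psi> x - \<psi> y) \<le> 1 + 2 * R \<longrightarrow> cmod (f x - f y) \<le> K0"
    using bounded_variation by blast
  define K where "K = max K0 1"
  have K: "K > 0" by (simp add: K_def)
  have Kb: "cmod (f x - f y) \<le> K" if "x \<in> C" "y \<in> C" "norm (\<psi> x - \<psi> y) \<le> 1 + 2 * R" for x y
    using K0 that by (fastforce simp: K_def)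
  have "cmod (f x - f y) \<le> K * (norm (\<psi> x - \<psi> y) + 2)" if xy: "x \<in> C" "y \<in> C" for x y
  proof -
    define T where "T = norm (\<psi> y - \<psi> x)"
    define n where "n = nat \<lfloor>T\<rfloor> + 1"
    have T: "T \<ge> 0" by (simp add: T_def)
    have n: "T \<le> real n" "real n \<le> T + 1" "n > 0" unfolding n_def using T by linarith+
    obtain u where u: "u 0 = x" "u n = y" "\<And>i. i \<le> n \<Longrightarrow> u i \<in> C"
      "\<And>i. i \<le> n \<Longrightarrow> norm (\<psi> (u i) - (\<psi> x + (real i / real n) *\<^sub>R (\<psi> y - \<psi> x))) \<le> R"
      using subdivide[OF xy n(3)] by blast
    have step: "cmod (f (u (Suc i)) - f (u i)) \<le> K" if i: "i < n" for i
    proof -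
      let ?l = "\<lambda>i. \<psi> x + (real i / real n) *\<^sub>R (\<psi> y - \<psi> x)"
      have "?l (Suc i) - ?l i = (1 / real n) *\<^sub>R (\<psi> y - \<psi> x)"
        by (simp add: add_divide_distrib scaleR_left_distrib)
      then have l1: "norm (?l (Suc i) - ?l i) \<le> 1"
        using n(1,3) by (simp add: T_def[symmetric])
      have "norm (\<psi> (u (Suc i)) - \<psi> (u i)) \<le> norm (?l (Suc i) - ?l i)
          + norm (\<psi> (u (Suc i)) - ?l (Suc i)) + norm (\<psi> (u i) - ?l i)"
        by (rule norm_diff_le_via)
      also have "\<dots> \<le> 1 + 2 * R" using l1 u(4)[of i] u(4)[of "Suc i"] i by simp
      finally show ?thesis using Kb u(3) i by simp
    qed
    have "f y - f x = (\<Sum>i<n. f (u (Suc i)) - f (u i))"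
      using u(1,2) sum_lessThan_telescope[of "\<lambda>i. f (u i)" n] by simp
    then have "cmod (f y - f x) \<le> (\<Sum>i<n. cmod (f (u (Suc i)) - f (u i)))"
      by (simp add: norm_sum)
    also have "\<dots> \<le> (\<Sum>i<n. K)" using step by (intro sum_mono) auto
    also have "\<dots> \<le> K * (T + 2)" using n(2) K by (simp add: mult.commute)
    finally show ?thesis by (simp add: T_def norm_minus_commute)
  qed
  then show ?thesis using that K by blast
qed

lemma iterate_closed: "x \<in> C \<Longrightarrow> (Q ^^ k) x \<in> C"
  by (induction k) (auto intro: Q_closed)

lemma iterate_expansion:
  assumes "x \<in> C" "y \<in> C"
  shows "norm (\<psi> ((Q ^^ k) x) - \<psi> ((Q ^^ k) y)) \<le> \<rho> ^ k * norm (\<psi> x - \<psi> y)"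
proof (induction k)
  case (Suc k)
  have "norm (\<psi> ((Q ^^ Suc k) x) - \<psi> ((Q ^^ Suc k) y))
      \<le> \<rho> * norm (\<psi> ((Q ^^ k) x) - \<psi> ((Q ^^ k) y))"
    using Q_expansion iterate_closed assms by simp
  also have "\<dots> \<le> \<rho> * (\<rho> ^ k * norm (\<psi> x - \<psi> y))"
    using Suc rho by (intro mult_left_mono) auto
  finally show ?case by simp
qed simp

lemma iterate_f:
  assumes "x \<in> C" "y \<in> C"
  shows "cmod (f ((Q ^^ k) x) - f ((Q ^^ k) y)) = \<rho> ^ k * cmod (f x - f y)"
  by (induction k) (use assms in \<open>auto simp: f_Q iterate_closed\<close>)

text \<open>The additive constant of the coarse bound disappears when it is applied to the iterates
  under \<open>Q\<close> and divided by \<open>\<rho> ^ k\<close>.\<close>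
lemma lipschitz:
  obtains K where "K > 0" "\<And>x y. x \<in> C \<Longrightarrow> y \<in> C \<Longrightarrow> cmod (f x - f y) \<le> K * norm (\<psi> x - \<psi> y)"
proof -
  obtain K where K: "K > 0"
    "\<And>x y. x \<in> C \<Longrightarrow> y \<in> C \<Longrightarrow> cmod (f x - f y) \<le> K * (norm (\<psi> x - \<psi> y) + 2)"
    using coarse_lipschitz by blast
  have "cmod (f x - f y) \<le> K * norm (\<psi> x - \<psi> y)" if xy: "x \<in> C" "y \<in> C" for x y
  proof (rule LIMSEQ_le_const)
    show "(\<lambda>k. K * norm (\<psi> x - \<psi> y) + 2 * K * (1 / \<rho>) ^ k) \<longlonglongrightarrow> K * norm (\<psi> x - \<psi> y)"
      using rho by (auto intro!: tendsto_eq_intros LIMSEQ_power_zero)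
    have "cmod (f x - f y) \<le> K * norm (\<psi> x - \<psi> y) + 2 * K * (1 / \<rho>) ^ k" for k
    proof -
      have "\<rho> ^ k * cmod (f x - f y) \<le> K * (norm (\<psi> ((Q ^^ k) x) - \<psi> ((Q ^^ k) y)) + 2)"
        using K(2)[OF iterate_closed[OF xy(1), of k] iterate_closed[OF xy(2), of k]] iterate_f[OF xy, of k] by simp
      also have "\<dots> \<le> K * (\<rho> ^ k * norm (\<psi> x - \<psi> y) + 2)"
        using iterate_expansion[OF xy, of k] K(1) by simp
      also have "\<dots> = \<rho> ^ k * (K * norm (\<psi> x - \<psi> y) + 2 * K * (1 / \<rho>) ^ k)"
        using rho by (simp add: algebra_simps power_divide)
      finally show ?thesis using rho by (simp add: mult_le_cancel_left_pos)
    qed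
    then show "\<exists>N. \<forall>n\<ge>N. cmod (f x - f y) \<le> K * norm (\<psi> x - \<psi> y) + 2 * K * (1 / \<rho>) ^ n"
      by blast
  qed
  then show ?thesis using that K(1) by blast
qed

section \<open>Pairs of nearly maximal slope and flat balls\<close>

definition slopes :: "real set" where
  "slopes = {cmod (f x - f y) / norm (\<psi> x - \<psi> y) | x y. x \<in> C \<and> y \<in> C \<and> \<psi> x \<noteq> \<psi> y}"

definition M :: real where "M = Sup slopes"

lemma bdd_slopes: "bdd_above slopes"
proof -
  obtain K where K: "K > 0" "\<And>x y. x \<in> C \<Longrightarrow> y \<in> C \<Longrightarrow> cmod (f x - f y) \<le> K * norm (\<psi> x - \<psi> y)"
    using lipschitz by blast
  show ?thesis
    unfolding slopes_def by (intro bdd_aboveI[of _ K]) (auto simp: divide_le_eq K)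
qed

lemma le_M:
  assumes "x \<in> C" "y \<in> C"
  shows "cmod (f x - f y) \<le> M * norm (\<psi> x - \<psi> y)"
proof (cases "\<psi> x = \<psi> y")
  case True
  then show ?thesis using lipschitz assms by (metis diff_self norm_zero mult_zero_right)
next
  case False
  then have "cmod (f x - f y) / norm (\<psi> x - \<psi> y) \<le> M"
    unfolding M_def using assms bdd_slopes by (intro cSup_upper) (auto simp: slopes_def)
  then show ?thesis using False by (simp add: divide_le_eq)
qed

text \<open>Powers of \<open>Q\<close> do not lower the slope of a pair. They lengthen it as well:
  the difference of \<open>f\<close> grows like \<open>\<rho> ^ k\<close>, and the distance is at
  least this difference divided by \<open>M\<close>.\<close>

lemma large_optimal:
  assumes nontrivial: "x0 \<in> C" "y0 \<in> C" "f x0 \<noteq> f y0" and "\<epsilon> > 0"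
  obtains a b where "a \<in> C" "b \<in> C" "norm (\<psi> a - \<psi> b) \<ge> T0"
    "cmod (f a - f b) \<ge> (M - \<epsilon>) * norm (\<psi> a - \<psi> b)"
proof -
  have ne: "\<psi> x0 \<noteq> \<psi> y0" using le_M[OF nontrivial(1,2)] nontrivial(3) by auto
  then have sl: "cmod (f x0 - f y0) / norm (\<psi> x0 - \<psi> y0) \<in> slopes"
    unfolding slopes_def using nontrivial by blast
  have "0 < cmod (f x0 - f y0) / norm (\<psi> x0 - \<psi> y0)" using nontrivial ne by simp
  also have "\<dots> \<le> M" unfolding M_def using sl bdd_slopes by (rule cSup_upper)
  finally have M: "M > 0" .
  \<comment> \<open>The cap \<open>M / 2\<close> keeps \<open>M - \<delta>\<close> positive, so that
    the chosen pair has distinct values of \<open>f\<close> and bounds on distances can be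
    multiplied by \<open>M - \<delta>\<close>.\<close>
  define \<delta> where "\<delta> = min \<epsilon> (M / 2)"
  have "M - \<delta> < Sup slopes" using M assms(4) by (simp add: M_def[symmetric] \<delta>_def)
  then obtain s where s: "s \<in> slopes" "M - \<delta> < s" using sl by (metis less_cSup_iff bdd_slopes empty_iff)
  then obtain a b where ab: "a \<in> C" "b \<in> C" "\<psi> a \<noteq> \<psi> b"
    "M - \<delta> < cmod (f a - f b) / norm (\<psi> a - \<psi> b)" unfolding slopes_def by blast
  then have ab4: "(M - \<delta>) * norm (\<psi> a - \<psi> b) < cmod (f a - f b)" by (simp add: less_divide_eq)
  have pos: "cmod (f a - f b) > 0"
  proof -
    have "M - \<delta> > 0" using M by (auto simp: \<delta>_def min_def)
    then have "(M - \<delta>) * norm (\<psi> a - \<psi> b) > 0" using ab(3) by simp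
    then show ?thesis using ab4 by linarith
  qed
  obtain k where k: "\<rho> ^ k > M * T0 / cmod (f a - f b)" using real_arch_pow[OF rho] by blast
  define a' b' where "a' = (Q ^^ k) a" and "b' = (Q ^^ k) b"
  have C': "a' \<in> C" "b' \<in> C" by (auto simp: a'_def b'_def iterate_closed ab)
  have fk: "cmod (f a' - f b') = \<rho> ^ k * cmod (f a - f b)"
    unfolding a'_def b'_def by (rule iterate_f[OF ab(1,2)])
  have "M * T0 < \<rho> ^ k * cmod (f a - f b)" using k pos by (simp add: divide_less_eq)
  also have "\<dots> \<le> M * norm (\<psi> a' - \<psi> b')" using le_M[OF C'] fk by simp
  finally have big: "norm (\<psi> a' - \<psi> b') \<ge> T0" using M by simp
  have "(M - \<epsilon>) * norm (\<psi> a' - \<psi> b') \<le> (M - \<delta>) * norm (\<psi> a' - \<psi> b')"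
    by (intro mult_right_mono) (auto simp: \<delta>_def)
  also have "\<dots> \<le> (M - \<delta>) * (\<rho> ^ k * norm (\<psi> a - \<psi> b))"
    unfolding a'_def b'_def using iterate_expansion[OF ab(1,2)] M
    by (intro mult_left_mono) (auto simp: \<delta>_def min_def)
  also have "\<dots> \<le> \<rho> ^ k * cmod (f a - f b)"
    using ab4 rho by (simp add: mult.left_commute)
  finally show ?thesis using that[OF C' big] fk by simp
qed

text \<open>The upper bound from \<open>w\<close> and the lower bound from \<open>u\<close> have the
  same affine part: moving \<open>x\<close> by \<open>e\<close> from the midpoint changes its
  distances to the two ends by at most \<open>e \<bullet> v\<close> and
  \<open>- (e \<bullet> v)\<close>, up to a quadratic error. The condition on \<open>r\<close> is
  that of the second-order estimate for half the segment.\<close>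

lemma near_midpoint:
  assumes uw: "w \<in> C" "u \<in> C" and h: "\<And>x y. x \<in> C \<Longrightarrow> y \<in> C \<Longrightarrow> h x - h y \<le> M * norm (\<psi> x - \<psi> y)"
    and l: "l = norm (\<psi> u - \<psi> w)" "l > 0" and r: "r \<le> l / 4" and M0: "M \<ge> 0"
    and gap: "M * l - (h u - h w) \<le> g"
    and x: "x \<in> C" "norm (\<psi> x - (\<psi> w + (1/2) *\<^sub>R (\<psi> u - \<psi> w))) \<le> r"
  shows "\<bar>h x - (h w + M * l / 2 + M * ((\<psi> x - (\<psi> w + (1/2) *\<^sub>R (\<psi> u - \<psi> w))) \<bullet> ((\<psi> u - \<psi> w) /\<^sub>R l)))\<bar>
      \<le> g + 2 * M * r\<^sup>2 / l"
proof -
  define v where "v = (\<psi> u - \<psi> w) /\<^sub>R l"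
  define e where "e = \<psi> x - (\<psi> w + (1/2) *\<^sub>R (\<psi> u - \<psi> w))"
  have v: "norm v = 1" using l by (simp add: v_def)
  have d: "\<psi> u - \<psi> w = l *\<^sub>R v" using l by (simp add: v_def)
  have e: "norm e \<le> r" using x(2) by (simp add: e_def)
  have e': "norm e \<le> (l / 2) / 2" "norm (- e) \<le> (l / 2) / 2" using e r by auto
  have sq: "(norm e)\<^sup>2 / (l / 2) \<le> 2 * r\<^sup>2 / l"
    using power_mono[OF e, of 2] l(2) by (simp add: divide_right_mono)
  have "\<psi> x - \<psi> w = (l / 2) *\<^sub>R v + e" using d by (simp add: e_def)
  then have n1: "norm (\<psi> x - \<psi> w) \<le> l / 2 + e \<bullet> v + 2 * r\<^sup>2 / l"
    using norm_add_scaleR_unit_le[OF v e'(1)] l(2) sq by simp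
  have "\<psi> u - \<psi> x = (\<psi> u - \<psi> w) - (1/2) *\<^sub>R (\<psi> u - \<psi> w) - e" by (simp add: e_def)
  also have "\<dots> = (l / 2) *\<^sub>R v + (- e)" unfolding d
    by (simp add: scaleR_left_diff_distrib[symmetric])
  finally have n2: "norm (\<psi> u - \<psi> x) \<le> l / 2 - e \<bullet> v + 2 * r\<^sup>2 / l"
    using norm_add_scaleR_unit_le[OF v e'(2)] l(2) sq by simp
  have "h x - h w \<le> M * (l / 2 + e \<bullet> v + 2 * r\<^sup>2 / l)"
    using h[OF x(1) uw(1)] mult_left_mono[OF n1 M0] by linarith
  then have up: "h x \<le> h w + M * l / 2 + M * (e \<bullet> v) + 2 * M * r\<^sup>2 / l"
    by (simp add: algebra_simps)
  have "h u - h x \<le> M * (l / 2 - e \<bullet> v + 2 * r\<^sup>2 / l)"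
    using h[OF uw(2) x(1)] mult_left_mono[OF n2 M0] by linarith
  also have "\<dots> = M * l / 2 - M * (e \<bullet> v) + 2 * M * r\<^sup>2 / l"
    by (simp add: algebra_simps)
  finally have low: "h x \<ge> h w + M * l / 2 + M * (e \<bullet> v) - g - 2 * M * r\<^sup>2 / l"
    using gap by (simp add: field_simps)
  have "h u - h w \<le> M * l" unfolding l(1) by (rule h[OF uw(2,1)])
  then have "g \<ge> 0" using gap by linarith
  then show ?thesis using up low unfolding e_def[symmetric] v_def[symmetric] by linarith
qed

text \<open>A nearly extremal pair has a small defect per unit of length, but its length has no
  upper bound, so its total defect need not be small. Cutting it into pieces of bounded length and
  averaging yields one piece of small total defect; the ball lies near the midpoint of that
  piece.\<close>

lemma locally_flat:
  assumes nontrivial: "x0 \<in> C" "y0 \<in> C" "f x0 \<noteq> f y0" and "\<eta> > 0" "r > 0"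
    and \<Omega>: "\<And>x y. x \<in> C \<Longrightarrow> y \<in> C \<Longrightarrow> \<exists>\<omega>\<in>\<Omega>. cmod \<omega> = 1 \<and> Re (\<omega> * (f x - f y)) = cmod (f x - f y)"
  obtains c v \<omega> where "c \<in> C" "norm v = 1" "\<omega> \<in> \<Omega>" "cmod \<omega> = 1"
    "\<And>x y. x \<in> C \<Longrightarrow> y \<in> C \<Longrightarrow> norm (\<psi> x - \<psi> c) \<le> r \<Longrightarrow> norm (\<psi> y - \<psi> c) \<le> r \<Longrightarrow>
       \<bar>Re (\<omega> * (f x - f y)) - M * ((\<psi> x - \<psi> y) \<bullet> v)\<bar> \<le> \<eta>"
proof -
  have M0: "M > 0"
  proof (rule ccontr)
    assume "\<not> M > 0"
    then have "M * norm (\<psi> x0 - \<psi> y0) \<le> 0" by (simp add: mult_nonpos_nonneg)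
    then show False using le_M[OF nontrivial(1,2)] nontrivial(3) by (metis order_trans norm_le_zero_iff right_minus_eq)
  qed
  define r1 where "r1 = r + R"
  have r1: "r1 > 0" "R \<le> r1" using assms R by (auto simp: r1_def)
  \<comment> \<open>The first summand ensures \<open>r1 \<le> l / 4\<close> for a piece of length
    \<open>l \<ge> \<tau> / 2\<close>; the second keeps the quadratic errors below a fraction of
    \<open>\<eta>\<close>.\<close>
  define \<tau> where "\<tau> = 8 * r1 + 24 * M * r1\<^sup>2 / \<eta>"
  have \<tau>: "\<tau> > 0" "8 * r1 \<le> \<tau>" "24 * M * r1\<^sup>2 / \<eta> \<le> \<tau>"
    using r1 M0 assms(4) by (auto simp: \<tau>_def add_pos_nonneg)
  have \<tau>3: "8 * M * r1\<^sup>2 / \<tau> \<le> \<eta> / 3"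
    using \<tau> assms(4) by (simp add: field_simps)
  \<comment> \<open>The nominal length of a piece is \<open>s \<le> 2 * \<tau>\<close>, so its share
    \<open>\<epsilon> * s\<close> of the defect is at most \<open>\<eta> / 6\<close>.\<close>
  define \<epsilon> where "\<epsilon> = \<eta> / (12 * \<tau>)"
  have \<epsilon>: "\<epsilon> > 0" using assms(4) \<tau> by (simp add: \<epsilon>_def)
  obtain a b where ab: "a \<in> C" "b \<in> C" "norm (\<psi> a - \<psi> b) \<ge> \<tau>"
    "cmod (f a - f b) \<ge> (M - \<epsilon>) * norm (\<psi> a - \<psi> b)"
    using large_optimal[OF nontrivial \<epsilon>] by blast
  define T where "T = norm (\<psi> a - \<psi> b)"
  have T: "T \<ge> \<tau>" "T > 0" using ab(3) \<tau>(1) by (auto simp: T_def)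
  define v0 where "v0 = (\<psi> a - \<psi> b) /\<^sub>R T"
  have v0: "norm v0 = 1" "\<psi> a - \<psi> b = T *\<^sub>R v0" using T by (auto simp: v0_def T_def)
  obtain \<omega> where \<omega>: "\<omega> \<in> \<Omega>" "cmod \<omega> = 1" "Re (\<omega> * (f a - f b)) = cmod (f a - f b)"
    using \<Omega>[OF ab(1,2)] by blast
  define h where "h x = Re (\<omega> * f x)" for x
  have h: "h x - h y \<le> M * norm (\<psi> x - \<psi> y)" if "x \<in> C" "y \<in> C" for x y
  proof -
    have "h x - h y = Re (\<omega> * (f x - f y))" by (simp add: h_def algebra_simps)
    also have "\<dots> \<le> cmod (f x - f y)" using complex_Re_le_cmod[of "\<omega> * (f x - f y)"] \<omega>(2)
      by (simp add: norm_mult)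
    finally show ?thesis using le_M[OF that] by linarith
  qed
  define n where "n = nat \<lfloor>T / \<tau>\<rfloor>"
  have "T / \<tau> \<ge> 1" using T \<tau> by simp
  then have n: "n > 0" "real n \<le> T / \<tau>" "T / \<tau> < real n + 1" unfolding n_def by linarith+
  then have n1: "real n \<ge> 1" by simp
  define s where "s = T / real n"
  have ns: "real n * s = T" using n by (simp add: s_def)
  have s1: "\<tau> \<le> s" using n \<tau> T by (simp add: s_def field_simps)
  have s2: "s \<le> 2 * \<tau>"
  proof -
    have "T \<le> (real n + 1) * \<tau>" using n(3) \<tau>(1) by (simp add: divide_less_eq)
    also have "\<dots> \<le> (2 * real n) * \<tau>" using n1 \<tau>(1) by (intro mult_right_mono) auto
    finally show ?thesis using n by (simp add: s_def field_simps)
  qed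
  have s0: "s > 0" using s1 \<tau> by linarith
  obtain u where u: "u 0 = b" "u n = a" "\<And>i. i \<le> n \<Longrightarrow> u i \<in> C"
    "\<And>i. i \<le> n \<Longrightarrow> norm (\<psi> (u i) - (\<psi> b + (real i / real n) *\<^sub>R (\<psi> a - \<psi> b))) \<le> R"
    using subdivide[OF ab(2,1) n(1)] by blast
  define e where "e i = \<psi> (u (Suc i)) - \<psi> (u i) - s *\<^sub>R v0" for i
  have e: "norm (e i) \<le> 2 * R" if "i < n" for i
  proof -
    let ?l = "\<lambda>i. \<psi> b + (real i / real n) *\<^sub>R (\<psi> a - \<psi> b)"
    have "?l (Suc i) - ?l i = s *\<^sub>R v0"
      unfolding v0(2) by (simp add: add_divide_distrib scaleR_left_distrib s_def algebra_simps)
    then have "e i = (\<psi> (u (Suc i)) - ?l (Suc i)) - (\<psi> (u i) - ?l i)"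
      unfolding e_def by (simp add: algebra_simps)
    then have "norm (e i) \<le> norm (\<psi> (u (Suc i)) - ?l (Suc i)) + norm (\<psi> (u i) - ?l i)"
      using norm_triangle_ineq4 by metis
    also have "\<dots> \<le> 2 * R" using u(4)[of i] u(4)[of "Suc i"] that by simp
    finally show ?thesis .
  qed
  have len: "norm (\<psi> (u (Suc i)) - \<psi> (u i)) \<le> s + e i \<bullet> v0 + 4 * R\<^sup>2 / s" if "i < n" for i
  proof -
    have "norm (s *\<^sub>R v0 + e i) \<le> s + e i \<bullet> v0 + (norm (e i))\<^sup>2 / s"
      using e[OF that] r1 \<tau>(2) s1 s0 by (intro norm_add_scaleR_unit_le v0) auto
    moreover have "(norm (e i))\<^sup>2 / s \<le> 4 * R\<^sup>2 / s"
      using power_mono[OF e[OF that], of 2] s0 by (intro divide_right_mono) (auto simp: power2_eq_square)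
    ultimately show ?thesis by (simp add: e_def)
  qed
  (* Deviations of size R from the segment lengthen a step of length s by O(R^2 / s) only. *)
  define g where "g i = M * norm (\<psi> (u (Suc i)) - \<psi> (u i)) - (h (u (Suc i)) - h (u i))" for i
  \<comment> \<open>The chain ends exactly at \<open>a\<close> and \<open>b\<close>, so the
    first-order deviations cancel and the total length exceeds \<open>T\<close> by at most the
    quadratic terms.\<close>
  have "(\<Sum>i<n. e i) = 0"
  proof -
    have "(\<Sum>i<n. e i) = (\<Sum>i<n. \<psi> (u (Suc i)) - \<psi> (u i)) - (\<Sum>i<n. s *\<^sub>R v0)"
      by (simp add: e_def sum_subtractf)
    also have "(\<Sum>i<n. \<psi> (u (Suc i)) - \<psi> (u i)) = T *\<^sub>R v0"
      using sum_lessThan_telescope[of "\<lambda>i. \<psi> (u i)" n] u(1,2) v0(2) by simp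
    also have "(\<Sum>i<n. s *\<^sub>R v0) = T *\<^sub>R v0" using ns by (simp add: scaleR_left.sum[symmetric])
    finally show ?thesis by simp
  qed
  then have sum_e: "(\<Sum>i<n. e i \<bullet> v0) = 0" by (simp add: inner_sum_left[symmetric])
  have "(\<Sum>i<n. norm (\<psi> (u (Suc i)) - \<psi> (u i))) \<le> (\<Sum>i<n. s + e i \<bullet> v0 + 4 * R\<^sup>2 / s)"
    using len by (intro sum_mono) auto
  also have "\<dots> = T + real n * (4 * R\<^sup>2 / s)"
    using sum_e ns by (simp add: sum.distrib)
  finally have "M * (\<Sum>i<n. norm (\<psi> (u (Suc i)) - \<psi> (u i))) \<le> M * (T + real n * (4 * R\<^sup>2 / s))"
    using M0 by simp
  moreover have "(\<Sum>i<n. h (u (Suc i)) - h (u i)) = cmod (f a - f b)"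
    using sum_lessThan_telescope[of "\<lambda>i. h (u i)" n] u(1,2) \<omega>(3) by (simp add: h_def algebra_simps)
  ultimately have "sum g {..<n} \<le> M * (T + real n * (4 * R\<^sup>2 / s)) - (M - \<epsilon>) * T"
    using ab(4) by (simp add: g_def sum_subtractf sum_distrib_left[symmetric] T_def)
  also have "\<dots> = real n * (\<epsilon> * s + 4 * M * R\<^sup>2 / s)"
    by (simp add: ns[symmetric] algebra_simps)
  finally obtain i where i: "i < n" "g i \<le> \<epsilon> * s + 4 * M * R\<^sup>2 / s"
    using exists_le_average n(1) by blast
  have "\<epsilon> * s \<le> \<eta> / 6"
    using mult_left_mono[OF s2, of \<epsilon>] \<epsilon> \<tau>(1) by (simp add: \<epsilon>_def)
  moreover have "4 * M * R\<^sup>2 / s \<le> 4 * M * r1\<^sup>2 / \<tau>"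
    using r1 R M0 s1 \<tau>(1) by (intro frac_le mult_left_mono power_mono) auto
  ultimately have gi: "g i \<le> \<eta> / 6 + \<eta> / 6" using i(2) \<tau>3 by linarith
  define l where "l = norm (\<psi> (u (Suc i)) - \<psi> (u i))"
  have l: "\<tau> / 2 \<le> l"
  proof -
    have "s = norm (s *\<^sub>R v0)" using v0 s0 by simp
    also have "s *\<^sub>R v0 = \<psi> (u (Suc i)) - \<psi> (u i) - e i" by (simp add: e_def)
    also have "norm \<dots> \<le> l + norm (e i)" unfolding l_def by (rule norm_triangle_ineq4)
    finally show ?thesis using e[OF i(1)] s1 r1 \<tau>(2) by linarith
  qed
  have l0: "l > 0" using l \<tau>(1) by linarith
  define v where "v = (\<psi> (u (Suc i)) - \<psi> (u i)) /\<^sub>R l"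
  have v: "norm v = 1" using l0 by (simp add: v_def l_def)
  define z where "z = \<psi> (u i) + (1/2) *\<^sub>R (\<psi> (u (Suc i)) - \<psi> (u i))"
  have ui: "u i \<in> C" "u (Suc i) \<in> C" using u(3) i(1) by auto
  obtain c where c: "c \<in> C" "norm (\<psi> c - z) \<le> R"
    using dense[OF ui, of "1/2"] unfolding z_def by auto
  define A where "A = h (u i) + M * l / 2"
  have near: "\<bar>h x - (A + M * ((\<psi> x - z) \<bullet> v))\<bar> \<le> \<eta> / 2"
    if x: "x \<in> C" "norm (\<psi> x - \<psi> c) \<le> r" for x
  proof -
    have "norm (\<psi> x - z) \<le> r1"
      using norm_triangle_ineq[of "\<psi> x - \<psi> c" "\<psi> c - z"] x(2) c(2) by (simp add: r1_def)
    then have "\<bar>h x - (A + M * ((\<psi> x - z) \<bullet> v))\<bar> \<le> g i + 2 * M * r1\<^sup>2 / l"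
      unfolding A_def z_def v_def using ui x(1) l0 M0 l \<tau>(2)
      by (intro near_midpoint h) (auto simp: g_def l_def)
    moreover have "2 * M * r1\<^sup>2 / l \<le> 2 * M * r1\<^sup>2 / (\<tau> / 2)"
      using l \<tau>(1) M0 by (intro divide_left_mono) auto
    ultimately show ?thesis using gi \<tau>3 by simp
  qed
  show ?thesis
  proof (rule that[OF c(1) v \<omega>(1,2)])
    fix x y assume "x \<in> C" "y \<in> C" "norm (\<psi> x - \<psi> c) \<le> r" "norm (\<psi> y - \<psi> c) \<le> r"
    then have "\<bar>h x - (A + M * ((\<psi> x - z) \<bullet> v))\<bar> \<le> \<eta> / 2" "\<bar>h y - (A + M * ((\<psi> y - z) \<bullet> v))\<bar> \<le> \<eta> / 2"
      using near by blast+
    moreover have "M * ((\<psi> x - \<psi> y) \<bullet> v) = M * ((\<psi> x - z) \<bullet> v) - M * ((\<psi> y - z) \<bullet> v)"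
      by (simp add: inner_diff_left algebra_simps)
    moreover have "Re (\<omega> * (f x - f y)) = h x - h y" by (simp add: h_def algebra_simps)
    ultimately show "\<bar>Re (\<omega> * (f x - f y)) - M * ((\<psi> x - \<psi> y) \<bullet> v)\<bar> \<le> \<eta>" by linarith
  qed
qed

text \<open>The set \<open>\<Omega>\<close> of phases makes it possible to keep \<open>\<omega>\<close> real when \<open>f\<close> is real.\<close>
theorem affine:
  assumes \<Omega>: "\<And>x y. x \<in> C \<Longrightarrow> y \<in> C \<Longrightarrow> \<exists>\<omega>\<in>\<Omega>. cmod \<omega> = 1 \<and> Re (\<omega> * (f x - f y)) = cmod (f x - f y)"
    and "closed \<Omega>" "C \<noteq> {}"
  obtains \<omega> v where "\<omega> \<in> \<Omega>" "cmod \<omega> = 1"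
    "\<And>x y. x \<in> C \<Longrightarrow> y \<in> C \<Longrightarrow> Re (\<omega> * (f x - f y)) = (\<psi> x - \<psi> y) \<bullet> v"
proof (cases "\<exists>x0\<in>C. \<exists>y0\<in>C. f x0 \<noteq> f y0")
  case False
  then have c: "f x = f y" if "x \<in> C" "y \<in> C" for x y using that by blast
  obtain x0 where "x0 \<in> C" using assms(3) by blast
  then obtain \<omega> where "\<omega> \<in> \<Omega>" "cmod \<omega> = 1" using \<Omega> by blast
  then show ?thesis using that[of \<omega> 0] c by (metis diff_self mult_zero_right zero_complex.sel(1) inner_zero_right)
next
  case True
  then obtain x0 y0 where nt: "x0 \<in> C" "y0 \<in> C" "f x0 \<noteq> f y0" by blast
  \<comment> \<open>Phases and unit directions range over a compact set and each inequality in
    \<open>Z\<close> cuts out a closed part of it, so it is enough to satisfy finitely many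
    inequalities with one pair \<open>(\<omega>, v)\<close>.\<close>
  define K :: "(complex \<times> 'a) set" where "K = (\<Omega> \<inter> sphere 0 1) \<times> sphere 0 1"
  have K: "compact K" unfolding K_def using assms(2)
    by (intro compact_Times closed_Int_compact compact_sphere)
  define Z where "Z = (\<lambda>(x,y,\<eta>). {p :: complex \<times> 'a. \<bar>Re (fst p * (f x - f y)) - M * ((\<psi> x - \<psi> y) \<bullet> snd p)\<bar> \<le> \<eta>})"
  define I where "I = C \<times> C \<times> {0<..(1::real)}"
  have "K \<inter> \<Inter>(Z ` I) \<noteq> {}"
  proof (rule compact_imp_fip[OF K])
    fix T assume "T \<in> Z ` I"
    then show "closed T" unfolding Z_def
      by (auto intro!: closed_Collect_le continuous_intros)
  next
    fix \<F> assume "finite \<F>" "\<F> \<subseteq> Z ` I"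
    then obtain J where J: "finite J" "J \<subseteq> I" "\<F> = Z ` J" by (meson finite_subset_image)
    define F where "F = insert x0 (fst ` J \<union> (fst \<circ> snd) ` J)"
    have F: "finite F" "F \<subseteq> C" unfolding F_def using J nt by (auto simp: I_def)
    define \<eta> where "\<eta> = Min (insert 1 ((snd \<circ> snd) ` J))"
    have \<eta>: "\<eta> > 0" unfolding \<eta>_def using J by (subst Min_gr_iff) (auto simp: I_def)
    have \<eta>le: "\<eta> \<le> e" if "(x,y,e) \<in> J" for x y e
      unfolding \<eta>_def using J that by (intro Min_le) force+
    obtain R' where R': "\<forall>c\<in>C. \<exists>y. \<forall>x\<in>F. x + y \<in> C \<and> norm (\<psi> (x + y) - \<psi> c) \<le> R'"
      using rep[OF F] by blast
    have "max R' 1 > 0" by simp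
    from locally_flat[OF nt \<eta> this \<Omega>] obtain c v \<omega> where
      c: "c \<in> C" "norm v = 1" "\<omega> \<in> \<Omega>" "cmod \<omega> = 1"
      and fl: "\<And>x y. x \<in> C \<Longrightarrow> y \<in> C \<Longrightarrow> norm (\<psi> x - \<psi> c) \<le> max R' 1 \<Longrightarrow> norm (\<psi> y - \<psi> c) \<le> max R' 1 \<Longrightarrow>
       \<bar>Re (\<omega> * (f x - f y)) - M * ((\<psi> x - \<psi> y) \<bullet> v)\<bar> \<le> \<eta>" by metis
    \<comment> \<open>The points of \<open>F\<close> are moved together into the flat ball.
      Differences of \<open>f\<close> and of \<open>\<psi>\<close> do not change, so the flatness
      found there holds for the original points.\<close>
    obtain y0 where y0: "\<forall>x\<in>F. x + y0 \<in> C \<and> norm (\<psi> (x + y0) - \<psi> c) \<le> R'" using R' c(1) by blast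
    have "(\<omega>, v) \<in> Z j" if j: "j \<in> J" for j
    proof -
      obtain x y e where xy: "j = (x,y,e)" by (cases j) auto
      have mem: "x \<in> F" "y \<in> F" unfolding F_def using j xy by force+
      then have xyC: "x \<in> C" "y \<in> C" using F by auto
      have *: "f (x + y0) - f (y + y0) = f x - f y"
        using f_translate[OF xyC] y0 mem by blast
      have **: "\<psi> (x + y0) - \<psi> (y + y0) = \<psi> x - \<psi> y"
        using lin by (simp add: linear_add)
      have "\<bar>Re (\<omega> * (f (x + y0) - f (y + y0))) - M * ((\<psi> (x + y0) - \<psi> (y + y0)) \<bullet> v)\<bar> \<le> \<eta>"
        using y0 mem by (intro fl) (auto simp: le_max_iff_disj)
      then show ?thesis unfolding xy Z_def * ** using \<eta>le j xy by force
    qed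
    then have "(\<omega>, v) \<in> K \<inter> \<Inter>\<F>" using c J unfolding K_def by auto
    then show "K \<inter> \<Inter>\<F> \<noteq> {}" by blast
  qed
  then obtain \<omega> v where wv: "(\<omega>, v) \<in> K" "\<And>j. j \<in> I \<Longrightarrow> (\<omega>, v) \<in> Z j" by auto
  show ?thesis
  proof (rule that[of \<omega> "M *\<^sub>R v"])
    show "\<omega> \<in> \<Omega>" "cmod \<omega> = 1" using wv(1) by (auto simp: K_def)
    fix x y assume xy: "x \<in> C" "y \<in> C"
    define d where "d = \<bar>Re (\<omega> * (f x - f y)) - M * ((\<psi> x - \<psi> y) \<bullet> v)\<bar>"
    have "d \<le> e" if "0 < e" "e \<le> 1" for e
    proof -
      have "(x, y, e) \<in> I" using xy that by (simp add: I_def)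
      from wv(2)[OF this] show ?thesis unfolding Z_def d_def by simp
    qed
    from this[of "min 1 (d / 2)"] have "d \<le> 0" by linarith
    then show "Re (\<omega> * (f x - f y)) = (\<psi> x - \<psi> y) \<bullet> (M *\<^sub>R v)"
      unfolding d_def inner_scaleR_right by linarith
  qed
qed

end

section \<open>Rational polynomials and their complex roots\<close>

abbreviation cpoly :: "rat poly \<Rightarrow> complex poly" where
  "cpoly \<equiv> map_poly of_rat"

lemma coeff_cpoly [simp]: "coeff (cpoly r) i = of_rat (coeff r i)"
  by (simp add: coeff_map_poly)

lemma degree_cpoly [simp]: "degree (cpoly r) = degree r"
  by (rule degree_map_poly) auto

lemma cpoly_add: "cpoly (r + s) = cpoly r + cpoly s"
  by (rule poly_eqI) (simp add: of_rat_add)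

lemma cpoly_diff: "cpoly (r - s) = cpoly r - cpoly s"
  by (rule poly_eqI) (simp add: of_rat_diff)

lemma cpoly_mult: "cpoly (r * s) = cpoly r * cpoly s"
  by (rule poly_eqI) (simp add: coeff_mult of_rat_sum of_rat_mult)

lemma cpoly_pderiv: "cpoly (pderiv r) = pderiv (cpoly r)"
  by (rule poly_eqI) (simp add: coeff_pderiv of_rat_mult of_rat_add)

lemma cpoly_eq_0 [simp]: "cpoly r = 0 \<longleftrightarrow> r = 0"
  by (simp add: poly_eq_iff)

text \<open>A nonzero element \<open>g\<close> of least degree in the ideal of \<open>p\<close> and
  \<open>q\<close> divides both, by division with remainder. Were its cofactor in \<open>p\<close> a
  unit, \<open>p\<close> would divide \<open>q\<close>; hence \<open>g\<close> is a unit.\<close>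

lemma bezout_irreducible:
  fixes p q :: "'a::field poly"
  assumes "irreducible p" "\<not> p dvd q"
  obtains a b where "a * p + b * q = 1"
proof -
  define I where "I = {a * p + b * q | a b. True}"
  have pI: "p \<in> I" unfolding I_def by (intro CollectI exI[of _ 1] exI[of _ 0]) simp
  have qI: "q \<in> I" unfolding I_def by (intro CollectI exI[of _ 0] exI[of _ 1]) simp
  have diffI: "x - y * z \<in> I" if "x \<in> I" "z \<in> I" for x y z
  proof -
    from that obtain a b c d where "x = a * p + b * q" "z = c * p + d * q" unfolding I_def by blast
    then have "x - y * z = (a - y * c) * p + (b - y * d) * q" by (simp add: algebra_simps)
    then show ?thesis unfolding I_def by blast
  qed
  have "p \<noteq> 0" using assms(1) by auto
  then obtain g where g: "g \<in> I" "g \<noteq> 0" and min: "\<And>h. h \<in> I \<Longrightarrow> h \<noteq> 0 \<Longrightarrow> degree g \<le> degree h"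
    using ex_has_least_nat[of "\<lambda>g. g \<in> I \<and> g \<noteq> 0" p degree] pI by blast
  have dvd: "g dvd x" if "x \<in> I" for x
  proof (rule ccontr)
    assume "\<not> g dvd x"
    then have nz: "x mod g \<noteq> 0" by (simp add: dvd_eq_mod_eq_0)
    have "x mod g = x - (x div g) * g" by (simp add: minus_div_mult_eq_mod)
    then have "x mod g \<in> I" using diffI[OF that g(1)] by simp
    then have "degree g \<le> degree (x mod g)" using min nz by blast
    then show False using degree_mod_less[OF g(2), of x] nz by simp
  qed
  obtain h where h: "p = g * h" using dvd[OF pI] by blast
  have "\<not> h dvd 1"
  proof
    assume "h dvd 1"
    then have "p dvd g" using h by (simp add: mult_unit_dvd_iff)
    then show False using dvd[OF qI] assms(2) dvd_trans by blast
  qed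
  then have "g dvd 1" using irreducibleD[OF assms(1) h] by blast
  then obtain k where k: "1 = g * k" by blast
  obtain a b where "g = a * p + b * q" using g(1) unfolding I_def by blast
  then have "(k * a) * p + (k * b) * q = 1" using k by (simp add: algebra_simps)
  then show ?thesis by (rule that)
qed

lemma cpoly_dvd_root:
  assumes "p dvd q" "poly (cpoly p) z = 0"
  shows "poly (cpoly q) z = 0"
  using assms by (auto simp: cpoly_mult)

lemma irreducible_dvd_of_common_root:
  fixes p q :: "rat poly"
  assumes "irreducible p" "poly (cpoly p) z = 0" "poly (cpoly q) z = 0"
  shows "p dvd q"
proof (rule ccontr)
  assume "\<not> p dvd q"
  then obtain a b where "a * p + b * q = 1" using bezout_irreducible assms(1) by blast
  then have "poly (cpoly (a * p + b * q)) z = poly (cpoly 1) z" by simp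
  then show False using assms by (simp add: cpoly_add cpoly_mult)
qed

lemma irreducible_degree_pos:
  fixes p :: "rat poly"
  assumes "irreducible p"
  shows "degree p > 0"
proof (rule ccontr)
  assume "\<not> ?thesis"
  moreover have "p \<noteq> 0" using assms by auto
  ultimately have "p dvd 1" by (simp add: is_unit_iff_degree)
  then show False using assms by (simp add: irreducible_def)
qed

text \<open>Separability in characteristic zero: the derivative has smaller degree, so
  \<open>p\<close> does not divide it and they share no root. The count makes the roots enough
  points to interpolate polynomials of degree below \<open>degree p\<close>.\<close>

lemma card_roots_irreducible:
  fixes p :: "rat poly"
  assumes "irreducible p"
  shows "card {z. poly (cpoly p) z = 0} = degree p"
proof -
  have nd: "\<not> p dvd pderiv p"
  proof
    assume "p dvd pderiv p"
    moreover have "pderiv p \<noteq> 0" using irreducible_degree_pos[OF assms] by (simp add: pderiv_eq_0_iff)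
    ultimately have "degree p \<le> degree (pderiv p)" by (rule dvd_imp_degree_le)
    then show False using irreducible_degree_pos[OF assms] by (simp add: degree_pderiv)
  qed
  have "rsquarefree (cpoly p)"
    unfolding rsquarefree_roots
  proof (intro allI notI)
    fix z assume "poly (cpoly p) z = 0 \<and> poly (pderiv (cpoly p)) z = 0"
    then show False using irreducible_dvd_of_common_root[OF assms, of z "pderiv p"] nd
      by (simp add: cpoly_pderiv)
  qed
  then have "smult (lead_coeff (cpoly p)) (\<Prod>z|poly (cpoly p) z = 0. [:-z, 1:]) = cpoly p"
    by (rule complex_poly_decompose_rsquarefree)
  then have "degree (\<Prod>z|poly (cpoly p) z = 0. [:-z, 1:]) = degree p"
    by (metis degree_cpoly degree_smult_eq leading_coeff_0_iff degree_0 smult_0_left irreducible_degree_pos[OF assms] less_irrefl)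
  then show ?thesis by (simp add: degree_prod_sum_eq)
qed

text \<open>Lagrange interpolation: each coefficient is a fixed linear combination of the values on
  \<open>Z\<close>.\<close>

lemma interpolation_bound:
  fixes Z :: "complex set"
  assumes "finite Z"
  obtains K where "K \<ge> 0"
    "\<And>q B j. degree q < card Z \<Longrightarrow> (\<And>z. z \<in> Z \<Longrightarrow> cmod (poly q z) \<le> B) \<Longrightarrow> cmod (coeff q j) \<le> K * B"
proof -
  define L where "L z = (\<Prod>w\<in>Z - {z}. smult (1 / (z - w)) [:-w, 1:])" for z
  have degL: "degree (L z) < card Z" if "z \<in> Z" for z
  proof -
    have d1: "degree (smult (1 / (z - w)) [:-w, 1:]) = 1" if "w \<in> Z - {z}" for w
      using that by (subst degree_smult_eq) auto
    have "degree (L z) = (\<Sum>w\<in>Z - {z}. degree (smult (1 / (z - w)) [:-w, 1:]))"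
      unfolding L_def by (intro degree_prod_sum_eq) auto
    also have "\<dots> = (\<Sum>w\<in>Z - {z}. 1)" using d1 by (rule sum.cong[OF refl])
    also have "\<dots> < card Z" using that assms by (metis card_Diff1_less card_eq_sum)
    finally show ?thesis .
  qed
  have polyL: "poly (L z) w = (if z = w then 1 else 0)" if "z \<in> Z" "w \<in> Z" for z w
  proof -
    have e: "poly (L z) w = (\<Prod>x\<in>Z - {z}. (w - x) / (z - x))"
      unfolding L_def by (simp add: poly_prod diff_divide_distrib)
    show ?thesis
    proof (cases "z = w")
      case True
      then have "(\<Prod>x\<in>Z - {z}. (w - x) / (z - x)) = 1" by (intro prod.neutral) auto
      then show ?thesis using True e by metis
    next
      case False
      then show ?thesis unfolding e using that assms by auto
    qed
  qed
  define K where "K = (\<Sum>z\<in>Z. \<Sum>j\<le>card Z. cmod (coeff (L z) j))"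
  have rep: "q = (\<Sum>z\<in>Z. smult (poly q z) (L z))" if "degree q < card Z" for q
  proof (rule ccontr)
    let ?s = "\<Sum>z\<in>Z. smult (poly q z) (L z)"
    assume "q \<noteq> ?s"
    then have nz: "q - ?s \<noteq> 0" by simp
    have "poly (q - ?s) w = 0" if "w \<in> Z" for w
    proof -
      have "poly ?s w = (\<Sum>z\<in>Z. if z = w then poly q z else 0)"
        using that by (auto simp: poly_sum polyL intro!: sum.cong)
      then show ?thesis using that assms by simp
    qed
    then have "card Z \<le> card {w. poly (q - ?s) w = 0}"
      using nz by (intro card_mono poly_roots_finite) auto
    also have "\<dots> \<le> degree (q - ?s)" using nz by (rule card_poly_roots_bound)
    also have "degree ?s < card Z"
      using degL that by (intro degree_sum_less) (auto intro: le_less_trans[OF degree_smult_le])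
    then have "degree (q - ?s) < card Z" using that by (metis degree_diff_less)
    finally show False by simp
  qed
  have nn: "K \<ge> 0" unfolding K_def by (intro sum_nonneg) auto
  have bd: "cmod (coeff q j) \<le> K * B"
    if q: "degree q < card Z" and B: "\<And>z. z \<in> Z \<Longrightarrow> cmod (poly q z) \<le> B" for q B j
  proof -
    have "Z \<noteq> {}" using q by auto
    then have B0: "B \<ge> 0" using B by (meson all_not_in_conv norm_ge_zero order_trans)
    show ?thesis
    proof (cases "j \<le> card Z")
      case True
      have "coeff q j = (\<Sum>z\<in>Z. poly q z * coeff (L z) j)"
        by (subst rep[OF q]) (simp add: coeff_sum)
      also have "cmod \<dots> \<le> (\<Sum>z\<in>Z. B * cmod (coeff (L z) j))"
        using B by (intro sum_norm_le) (auto simp: norm_mult intro: mult_right_mono)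
      also have "\<dots> \<le> (\<Sum>z\<in>Z. B * (\<Sum>j\<le>card Z. cmod (coeff (L z) j)))"
        using B0 True by (intro sum_mono mult_left_mono member_le_sum) auto
      also have "\<dots> = K * B" by (simp add: K_def sum_distrib_left mult.commute)
      finally show ?thesis .
    next
      case False
      then show ?thesis using q nn B0 by (simp add: coeff_eq_0)
    qed
  qed
  show ?thesis using that nn bd by blast
qed

text \<open>Bounds on \<open>Z\<close> become bounds on the coefficients, which are multiples of
  \<open>1 / N\<close> and thus finitely many.\<close>

lemma finite_bounded_polys:
  fixes Z :: "complex set"
  assumes "finite Z" "N > 0"
  shows "finite {r :: rat poly. degree r < card Z \<and> (\<forall>i. of_nat N * coeff r i \<in> \<int>) \<and>
     (\<forall>z\<in>Z. cmod (poly (cpoly r) z) \<le> B)}" (is "finite ?P")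
proof -
  obtain K where K: "\<And>q B j. degree q < card Z \<Longrightarrow> (\<And>z. z \<in> Z \<Longrightarrow> cmod (poly q z) \<le> B) \<Longrightarrow> cmod (coeff q j) \<le> K * B"
    using interpolation_bound[OF assms(1)] by blast
  define b where "b = \<lceil>real N * (K * B)\<rceil>"
  define T :: "rat set" where "T = (\<lambda>k. of_int k / of_nat N) ` {-b..b}"
  have coT: "coeff r i \<in> T" if r: "r \<in> ?P" for r i
  proof -
    have "of_nat N * coeff r i \<in> \<int>" using r by simp
    then obtain k where k: "of_nat N * coeff r i = of_int k" by (elim Ints_cases)
    then have c: "coeff r i = of_int k / of_nat N" using assms(2) by (simp add: field_simps)
    have "cmod (of_rat (coeff r i)) \<le> K * B" using K[of "cpoly r" B i] r by auto
    moreover have "(of_rat (coeff r i) :: complex) = of_int k / of_nat N"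
      unfolding c by (simp add: of_rat_divide)
    ultimately have "\<bar>real_of_int k\<bar> / real N \<le> K * B" by (simp add: norm_divide)
    then have "\<bar>real_of_int k\<bar> \<le> real N * (K * B)" using assms(2) by (simp add: field_simps)
    then have "k \<in> {-b..b}" unfolding b_def by (auto simp: abs_le_iff) linarith+
    then show ?thesis unfolding T_def c by blast
  qed
  have "finite (PiE {..<card Z} (\<lambda>_. T))" by (intro finite_PiE) (auto simp: T_def)
  moreover have "(\<lambda>r. restrict (coeff r) {..<card Z}) ` ?P \<subseteq> PiE {..<card Z} (\<lambda>_. T)"
    by (intro image_subsetI restrict_PiE_iff[THEN iffD2] ballI coT)
  moreover have "inj_on (\<lambda>r. restrict (coeff r) {..<card Z}) ?P"
  proof (rule inj_onI)
    fix r s assume rs: "r \<in> ?P" "s \<in> ?P" and eq: "restrict (coeff r) {..<card Z} = restrict (coeff s) {..<card Z}"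
    show "r = s"
    proof (rule poly_eqI)
      fix i show "coeff r i = coeff s i"
        using fun_cong[OF eq, of i] rs by (cases "i < card Z") (auto simp: coeff_eq_0)
    qed
  qed
  ultimately show ?thesis using finite_subset finite_imageD by blast
qed

lemma common_denominator:
  fixes P :: "rat poly set"
  assumes "finite P"
  obtains N where "N > 0" "\<And>r i. r \<in> P \<Longrightarrow> of_nat N * coeff r i \<in> \<int>"
proof -
  have "\<exists>N>0. \<forall>r\<in>P. \<forall>i. of_nat N * coeff r i \<in> \<int>"
    using assms
  proof induction
    case (insert r P)
    then obtain N where N: "N > 0" "\<forall>r\<in>P. \<forall>i. of_nat N * coeff r i \<in> \<int>" by blast
    have "\<exists>n>0. of_nat n * c \<in> \<int>" for c :: rat
    proof (cases c)
      case (Fract a b)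
      then have "of_nat (nat b) * c = of_int a" by (simp add: Fract_of_int_quotient)
      then show ?thesis using Fract by (intro exI[of _ "nat b"]) auto
    qed
    then obtain n where n: "\<And>c::rat. n c > 0 \<and> of_nat (n c) * c \<in> \<int>" by metis
    define d where "d = (\<Prod>i\<le>degree r. n (coeff r i))"
    have d: "d > 0" unfolding d_def using n by (simp add: prod_pos)
    have dr: "of_nat d * coeff r i \<in> \<int>" for i
    proof (cases "i \<le> degree r")
      case True
      then have "n (coeff r i) dvd d" unfolding d_def by (intro dvd_prodI) auto
      then obtain e where "d = n (coeff r i) * e" by blast
      then have "of_nat d * coeff r i = of_nat e * (of_nat (n (coeff r i)) * coeff r i)" by simp
      also have "\<dots> \<in> \<int>" by (rule Ints_mult[OF Ints_of_nat conjunct2[OF n]])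
      finally show ?thesis .
    qed (simp add: coeff_eq_0)
    have "of_nat (N * d) * coeff s i \<in> \<int>" if "s \<in> insert r P" for s i
    proof (cases "s = r")
      case True
      have "of_nat (N * d) * coeff s i = of_nat N * (of_nat d * coeff r i)" using True by simp
      also have "\<dots> \<in> \<int>" by (rule Ints_mult[OF Ints_of_nat dr])
      finally show ?thesis .
    next
      case False
      have "of_nat (N * d) * coeff s i = of_nat d * (of_nat N * coeff s i)" by simp
      also have "\<dots> \<in> \<int>" by (rule Ints_mult[OF Ints_of_nat]) (use N False that in blast)
      finally show ?thesis .
    qed
    then show ?case using N(1) d by (intro exI[of _ "N * d"]) auto
  qed (auto intro: exI[of _ 1])
  then show ?thesis using that by blast
qed

section \<open>Diagonalized expansions\<close>

lemma of_real_of_rat: "(of_real (of_rat q) :: 'a::{real_field,field_char_0}) = of_rat q"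
  by (cases q) (simp add: of_rat_rat)

lemma map_poly_of_real_simps:
  fixes a b :: "real poly"
  shows "map_poly complex_of_real (a + b) = map_poly complex_of_real a + map_poly complex_of_real b"
    and "map_poly complex_of_real (a * b) = map_poly complex_of_real a * map_poly complex_of_real b"
    and "map_poly complex_of_real (- a) = - map_poly complex_of_real a"
  by (rule poly_eqI; simp add: coeff_map_poly coeff_mult)+

lemma map_poly_of_real_sum:
  "map_poly complex_of_real (sum f A) = (\<Sum>x\<in>A. map_poly complex_of_real (f x))"
  by (induction A rule: infinite_finite_induct) (simp_all add: map_poly_of_real_simps)

lemma map_poly_of_real_prod:
  "map_poly complex_of_real (prod f A) = (\<Prod>x\<in>A. map_poly complex_of_real (f x))"
  by (induction A rule: infinite_finite_induct) (simp_all add: map_poly_of_real_simps)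

lemma map_poly_of_real_det:
  fixes B :: "real poly^'n::finite^'n"
  shows "map_poly complex_of_real (det B) = det (\<chi> i j. map_poly complex_of_real (B $ i $ j))"
proof -
  have "map_poly complex_of_real (of_int (sign p) * c) = of_int (sign p) * map_poly complex_of_real c"
    for p :: "'n \<Rightarrow> 'n" and c
    by (auto simp: sign_def map_poly_of_real_simps)
  then show ?thesis
    by (simp add: det_def map_poly_of_real_sum map_poly_of_real_prod)
qed

lemma matrix_mult_diff_distrib:
  fixes A B :: "'a::ring_1^'n^'m" and C D :: "'a^'k^'n"
  shows "A ** (C - D) = A ** C - A ** D" "(A - B) ** C = A ** C - B ** C"
  by (simp_all add: vec_eq_iff matrix_matrix_mult_def sum_subtractf left_diff_distrib right_diff_distrib)

text \<open>The columns of \<open>S\<close> are eigenvectors, and \<open>D\<close> lists the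
  eigenvalues by column, repeated according to multiplicity.\<close>

locale diagonalized =
  fixes Q :: "real^'n::finite^'n" and S S' :: "complex^'n^'n" and D :: "'n \<Rightarrow> complex"
  assumes S_S': "S ** S' = mat 1" and S'_S: "S' ** S = mat 1"
    and diagonal: "\<And>i j. (S' ** complex_mat Q ** S) $ i $ j = (if i = j then D i else 0)"
begin

text \<open>Eigenvector coordinates. The norm of \<open>\<psi> x\<close> is adapted to
  \<open>Q\<close>, which expands it by a factor between the smallest and the largest modulus of an
  eigenvalue.\<close>

definition \<psi> :: "real^'n \<Rightarrow> complex^'n" where
  "\<psi> x = S' *v (\<chi> i. complex_of_real (x $ i))"

lemma linear_psi: "linear \<psi>"
proof (rule linearI)
  fix x y :: "real^'n" and c :: real
  have "(\<chi> i. complex_of_real ((x + y) $ i)) = (\<chi> i. complex_of_real (x $ i)) + (\<chi> i. complex_of_real (y $ i))"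
    by (simp add: vec_eq_iff)
  then show "\<psi> (x + y) = \<psi> x + \<psi> y" by (simp add: \<psi>_def matrix_vector_right_distrib)
  show "\<psi> (c *\<^sub>R x) = c *\<^sub>R \<psi> x"
    by (simp add: \<psi>_def vec_eq_iff matrix_vector_mult_def scaleR_sum_right sum_distrib_left scaleR_conv_of_real[where 'a = complex] mult_ac)
qed

lemmas psi_add = linear_add[OF linear_psi] and psi_diff = linear_diff[OF linear_psi]
  and psi_scaleR = linear_cmul[OF linear_psi] and psi_sum = linear_sum[OF linear_psi]
  and psi_0 [simp] = linear_0[OF linear_psi]

lemma S_psi: "S *v \<psi> x = (\<chi> i. complex_of_real (x $ i))"
  by (simp add: \<psi>_def matrix_vector_mul_assoc S_S')

lemma psi_inject: "\<psi> x = \<psi> y \<longleftrightarrow> x = y"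
proof
  assume "\<psi> x = \<psi> y"
  then have "S *v \<psi> x = S *v \<psi> y" by simp
  then show "x = y" by (simp add: S_psi vec_eq_iff)
qed simp

lemma complex_mat_vec: "complex_mat Q *v (\<chi> i. complex_of_real (x $ i)) = (\<chi> i. complex_of_real ((Q *v x) $ i))"
  by (simp add: vec_eq_iff complex_mat_def matrix_vector_mult_def)

lemma S'_complex_mat: "S' ** complex_mat Q = (\<chi> i j. if i = j then D i else 0) ** S'"
proof -
  have "S' ** complex_mat Q ** S = (\<chi> i j. if i = j then D i else 0)"
    by (simp add: vec_eq_iff diagonal)
  then have "(S' ** complex_mat Q ** S) ** S' = (\<chi> i j. if i = j then D i else 0) ** S'" by simp
  then show ?thesis by (simp add: matrix_mul_assoc[symmetric] S_S')
qed

lemma complex_mat_S: "complex_mat Q ** S = S ** (\<chi> i j. if i = j then D i else 0)"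
proof -
  have "S' ** complex_mat Q ** S = (\<chi> i j. if i = j then D i else 0)"
    by (simp add: vec_eq_iff diagonal)
  then have "S ** (S' ** complex_mat Q ** S) = S ** (\<chi> i j. if i = j then D i else 0)" by simp
  then show ?thesis by (simp add: matrix_mul_assoc S_S')
qed

lemma psi_Q: "\<psi> (Q *v x) $ k = D k * \<psi> x $ k"
proof -
  have "\<psi> (Q *v x) = (S' ** complex_mat Q) *v (\<chi> i. complex_of_real (x $ i))"
    by (simp add: \<psi>_def complex_mat_vec[symmetric] matrix_vector_mul_assoc)
  also have "\<dots> = (\<chi> i j. if i = j then D i else 0) *v \<psi> x"
    by (simp add: S'_complex_mat \<psi>_def matrix_vector_mul_assoc)
  finally show ?thesis by (simp add: matrix_vector_mult_def if_distrib[of "\<lambda>x. x * _"] cong: if_cong)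
qed

lemma norm_psi_Q_le:
  assumes "\<And>k. cmod (D k) \<le> \<rho>" "\<rho> \<ge> 0"
  shows "norm (\<psi> (Q *v x)) \<le> \<rho> * norm (\<psi> x)"
proof -
  have "norm (\<psi> (Q *v x)) \<le> norm (\<rho> *\<^sub>R \<psi> x)"
    using assms by (intro norm_le_componentwise_cart) (simp add: psi_Q norm_mult mult_right_mono)
  then show ?thesis using assms by simp
qed

lemma expansion_constant:
  assumes "\<And>k. cmod (D k) > 1"
  obtains \<kappa> where "\<kappa> > 1" "\<And>x. \<kappa> * norm (\<psi> x) \<le> norm (\<psi> (Q *v x))"
proof -
  define \<kappa> where "\<kappa> = Min (range (\<lambda>k. cmod (D k)))"
  have kle: "\<kappa> \<le> cmod (D k)" for k unfolding \<kappa>_def by (intro Min_le) auto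
  have k1: "\<kappa> > 1" unfolding \<kappa>_def using assms by (subst Min_gr_iff) auto
  have "\<kappa> * norm (\<psi> x) \<le> norm (\<psi> (Q *v x))" for x
  proof -
    have "norm (\<kappa> *\<^sub>R \<psi> x) \<le> norm (\<psi> (Q *v x))"
      using kle k1 by (intro norm_le_componentwise_cart) (simp add: psi_Q norm_mult mult_right_mono)
    then show ?thesis using k1 by simp
  qed
  then show ?thesis using that k1 by blast
qed

lemma psi_bounded_below:
  obtains \<beta> where "\<beta> > 0" "\<And>x. \<beta> * norm x \<le> norm (\<psi> x)"
proof -
  have "inj \<psi>" by (auto simp: inj_def psi_inject)
  then show ?thesis using that linear_inj_bounded_below_pos[OF linear_psi] by blast
qed

text \<open>Conjugation by constant matrices preserves the determinant and fixes the scalar matrix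
  \<open>X\<close>. The embedding \<open>c\<close> of constant matrices is multiplicative, which
  transports the identities between \<open>S\<close> and \<open>S'\<close> to polynomial
  matrices.\<close>

lemma charpoly_eq: "map_poly complex_of_real (charpoly Q) = (\<Prod>k\<in>UNIV. [:- D k, 1:])"
proof -
  define c :: "complex^'n^'n \<Rightarrow> complex poly^'n^'n" where "c A = (\<chi> i j. [:A $ i $ j:])" for A
  have const_sum: "[:sum f I:] = (\<Sum>i\<in>I. [:f i:])" for f :: "'n \<Rightarrow> complex" and I
    by (rule poly_eqI) (simp add: coeff_sum coeff_pCons split: nat.split)
  have c_mult: "c (A ** B) = c A ** c B" for A B
    by (simp add: c_def vec_eq_iff matrix_matrix_mult_def const_sum mult.commute)
  define X :: "complex poly^'n^'n" where "X = (\<chi> i j. if i = j then [:0,1:] else 0)"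
  have X: "A ** X = X ** A" for A
    by (simp add: X_def vec_eq_iff matrix_matrix_mult_def if_distrib[of "\<lambda>x. x * _"]
        if_distrib[of "\<lambda>x. _ * x"] cong: if_cong)
  have c1: "c (mat 1) = mat 1" by (simp add: c_def vec_eq_iff mat_def one_pCons)
  have "map_poly complex_of_real (charpoly Q) = det (X - c (complex_mat Q))"
    unfolding charpoly_def map_poly_of_real_det
    by (intro arg_cong[of _ _ det])
      (auto simp: vec_eq_iff X_def c_def complex_mat_def map_poly_pCons)
  also have "\<dots> = det (c S') * det (X - c (complex_mat Q)) * det (c S)"
  proof -
    have "det (c S') * det (c S) = 1"
      by (simp add: det_mul[symmetric] c_mult[symmetric] S'_S c1)
    then show ?thesis by (simp add: mult_ac)
  qed
  also have "\<dots> = det (c S' ** (X - c (complex_mat Q)) ** c S)" by (simp add: det_mul)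
  also have "c S' ** (X - c (complex_mat Q)) ** c S = c S' ** X ** c S - c S' ** c (complex_mat Q) ** c S"
    by (simp add: matrix_mult_diff_distrib)
  also have "\<dots> = X - c (\<chi> i j. if i = j then D i else 0)"
  proof -
    have "c S' ** X ** c S = X ** (c S' ** c S)" by (simp add: X matrix_mul_assoc)
    moreover have "S' ** complex_mat Q ** S = (\<chi> i j. if i = j then D i else 0)"
      by (simp add: vec_eq_iff diagonal)
    ultimately show ?thesis by (simp add: c_mult[symmetric] S'_S c1)
  qed
  also have "det \<dots> = (\<Prod>k\<in>UNIV. [:- D k, 1:])"
    by (subst det_diagonal) (auto simp: X_def c_def)
  finally show ?thesis .
qed

lemma spec_eq: "spec Q = range D"
  unfolding spec_def charpoly_eq by (auto simp: poly_prod)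

lemma eig_mult_eq: "eig_mult Q \<mu> = card {k. D k = \<mu>}"
proof -
  have "order \<mu> (\<Prod>k\<in>K. [:- D k, 1:]) = card {k\<in>K. D k = \<mu>}" if "finite K" for K
    using that
  proof induction
    case (insert k K)
    have "order \<mu> (\<Prod>k\<in>insert k K. [:- D k, 1:]) = order \<mu> [:- D k, 1:] + order \<mu> (\<Prod>k\<in>K. [:- D k, 1:])"
    proof -
      have "[:- D k, 1:] * (\<Prod>k\<in>K. [:- D k, 1:]) \<noteq> 0"
        using insert.hyps(1) by (intro no_zero_divisors) auto
      then show ?thesis unfolding prod.insert[OF insert.hyps] by (rule order_mult)
    qed
    also have "order \<mu> [:- D k, 1:] = (if D k = \<mu> then 1 else 0)"
      using order_power_n_n[of \<mu> 1] by (auto simp: order_0I)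
    also have "{j\<in>insert k K. D j = \<mu>} = (if D k = \<mu> then insert k {j\<in>K. D j = \<mu>} else {j\<in>K. D j = \<mu>})" by auto
    ultimately show ?case using insert by auto
  qed simp
  then show ?thesis unfolding eig_mult_def charpoly_eq by simp
qed

text \<open>The value of \<open>r\<close> at \<open>Q\<close>, applied to \<open>x\<close>. This
  makes \<open>real^'n\<close> a module over the rational polynomials, and a vector space over a
  number field once an irreducible polynomial acts as zero.\<close>

definition pact :: "rat poly \<Rightarrow> real^'n \<Rightarrow> real^'n" where
  "pact r x = (\<Sum>i\<le>degree r. real_of_rat (coeff r i) *\<^sub>R ((*v) Q ^^ i) x)"

lemma psi_iterate: "\<psi> (((*v) Q ^^ i) x) $ k = D k ^ i * \<psi> x $ k"
  by (induction i) (auto simp: psi_Q)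

lemma psi_pact: "\<psi> (pact r x) $ k = poly (cpoly r) (D k) * \<psi> x $ k"
  by (simp add: pact_def psi_sum psi_scaleR psi_iterate poly_altdef sum_distrib_right scaleR_conv_of_real[where 'a = complex]
      mult.assoc of_real_of_rat) 

lemma psi_eqI: "(\<And>k. \<psi> x $ k = \<psi> y $ k) \<Longrightarrow> x = y"
  by (metis vec_eq_iff psi_inject)

lemma pact_mult: "pact (r * s) x = pact r (pact s x)"
  by (rule psi_eqI) (simp add: psi_pact cpoly_mult)

lemma pact_add: "pact (r + s) x = pact r x + pact s x"
  by (rule psi_eqI) (simp add: psi_pact cpoly_add psi_add algebra_simps)

lemma pact_diff: "pact (r - s) x = pact r x - pact s x"
  by (rule psi_eqI) (simp add: psi_pact cpoly_diff psi_diff algebra_simps)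

lemma pact_add_right: "pact r (x + y) = pact r x + pact r y"
  by (rule psi_eqI) (simp add: psi_pact psi_add algebra_simps)

lemma pact_0 [simp]: "pact 0 x = 0" "pact r 0 = 0"
  by (rule psi_eqI; simp add: psi_pact)+

lemma pact_1 [simp]: "pact 1 x = x"
  by (rule psi_eqI) (simp add: psi_pact)

lemma pact_sum_right: "pact r (sum g B) = (\<Sum>b\<in>B. pact r (g b))"
  by (induction B rule: infinite_finite_induct) (auto simp: pact_add_right)

lemma pact_X: "pact [:0, 1:] x = Q *v x"
  by (rule psi_eqI) (simp add: psi_pact psi_Q map_poly_pCons)

lemma pact_of_int: "pact (smult (of_int n) r) x = real_of_int n *\<^sub>R pact r x"
  by (rule psi_eqI) (simp add: psi_pact psi_scaleR map_poly_smult of_rat_mult scaleR_conv_of_real[where 'a = complex] mult.assoc)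

text \<open>With \<open>g P\<close> a chosen child of \<open>P\<close> at position
  \<open>d P\<close>, the equation lets \<open>Q\<close> carry control points to control points.
  Unfolding it gives \<open>c P\<close> as the series with terms Q^(-i-1) d(g^i P), which converges
  because \<open>Q\<close> is expanding.\<close>

lemma ex_control_points:
  assumes expanding: "\<And>k. cmod (D k) > 1" and "finite A"
    and g: "\<And>P. P \<in> A \<Longrightarrow> g P \<in> A"
  shows "\<exists>c. \<forall>P\<in>A. Q *v c P = d P + c (g P)"
proof -
  obtain \<kappa> where k1: "\<kappa> > 1" and expand: "\<And>x. \<kappa> * norm (\<psi> x) \<le> norm (\<psi> (Q *v x))"
    using expansion_constant[OF expanding] by blast
  obtain \<beta> where \<beta>: "\<beta> > 0" "\<And>x. \<beta> * norm x \<le> norm (\<psi> x)"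
    using psi_bounded_below by blast
  have "inj ((*v) Q)"
  proof (rule injI)
    fix x y assume "Q *v x = Q *v y"
    then have "\<kappa> * norm (\<psi> (x - y)) \<le> 0" using expand[of "x - y"] by (simp add: matrix_vector_mult_diff_distrib)
    then have "\<psi> (x - y) = 0" using k1 by (simp add: mult_le_0_iff)
    then show "x = y" using psi_inject[of "x - y" 0] by simp
  qed
  then have "surj ((*v) Q)" using linear_injective_imp_surjective[OF matrix_vector_mul_linear] by auto
  then obtain J where J: "\<And>x. Q *v J x = x" by (metis surjD)
  have contract: "norm (\<psi> ((J ^^ i) x)) \<le> norm (\<psi> x) * (1 / \<kappa>) ^ i" for i x
  proof (induction i)
    case (Suc i)
    have "\<kappa> * norm (\<psi> ((J ^^ Suc i) x)) \<le> norm (\<psi> ((J ^^ i) x))"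
      using expand[of "(J ^^ Suc i) x"] by (simp add: J)
    also have "\<dots> \<le> norm (\<psi> x) * (1 / \<kappa>) ^ i" by (rule Suc)
    finally show ?case using k1 by (simp add: field_simps)
  qed simp
  define h where "h P i = (J ^^ Suc i) (d ((g ^^ i) P))" for P i
  have gA: "(g ^^ i) P \<in> A" if "P \<in> A" for P i
    using that by (induction i) (auto intro: g)
  define m where "m = (\<Sum>P\<in>A. norm (\<psi> (d P)))"
  have m: "norm (\<psi> (d P)) \<le> m" if "P \<in> A" for P
    unfolding m_def using that assms(2) by (intro member_le_sum) auto
  have summ: "summable (h P)" if "P \<in> A" for P
  proof (rule summable_comparison_test')
    show "summable (\<lambda>i. m / \<beta> * (1 / \<kappa>) ^ i)"
      using k1 by (intro summable_mult summable_geometric) simp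
    show "norm (h P i) \<le> m / \<beta> * (1 / \<kappa>) ^ i" for i
    proof -
      have "\<beta> * norm (h P i) \<le> norm (\<psi> (d ((g ^^ i) P))) * (1 / \<kappa>) ^ Suc i"
        unfolding h_def using \<beta>(2) contract order_trans by blast
      also have "\<dots> \<le> m * (1 / \<kappa>) ^ i"
      proof (rule mult_mono)
        show "(1 / \<kappa>) ^ Suc i \<le> (1 / \<kappa>) ^ i" using k1 by (intro power_decreasing) auto
        show "0 \<le> m" unfolding m_def by (intro sum_nonneg) auto
      qed (use m[OF gA[OF that]] k1 in auto)
      finally have "norm (h P i) \<le> m * (1 / \<kappa>) ^ i / \<beta>"
        using \<beta>(1) by (simp add: pos_le_divide_eq mult.commute)
      then show ?thesis by simp
    qed
  qed
  define c where "c P = suminf (h P)" for P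
  have bl: "bounded_linear ((*v) Q)" by (simp add: linear_conv_bounded_linear)
  have "Q *v c P = d P + c (g P)" if P: "P \<in> A" for P
  proof -
    have Qh0: "Q *v h P 0 = d P" by (simp add: h_def J)
    have QhS: "Q *v h P (Suc i) = h (g P) i" for i
    proof -
      have "(g ^^ Suc i) P = (g ^^ i) (g P)" by (simp add: funpow_swap1)
      then show ?thesis
        by (simp only: h_def funpow.simps(2)[of "Suc i" J] o_apply J)
    qed
    have "Q *v c P = (\<Sum>i. Q *v h P i)"
      unfolding c_def by (rule bounded_linear.suminf[OF bl summ[OF P]])
    also have "\<dots> = Q *v h P 0 + (\<Sum>i. Q *v h P (Suc i))"
      using suminf_split_head[OF bounded_linear.summable[OF bl summ[OF P]]] by simp
    finally show ?thesis by (simp add: Qh0 QhS c_def)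
  qed
  then show ?thesis by blast
qed

end

section \<open>Coordinates over the number field\<close>

text \<open>For finite \<open>G\<close> this is the additive group generated by \<open>G\<close>;
  for infinite \<open>G\<close> the sums are zero by convention.\<close>

definition zspan :: "'a::real_vector set \<Rightarrow> 'a set" where
  "zspan G = range (\<lambda>n. \<Sum>g\<in>G. real_of_int (n g) *\<^sub>R g)"

lemma zspanE:
  assumes "x \<in> zspan G"
  obtains n where "x = (\<Sum>g\<in>G. real_of_int (n g) *\<^sub>R g)"
  using assms unfolding zspan_def by blast

lemma zspan_0: "0 \<in> zspan G"
  unfolding zspan_def by (rule image_eqI[of _ _ "\<lambda>_. 0"]) auto

lemma zspan_add:
  assumes "x \<in> zspan G" "y \<in> zspan G"
  shows "x + y \<in> zspan G"
proof -
  from assms obtain m n where "x = (\<Sum>g\<in>G. real_of_int (m g) *\<^sub>R g)" "y = (\<Sum>g\<in>G. real_of_int (n g) *\<^sub>R g)"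
    by (elim zspanE)
  then have "x + y = (\<Sum>g\<in>G. real_of_int (m g + n g) *\<^sub>R g)"
    by (simp add: sum.distrib scaleR_left_distrib)
  then show ?thesis unfolding zspan_def by (intro image_eqI[of _ _ "\<lambda>g. m g + n g"]) auto
qed

lemma zspan_scale:
  assumes "x \<in> zspan G"
  shows "real_of_int k *\<^sub>R x \<in> zspan G"
proof -
  from assms obtain m where "x = (\<Sum>g\<in>G. real_of_int (m g) *\<^sub>R g)" by (elim zspanE)
  then have "real_of_int k *\<^sub>R x = (\<Sum>g\<in>G. real_of_int (k * m g) *\<^sub>R g)"
    by (simp add: scaleR_sum_right)
  then show ?thesis unfolding zspan_def by (intro image_eqI[of _ _ "\<lambda>g. k * m g"]) auto
qed

lemma zspan_diff: "x \<in> zspan G \<Longrightarrow> y \<in> zspan G \<Longrightarrow> x - y \<in> zspan G"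
  using zspan_add[of x G "- y"] zspan_scale[of y G "-1"] by simp

lemma zspan_sum: "(\<And>i. i \<in> I \<Longrightarrow> f i \<in> zspan G) \<Longrightarrow> sum f I \<in> zspan G"
  by (induction I rule: infinite_finite_induct) (auto intro: zspan_0 zspan_add)

lemma zspan_superset:
  assumes "finite G" "g \<in> G"
  shows "g \<in> zspan G"
proof -
  have "(\<Sum>h\<in>G. real_of_int (if h = g then 1 else 0) *\<^sub>R h) = (\<Sum>h\<in>G. if h = g then h else 0)"
    by (rule sum.cong) auto
  also have "\<dots> = g" using assms by simp
  finally have "(\<Sum>h\<in>G. real_of_int (if h = g then 1 else 0) *\<^sub>R h) = g" .
  from image_eqI[of g "\<lambda>n. \<Sum>g\<in>G. real_of_int (n g) *\<^sub>R g", OF this[symmetric] UNIV_I]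
  show ?thesis unfolding zspan_def .
qed

lemma zspan_subset_span: "zspan G \<subseteq> span G"
proof
  fix x assume "x \<in> zspan G"
  then obtain n where "x = (\<Sum>g\<in>G. real_of_int (n g) *\<^sub>R g)" by (rule zspanE)
  then show "x \<in> span G" by (simp add: span_sum span_scale span_base)
qed

lemma real_linear_extend_coordinate:
  fixes A :: "(complex^'n::finite) set"
  assumes "vec.independent A"
  obtains f :: "complex^'n \<Rightarrow> complex^'n \<Rightarrow> complex" where "\<And>a. linear (f a)" "\<And>a c x. f a (c *s x) = c * f a x"
    "\<And>a b. a \<in> A \<Longrightarrow> b \<in> A \<Longrightarrow> f a b = (if a = b then 1 else 0)"
proof -
  define E where "E = vec.extend_basis A"
  have E: "A \<subseteq> E" "vec.independent E" "vec.span E = UNIV"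
    unfolding E_def using vec.extend_basis_superset[OF assms] vec.independent_extend_basis[OF assms]
      vec.span_extend_basis[OF assms] by auto
  define f where "f a x = vec.representation E x a" for a x
  have add: "f a (x + y) = f a x + f a y" for a x y
    unfolding f_def by (subst vec.representation_add[OF E(2)]) (auto simp: E(3))
  have scale: "f a (c *s x) = c * f a x" for a c x
    unfolding f_def by (subst vec.representation_scale[OF E(2)]) (auto simp: E(3))
  have sc: "c *\<^sub>R x = complex_of_real c *s x" for c and x :: "complex^'n"
    by (simp add: vec_eq_iff scaleR_conv_of_real[where 'a = complex])
  show ?thesis
  proof (rule that[of f])
    show "linear (f a)" for a
      by (rule linearI) (auto simp: add sc scale scaleR_conv_of_real[where 'a = complex])
    show "f a (c *s x) = c * f a x" for a c x by (rule scale)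
    show "f a b = (if a = b then 1 else 0)" if "a \<in> A" "b \<in> A" for a b
      using E(1) that unfolding f_def by (subst vec.representation_basis[OF E(2)]) auto
  qed
qed

text \<open>\<open>p\<close> annihilates \<open>Q\<close>, so \<open>real^'n\<close> is a vector
  space over the field of rational polynomials modulo \<open>p\<close>, and \<open>zspan G\<close>
  is a \<open>Q\<close>-invariant group in it. As \<open>G\<close> spans over the reals, real-linear
  functions are determined by their values on it.\<close>

locale field_module = diagonalized Q S S' D
  for Q :: "real^'n::finite^'n" and S S' D +
  fixes p :: "rat poly" and G :: "(real^'n) set"
  assumes p_irreducible: "irreducible p"
    and root: "\<And>k. poly (cpoly p) (D k) = 0"
    and finite_G: "finite G"
    and G_Q: "\<And>g. g \<in> G \<Longrightarrow> Q *v g \<in> zspan G"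
    and span_G: "span G = UNIV"
begin

text \<open>Linear independence over the field of polynomials modulo \<open>p\<close>, in terms of
  representatives: a coefficient is zero when \<open>p\<close> divides it.\<close>

definition indep :: "(real^'n) set \<Rightarrow> bool" where
  "indep B \<longleftrightarrow> (\<forall>q. (\<Sum>b\<in>B. pact (q b) b) = 0 \<longrightarrow> (\<forall>b\<in>B. p dvd q b))"

lemma pact_p: "pact p x = 0"
  by (rule psi_eqI) (simp add: psi_pact root)

lemma pact_mod: "pact (r mod p) x = pact r x"
proof -
  have "pact r x = pact (p * (r div p) + r mod p) x" by simp
  also have "\<dots> = pact (r mod p) x" by (simp only: pact_add pact_mult pact_p add_0)
  finally show ?thesis by simp
qed

text \<open>Take a maximal independent subset of \<open>G\<close>. When adding \<open>g\<close>
  creates a relation, \<open>p\<close> does not divide the coefficient of \<open>g\<close>; that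
  coefficient is invertible modulo \<open>p\<close>, and the relation can be solved for
  \<open>g\<close>.\<close>

lemma ex_basis: "\<exists>B\<subseteq>G. indep B \<and> (\<forall>g\<in>G. \<exists>r. g = (\<Sum>b\<in>B. pact (r b) b))"
proof -
  let ?I = "{B. B \<subseteq> G \<and> indep B}"
  have "finite ?I" using finite_G by simp
  moreover have "{} \<in> ?I" by (simp add: indep_def)
  ultimately have "\<exists>B\<in>?I. \<forall>C\<in>?I. B \<subseteq> C \<longrightarrow> B = C" by (intro finite_has_maximal) auto
  then obtain B where B: "B \<subseteq> G" "indep B" and max: "\<And>C. C \<subseteq> G \<Longrightarrow> indep C \<Longrightarrow> B \<subseteq> C \<Longrightarrow> B = C"
    by auto
  have fB: "finite B" using B(1) finite_G by (rule finite_subset)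
  have "\<exists>r. g = (\<Sum>b\<in>B. pact (r b) b)" if g: "g \<in> G" for g
  proof (cases "g \<in> B")
    case True
    have "(\<Sum>b\<in>B. pact (if b = g then 1 else 0) b) = (\<Sum>b\<in>B. if b = g then b else 0)"
      by (rule sum.cong) auto
    also have "\<dots> = g" using True fB by simp
    finally show ?thesis by (intro exI[of _ "\<lambda>b. if b = g then 1 else 0"]) simp
  next
    case False
    have "\<not> indep (insert g B)" using max[of "insert g B"] B g False by blast
    then obtain q b where q: "(\<Sum>b\<in>insert g B. pact (q b) b) = 0" "b \<in> insert g B" "\<not> p dvd q b"
      unfolding indep_def by blast
    have q0: "pact (q g) g + (\<Sum>b\<in>B. pact (q b) b) = 0" using q(1) fB False by simp
    have ng: "\<not> p dvd q g"
    proof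
      assume d: "p dvd q g"
      then obtain s where "q g = p * s" by blast
      then have "pact (q g) g = 0" by (simp add: pact_mult pact_p)
      then have "\<forall>b\<in>B. p dvd q b" using q0 B(2) by (simp add: indep_def)
      then show False using d q(2,3) by blast
    qed
    then obtain u v where uv: "u * p + v * q g = 1" using bezout_irreducible p_irreducible by blast
    have "g = pact (u * p + v * q g) g" by (simp add: uv)
    also have "\<dots> = pact v (pact (q g) g)" by (simp add: pact_add pact_mult pact_p)
    also have "pact (q g) g = pact (-1) (\<Sum>b\<in>B. pact (q b) b)"
    proof -
      have "pact (-1) (\<Sum>b\<in>B. pact (q b) b) = - (\<Sum>b\<in>B. pact (q b) b)"
        using pact_diff[of 0 1] by simp
      then show ?thesis using q0 by (metis eq_neg_iff_add_eq_0)
    qed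
    also have "pact v \<dots> = (\<Sum>b\<in>B. pact (v * (- 1 * q b)) b)"
      by (simp only: pact_sum_right pact_mult)
    finally show ?thesis by (intro exI[of _ "\<lambda>b. v * (- 1 * q b)"])
  qed
  then show ?thesis using B by blast
qed

text \<open>\<open>B\<close> is a basis over the field of rational polynomials modulo \<open>p\<close>, and \<open>N\<close> below is a common
  denominator for the coordinates of all elements of \<open>zspan G\<close>.\<close>
definition B :: "(real^'n) set" where
  "B = (SOME B. B \<subseteq> G \<and> indep B \<and> (\<forall>g\<in>G. \<exists>r. g = (\<Sum>b\<in>B. pact (r b) b)))"

lemma B: "B \<subseteq> G" "indep B" "g \<in> G \<Longrightarrow> \<exists>r. g = (\<Sum>b\<in>B. pact (r b) b)"
  using someI_ex[OF ex_basis] unfolding B_def by blast+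

lemma finite_B: "finite B"
  using B(1) finite_G by (rule finite_subset)

lemma B_zspan: "b \<in> B \<Longrightarrow> b \<in> zspan G"
  using B(1) zspan_superset[OF finite_G] by blast

text \<open>The degree bound selects reduced representatives and the second condition fixes a
  denominator, as \<open>finite_bounded_polys\<close> expects.\<close>

definition coords :: "nat \<Rightarrow> real^'n \<Rightarrow> (real^'n \<Rightarrow> rat poly) \<Rightarrow> bool" where
  "coords N x r \<longleftrightarrow> x = (\<Sum>b\<in>B. pact (r b) b) \<and>
     (\<forall>b\<in>B. degree (r b) < degree p \<and> (\<forall>i. of_nat N * coeff (r b) i \<in> \<int>))"

text \<open>Both conditions survive integer combinations, so a common denominator for the generators
  serves the whole group.\<close>

lemma ex_coords: "\<exists>N>0. \<forall>x\<in>zspan G. \<exists>r. coords N x r"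
proof -
  obtain r where r: "\<And>g. g \<in> G \<Longrightarrow> g = (\<Sum>b\<in>B. pact (r g b) b)" using B(3) by metis
  define s where "s g b = r g b mod p" for g b
  have s: "g = (\<Sum>b\<in>B. pact (s g b) b)" if "g \<in> G" for g
    using r[OF that] by (simp add: s_def pact_mod)
  have deg: "degree (s g b) < degree p" for g b
    using irreducible_degree_pos[OF p_irreducible] degree_mod_less[of p "r g b"]
    by (cases "r g b mod p = 0"; cases "p = 0") (auto simp: s_def)
  have "finite ((\<lambda>(g,b). s g b) ` (G \<times> B))" using finite_G finite_B by simp
  then obtain N where N: "N > 0" "\<And>q i. q \<in> (\<lambda>(g,b). s g b) ` (G \<times> B) \<Longrightarrow> of_nat N * coeff q i \<in> \<int>"
    using common_denominator by blast
  have "\<exists>t. coords N x t" if x: "x \<in> zspan G" for x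
  proof -
    obtain n where n: "x = (\<Sum>g\<in>G. real_of_int (n g) *\<^sub>R g)" using x by (rule zspanE)
    define t where "t b = (\<Sum>g\<in>G. smult (of_int (n g)) (s g b))" for b
    have pact_sum: "pact (sum f A) y = (\<Sum>a\<in>A. pact (f a) y)" for f :: "real^'n \<Rightarrow> rat poly" and A y
      by (induction A rule: infinite_finite_induct) (auto simp: pact_add)
    have "x = (\<Sum>g\<in>G. real_of_int (n g) *\<^sub>R (\<Sum>b\<in>B. pact (s g b) b))"
      unfolding n using s by (intro sum.cong) auto
    also have "\<dots> = (\<Sum>g\<in>G. \<Sum>b\<in>B. pact (smult (of_int (n g)) (s g b)) b)"
      by (simp add: scaleR_sum_right pact_of_int)
    also have "\<dots> = (\<Sum>b\<in>B. \<Sum>g\<in>G. pact (smult (of_int (n g)) (s g b)) b)"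
      by (rule sum.swap)
    also have "\<dots> = (\<Sum>b\<in>B. pact (t b) b)" by (simp add: t_def pact_sum)
    finally have "x = (\<Sum>b\<in>B. pact (t b) b)" .
    moreover have "degree (t b) < degree p" for b
      unfolding t_def using deg irreducible_degree_pos[OF p_irreducible]
      by (intro degree_sum_less) (auto intro: le_less_trans[OF degree_smult_le])
    moreover have "of_nat N * coeff (t b) i \<in> \<int>" if "b \<in> B" for b i
    proof -
      have "of_nat N * coeff (t b) i = (\<Sum>g\<in>G. of_int (n g) * (of_nat N * coeff (s g b) i))"
        by (simp add: t_def coeff_sum sum_distrib_left mult.left_commute)
      also have "\<dots> \<in> \<int>" using N(2) that
        by (intro Ints_sum, intro Ints_mult[OF Ints_of_int, of "of_nat N * _"]) auto
      finally show ?thesis .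
    qed
    ultimately show ?thesis unfolding coords_def by blast
  qed
  then show ?thesis using N(1) by blast
qed

section \<open>Coordinates evaluated at the roots of \<open>p\<close>\<close>

definition N :: nat where
  "N = (SOME N. N > 0 \<and> (\<forall>x\<in>zspan G. \<exists>r. coords N x r))"

lemma N: "N > 0" "x \<in> zspan G \<Longrightarrow> \<exists>r. coords N x r"
  using someI_ex[OF ex_coords] unfolding N_def by auto

definition cf :: "real^'n \<Rightarrow> real^'n \<Rightarrow> rat poly" where
  "cf x = (SOME r. coords N x r)"

lemma cf: "x \<in> zspan G \<Longrightarrow> coords N x (cf x)"
  unfolding cf_def by (rule someI_ex[OF N(2)])

lemma cf_sum: "x \<in> zspan G \<Longrightarrow> (\<Sum>b\<in>B. pact (cf x b) b) = x"
  using cf by (simp add: coords_def)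

text \<open>The \<open>b\<close>-coordinate of \<open>x\<close> under the embedding of the number
  field that sends the class of the variable to \<open>\<mu>\<close>. For
  \<open>x \<in> zspan G\<close> and a root \<open>\<mu>\<close> of \<open>p\<close> it does not
  depend on the choice made in \<open>cf\<close>.\<close>

definition \<phi> :: "real^'n \<Rightarrow> complex \<Rightarrow> real^'n \<Rightarrow> complex" where
  "\<phi> b \<mu> x = poly (cpoly (cf x b)) \<mu>"

text \<open>Independence of \<open>B\<close> makes two sets of coordinates agree modulo
  \<open>p\<close>, and \<open>p\<close> vanishes at \<open>\<mu>\<close>. Additivity and the rule
  for \<open>Q\<close> follow by exhibiting coordinates.\<close>

lemma phi_eqI:
  assumes "x \<in> zspan G" "x = (\<Sum>b\<in>B. pact (r b) b)" "b \<in> B" "poly (cpoly p) \<mu> = 0"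
  shows "\<phi> b \<mu> x = poly (cpoly (r b)) \<mu>"
proof -
  have "(\<Sum>b\<in>B. pact (cf x b - r b) b) = 0"
    using cf_sum[OF assms(1)] assms(2) by (simp add: pact_diff sum_subtractf)
  then have "p dvd cf x b - r b"
    by (rule B(2)[unfolded indep_def, rule_format, of "\<lambda>b. cf x b - r b", OF _ assms(3)])
  then have "poly (cpoly (cf x b - r b)) \<mu> = 0" using assms(4) by (rule cpoly_dvd_root)
  then show ?thesis by (simp add: \<phi>_def cpoly_diff)
qed

lemma phi_add:
  assumes "x \<in> zspan G" "y \<in> zspan G" "b \<in> B" "poly (cpoly p) \<mu> = 0"
  shows "\<phi> b \<mu> (x + y) = \<phi> b \<mu> x + \<phi> b \<mu> y"
proof -
  have "x + y = (\<Sum>b\<in>B. pact (cf x b + cf y b) b)"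
    by (simp add: pact_add sum.distrib cf_sum assms(1,2))
  from phi_eqI[OF zspan_add[OF assms(1,2)] this assms(3,4)]
  show ?thesis by (simp add: \<phi>_def cpoly_add)
qed

lemma phi_diff:
  assumes "x \<in> zspan G" "y \<in> zspan G" "b \<in> B" "poly (cpoly p) \<mu> = 0"
  shows "\<phi> b \<mu> (x - y) = \<phi> b \<mu> x - \<phi> b \<mu> y"
  using phi_add[OF zspan_diff[OF assms(1,2)] assms(2-4)] by simp

lemma zspan_Q:
  assumes "x \<in> zspan G"
  shows "Q *v x \<in> zspan G"
proof -
  obtain n where n: "x = (\<Sum>g\<in>G. real_of_int (n g) *\<^sub>R g)" using assms by (rule zspanE)
  have "Q *v x = (\<Sum>g\<in>G. real_of_int (n g) *\<^sub>R (Q *v g))"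
    unfolding n by (simp add: linear_sum[OF matrix_vector_mul_linear] linear_cmul[OF matrix_vector_mul_linear])
  then show ?thesis using G_Q by (auto intro!: zspan_sum zspan_scale)
qed

lemma phi_Q:
  assumes "x \<in> zspan G" "b \<in> B" "poly (cpoly p) \<mu> = 0"
  shows "\<phi> b \<mu> (Q *v x) = \<mu> * \<phi> b \<mu> x"
proof -
  have "Q *v x = pact [:0, 1:] (\<Sum>b\<in>B. pact (cf x b) b)"
    using cf_sum assms(1) by (simp add: pact_X)
  also have "\<dots> = (\<Sum>b\<in>B. pact ([:0, 1:] * cf x b) b)"
    by (simp only: pact_sum_right pact_mult)
  finally show ?thesis
    using phi_eqI[OF zspan_Q[OF assms(1)] _ assms(2,3)] 
    by (simp add: \<phi>_def cpoly_mult map_poly_pCons)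
qed

lemma phi_basis:
  assumes "b \<in> B" "b' \<in> B" "poly (cpoly p) \<mu> = 0"
  shows "\<phi> b \<mu> b' = (if b = b' then 1 else 0)"
proof -
  have "(\<Sum>b\<in>B. pact (if b = b' then 1 else 0) b) = (\<Sum>b\<in>B. if b = b' then b else 0)"
    by (rule sum.cong) auto
  also have "\<dots> = b'" using assms(2) finite_B by simp
  finally show ?thesis
    using phi_eqI[OF B_zspan[OF assms(2)] _ assms(1,3), of "\<lambda>b. if b = b' then 1 else 0"] by simp
qed

lemma psi_phi:
  assumes "x \<in> zspan G"
  shows "\<psi> x $ k = (\<Sum>b\<in>B. \<phi> b (D k) x * \<psi> b $ k)"
proof -
  have "\<psi> x $ k = \<psi> (\<Sum>b\<in>B. pact (cf x b) b) $ k" using cf_sum[OF assms] by simp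
  then show ?thesis by (simp add: psi_sum psi_pact \<phi>_def)
qed

text \<open>The group is discrete when seen through all embeddings together: bounds at every root
  leave finitely many coordinate polynomials, and these determine \<open>x\<close>.\<close>

lemma phi_finite:
  "finite {x \<in> zspan G. \<forall>b\<in>B. \<forall>\<mu>. poly (cpoly p) \<mu> = 0 \<longrightarrow> cmod (\<phi> b \<mu> x) \<le> K}" (is "finite ?X")
proof -
  let ?Z = "{\<mu>. poly (cpoly p) \<mu> = 0}"
  have fZ: "finite ?Z" using p_irreducible by (intro poly_roots_finite) auto
  let ?R = "{r :: rat poly. degree r < card ?Z \<and> (\<forall>i. of_nat N * coeff r i \<in> \<int>) \<and>
     (\<forall>z\<in>?Z. cmod (poly (cpoly r) z) \<le> K)}"
  have fin: "finite (PiE B (\<lambda>_. ?R))"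
    using finite_bounded_polys[OF fZ N(1)] finite_B by (intro finite_PiE) auto
  have sub: "(\<lambda>x. restrict (cf x) B) ` ?X \<subseteq> PiE B (\<lambda>_. ?R)"
  proof (intro image_subsetI restrict_PiE_iff[THEN iffD2] ballI)
    fix x b assume x: "x \<in> ?X" and b: "b \<in> B"
    have "coords N x (cf x)" using x cf by blast
    then show "cf x b \<in> ?R"
      using x b by (auto simp: coords_def card_roots_irreducible[OF p_irreducible] \<phi>_def)
  qed
  have inj: "inj_on (\<lambda>x. restrict (cf x) B) ?X"
  proof (rule inj_onI)
    fix x y assume xy: "x \<in> ?X" "y \<in> ?X" and eq: "restrict (cf x) B = restrict (cf y) B"
    have "cf x b = cf y b" if "b \<in> B" for b using fun_cong[OF eq, of b] that by simp
    then have "(\<Sum>b\<in>B. pact (cf x b) b) = (\<Sum>b\<in>B. pact (cf y b) b)" by (intro sum.cong) auto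
    then show "x = y" using xy cf_sum by auto
  qed
  show ?thesis by (rule finite_imageD[OF finite_subset[OF sub fin] inj])
qed

text \<open>The component of \<open>x\<close> in the eigenspace of \<open>\<mu>\<close>, in
  eigenvector coordinates.\<close>

definition eigencomp :: "complex \<Rightarrow> real^'n \<Rightarrow> complex^'n" where
  "eigencomp \<mu> x = (\<chi> k. if D k = \<mu> then \<psi> x $ k else 0)"

lemma eigencomp_add: "eigencomp \<mu> (x + y) = eigencomp \<mu> x + eigencomp \<mu> y"
  by (simp add: eigencomp_def vec_eq_iff psi_add)

lemma eigencomp_scaleR: "eigencomp \<mu> (c *\<^sub>R x) = c *\<^sub>R eigencomp \<mu> x"
  by (simp add: eigencomp_def vec_eq_iff psi_scaleR)

lemma linear_eigencomp: "linear (eigencomp \<mu>)"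
  by (rule linearI) (simp_all add: eigencomp_add eigencomp_scaleR)

lemma eigencomp_phi:
  assumes "x \<in> zspan G"
  shows "eigencomp \<mu> x = (\<Sum>b\<in>B. \<phi> b \<mu> x *s eigencomp \<mu> b)"
  by (simp add: eigencomp_def vec_eq_iff psi_phi[OF assms])

section \<open>Linear coordinates and dimensions of eigenspaces\<close>

lemma real_basis_expansion: "(\<Sum>j\<in>UNIV. (x $ j) *\<^sub>R axis j 1) = (x :: real^'n)"
  using basis_expansion[of x] by (simp add: scalar_mult_eq_scaleR)

text \<open>Extended to complex vectors, \<open>L\<close> is a left eigenvector of \<open>Q\<close>
  for \<open>\<mu>\<close>, so it vanishes on eigenvectors of other eigenvalues. The coefficient
  \<open>\<gamma> k\<close> is its value on column \<open>k\<close> of \<open>S\<close>.\<close>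

lemma eigenfunctional_factors:
  fixes L :: "real^'n \<Rightarrow> complex"
  assumes "linear L" "\<And>x. x \<in> G \<Longrightarrow> L (Q *v x) = \<mu> * L x"
  obtains \<gamma> where "\<And>x. L x = (\<Sum>k\<in>UNIV. \<gamma> k * eigencomp \<mu> x $ k)"
proof -
  have LQ: "L (Q *v x) = \<mu> * L x" for x
  proof -
    have "linear (\<lambda>x. L (Q *v x))" 
      using linear_compose[OF matrix_vector_mul_linear assms(1), of Q] by (simp add: o_def)
    moreover have "linear (\<lambda>x. \<mu> * L x)"
      by (rule linearI) (simp_all add: linear_add[OF assms(1)] linear_cmul[OF assms(1)] algebra_simps)
    ultimately show ?thesis
      using linear_eq_on_span[of "\<lambda>x. L (Q *v x)" "\<lambda>x. \<mu> * L x" G x] assms(2) span_G by blast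
  qed
  define \<gamma> where "\<gamma> k = (\<Sum>j\<in>UNIV. L (axis j 1) * S $ j $ k)" for k
  have L: "L x = (\<Sum>j\<in>UNIV. L (axis j 1) * complex_of_real (x $ j))" for x
  proof -
    have "L x = L (\<Sum>j\<in>UNIV. (x $ j) *\<^sub>R axis j 1)" by (simp only: real_basis_expansion)
    also have "\<dots> = (\<Sum>j\<in>UNIV. (x $ j) *\<^sub>R L (axis j 1))"
      by (simp only: linear_sum[OF assms(1)] linear_cmul[OF assms(1)])
    finally show ?thesis by (simp add: scaleR_conv_of_real mult.commute)
  qed
  have g0: "\<gamma> k = 0" if "D k \<noteq> \<mu>" for k
  proof -
    have SD: "(complex_mat Q ** S) $ j $ k = S $ j $ k * D k" for j
      unfolding complex_mat_S
      by (simp add: matrix_matrix_mult_def if_distrib[of "\<lambda>x. _ * x"] cong: if_cong)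
    have "D k * \<gamma> k = (\<Sum>j\<in>UNIV. L (axis j 1) * (complex_mat Q ** S) $ j $ k)"
      unfolding SD by (simp add: \<gamma>_def sum_distrib_left mult_ac)
    also have "\<dots> = (\<Sum>j\<in>UNIV. \<Sum>l\<in>UNIV. L (axis j 1) * complex_of_real (Q $ j $ l) * S $ l $ k)"
      by (simp add: matrix_matrix_mult_def complex_mat_def sum_distrib_left mult.assoc)
    also have "\<dots> = (\<Sum>l\<in>UNIV. \<Sum>j\<in>UNIV. L (axis j 1) * complex_of_real (Q $ j $ l) * S $ l $ k)"
      by (rule sum.swap)
    also have "\<dots> = (\<Sum>l\<in>UNIV. L (Q *v axis l 1) * S $ l $ k)"
      by (subst L[of "Q *v _"]) (simp add: matrix_vector_mult_basis column_def sum_distrib_right)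
    also have "\<dots> = \<mu> * \<gamma> k" by (simp add: LQ \<gamma>_def sum_distrib_left mult.assoc)
    finally show ?thesis using that by simp
  qed
  have "L x = (\<Sum>k\<in>UNIV. \<gamma> k * eigencomp \<mu> x $ k)" for x
  proof -
    have "L x = (\<Sum>j\<in>UNIV. L (axis j 1) * (S *v \<psi> x) $ j)" by (subst L) (simp add: S_psi)
    also have "\<dots> = (\<Sum>j\<in>UNIV. \<Sum>k\<in>UNIV. L (axis j 1) * S $ j $ k * \<psi> x $ k)"
      by (simp add: matrix_vector_mult_def sum_distrib_left mult.assoc)
    also have "\<dots> = (\<Sum>k\<in>UNIV. \<Sum>j\<in>UNIV. L (axis j 1) * S $ j $ k * \<psi> x $ k)"
      by (rule sum.swap)
    also have "\<dots> = (\<Sum>k\<in>UNIV. \<gamma> k * \<psi> x $ k)" by (simp add: \<gamma>_def sum_distrib_right)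
    also have "\<dots> = (\<Sum>k\<in>UNIV. \<gamma> k * eigencomp \<mu> x $ k)"
      using g0 by (intro sum.cong) (auto simp: eigencomp_def)
    finally show ?thesis .
  qed
  then show ?thesis by (rule that)
qed

text \<open>Linear coordinate functions factor through the eigencomponent at \<open>\<mu>\<close>
  and are dual to the eigencomponents of the elements of \<open>B\<close>. The latter are therefore
  independent over the complex numbers, in a space spanned by as many unit vectors as the
  multiplicity says.\<close>

lemma card_B_le:
  assumes root: "poly (cpoly p) \<mu> = 0"
    and lin: "\<And>b. b \<in> B \<Longrightarrow> \<exists>L. linear L \<and> (\<forall>x\<in>zspan G. \<phi> b \<mu> x = L x)"
  shows "card B \<le> card {k. D k = \<mu>}"
proof -
  let ?w = "eigencomp \<mu>"
  let ?E = "(\<lambda>k. axis k 1 :: complex^'n) ` {k. D k = \<mu>}"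
  have "\<exists>\<gamma>. \<forall>x\<in>zspan G. \<phi> b \<mu> x = (\<Sum>k\<in>UNIV. \<gamma> k * ?w x $ k)" if b: "b \<in> B" for b
  proof -
    obtain L where L: "linear L" "\<forall>x\<in>zspan G. \<phi> b \<mu> x = L x" using lin[OF b] by blast
    have "L (Q *v x) = \<mu> * L x" if "x \<in> G" for x
      using phi_Q[OF _ b root] L(2) zspan_Q zspan_superset[OF finite_G that] by metis
    then obtain \<gamma> where "\<And>x. L x = (\<Sum>k\<in>UNIV. \<gamma> k * ?w x $ k)"
      using eigenfunctional_factors[OF L(1)] by metis
    then show ?thesis using L(2) by auto
  qed
  then obtain \<gamma> where \<gamma>: "\<And>b x. b \<in> B \<Longrightarrow> x \<in> zspan G \<Longrightarrow> \<phi> b \<mu> x = (\<Sum>k\<in>UNIV. \<gamma> b k * ?w x $ k)"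
    by metis
  have dual: "(\<Sum>k\<in>UNIV. \<gamma> b k * ?w b' $ k) = (if b = b' then 1 else 0)" if "b \<in> B" "b' \<in> B" for b b'
    using \<gamma>[OF that(1) B_zspan[OF that(2)]] phi_basis[OF that root] by simp
  have inj: "inj_on ?w B"
  proof (rule inj_onI)
    fix b b' assume bb: "b \<in> B" "b' \<in> B" "?w b = ?w b'"
    then have "(if b = b' then 1 else 0) = (1::complex)"
      using dual[OF bb(1,2)] dual[OF bb(1,1)] by simp
    then show "b = b'" by (simp split: if_splits)
  qed
  have ind: "vec.independent (?w ` B)"
  proof (rule vec.independent_if_scalars_zero)
    show "finite (?w ` B)" using finite_B by simp
    fix f x assume f: "(\<Sum>x\<in>?w ` B. f x *s x) = 0" and "x \<in> ?w ` B"
    then obtain b where b: "b \<in> B" "x = ?w b" by blast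
    have "(\<Sum>c\<in>B. f (?w c) *s ?w c) = 0" using f by (simp add: sum.reindex[OF inj])
    then have z: "(\<Sum>c\<in>B. f (?w c) * ?w c $ k) = 0" for k
      by (metis (mono_tags, lifting) sum.cong sum_component vector_smult_component zero_index)
    have "f (?w b) = (\<Sum>c\<in>B. if b = c then f (?w c) else 0)" using b finite_B by simp
    also have "\<dots> = (\<Sum>c\<in>B. f (?w c) * (\<Sum>k\<in>UNIV. \<gamma> b k * ?w c $ k))"
      using dual[OF b(1)] by (intro sum.cong) auto
    also have "\<dots> = (\<Sum>c\<in>B. \<Sum>k\<in>UNIV. \<gamma> b k * (f (?w c) * ?w c $ k))"
      by (simp add: sum_distrib_left mult_ac)
    also have "\<dots> = (\<Sum>k\<in>UNIV. \<Sum>c\<in>B. \<gamma> b k * (f (?w c) * ?w c $ k))"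
      by (rule sum.swap)
    also have "\<dots> = 0" by (simp add: sum_distrib_left[symmetric] z)
    finally show "f x = 0" by (simp add: b(2))
  qed
  have "?w ` B \<subseteq> vec.span ?E"
  proof clarify
    fix b assume "b \<in> B"
    have "?w b = (\<Sum>k\<in>UNIV. ?w b $ k *s axis k 1)" by (simp add: basis_expansion)
    also have "\<dots> \<in> vec.span ?E"
    proof (rule vec.span_sum)
      fix k show "?w b $ k *s axis k 1 \<in> vec.span ?E"
      proof (cases "D k = \<mu>")
        case True
        then have "axis k 1 \<in> ?E" by blast
        then show ?thesis by (rule vec.span_scale[OF vec.span_base])
      next
        case False
        then show ?thesis by (simp add: eigencomp_def vec.span_zero)
      qed
    qed
    finally show "?w b \<in> vec.span ?E" .
  qed
  then have "card (?w ` B) \<le> card ?E" using vec.independent_span_bound[OF _ ind, of ?E] by simp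
  also have "\<dots> \<le> card {k. D k = \<mu>}" by (rule card_image_le) simp
  finally show ?thesis by (simp add: card_image[OF inj])
qed

text \<open>The eigencomponents of \<open>B\<close> span the eigenspace because \<open>G\<close>
  spans over the reals, and the bound on \<open>card B\<close> leaves no room for a relation. So
  they form a basis, and \<open>\<phi> b \<mu>\<close> is a coordinate with respect to it, the
  restriction of a linear function.\<close>

lemma phi_bounded:
  assumes mu: "\<mu> \<in> range D" and card: "card B \<le> card {k. D k = \<mu>}" and b: "b \<in> B"
  shows "\<exists>K. \<forall>x\<in>zspan G. cmod (\<phi> b \<mu> x) \<le> K * norm x"
proof -
  let ?w = "eigencomp \<mu>"
  let ?V = "vec.span (?w ` B)"
  let ?E = "(\<lambda>k. axis k 1 :: complex^'n) ` {k. D k = \<mu>}"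
  have root_mu: "poly (cpoly p) \<mu> = 0" using mu root by auto
  have wV: "?w x \<in> ?V" for x
  proof -
    have "subspace {x. ?w x \<in> ?V}"
    proof (rule subspaceI)
      show "0 \<in> {x. ?w x \<in> ?V}" using linear_0[OF linear_eigencomp] by (simp add: vec.span_zero)
      show "x + y \<in> {x. ?w x \<in> ?V}" if "x \<in> {x. ?w x \<in> ?V}" "y \<in> {x. ?w x \<in> ?V}" for x y
        using that by (simp add: eigencomp_add vec.span_add)
      show "c *\<^sub>R x \<in> {x. ?w x \<in> ?V}" if "x \<in> {x. ?w x \<in> ?V}" for c x
      proof -
        have "?w (c *\<^sub>R x) = complex_of_real c *s ?w x"
          by (simp add: eigencomp_scaleR vec_eq_iff scaleR_conv_of_real[where 'a = complex])
        then show ?thesis using that by (simp add: vec.span_scale)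
      qed
    qed
    moreover have "G \<subseteq> {x. ?w x \<in> ?V}"
    proof clarify
      fix g assume "g \<in> G"
      then have "?w g = (\<Sum>b\<in>B. \<phi> b \<mu> g *s ?w b)" by (intro eigencomp_phi zspan_superset finite_G)
      also have "\<dots> \<in> ?V" by (intro vec.span_sum vec.span_scale vec.span_base) auto
      finally show "?w g \<in> ?V" .
    qed
    ultimately have "span G \<subseteq> {x. ?w x \<in> ?V}" by (intro span_minimal)
    then show ?thesis using span_G by auto
  qed
  have "?E \<subseteq> ?V"
  proof clarify
    fix k assume k: "\<mu> = D k"
    have psi_axis: "\<psi> (axis j 1) $ i = S' $ i $ j" for i j
    proof -
      have "(\<chi> i. complex_of_real (axis j 1 $ i)) = axis j 1" by (simp add: vec_eq_iff axis_def)
      then show ?thesis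
        by (simp add: \<psi>_def matrix_vector_mult_def axis_def if_distrib[of "\<lambda>x. _ * x"] cong: if_cong)
    qed
    have SS: "(\<Sum>j\<in>UNIV. S $ j $ k * S' $ i $ j) = (if i = k then 1 else 0)" for i
      using S'_S by (simp add: vec_eq_iff matrix_matrix_mult_def mat_def mult.commute)
    \<comment> \<open>Column \<open>k\<close> of \<open>S\<close> is a complex combination of real
      unit vectors, so complex combinations of eigencomponents of real vectors reach
      \<open>axis k 1\<close>.\<close>
    have "axis k 1 = (\<Sum>j\<in>UNIV. S $ j $ k *s ?w (axis j 1))"
    proof (subst vec_eq_iff, rule allI)
      fix i
      have "(\<Sum>j\<in>UNIV. S $ j $ k *s ?w (axis j 1)) $ i = (if D i = \<mu> then \<Sum>j\<in>UNIV. S $ j $ k * S' $ i $ j else 0)"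
        by (simp add: eigencomp_def psi_axis)
      also have "\<dots> = axis k 1 $ i" using k unfolding SS by (simp add: axis_def)
      finally show "axis k 1 $ i = (\<Sum>j\<in>UNIV. S $ j $ k *s ?w (axis j 1)) $ i" by simp
    qed
    also have "\<dots> \<in> vec.span (eigencomp (D k) ` B)" unfolding k[symmetric] by (intro vec.span_sum vec.span_scale wV)
    finally show "axis k 1 \<in> vec.span (eigencomp (D k) ` B)" .
  qed
  moreover have "vec.independent ?E"
    by (rule vec.independent_mono[OF independent_cart_basis]) (auto simp: cart_basis_def)
  ultimately have "card ?E \<le> vec.dim ?V" by (rule vec.independent_card_le_dim)
  moreover have "card ?E = card {k. D k = \<mu>}"
    by (rule card_image) (auto simp: inj_on_def axis_eq_axis)
  ultimately have dim: "card B \<le> vec.dim ?V" using card by simp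
  also have "\<dots> \<le> card (?w ` B)" by (rule vec.dim_le_card) (use finite_B in auto)
  finally have cB: "card (?w ` B) = card B" using card_image_le[OF finite_B, of ?w] by simp
  then have inj: "inj_on ?w B" using finite_B by (rule eq_card_imp_inj_on[rotated])
  have "vec.independent (?w ` B)"
    using dim cB finite_B by (intro vec.card_le_dim_spanning[of _ ?V]) (auto intro: vec.span_base)
  then obtain f where f: "\<And>a. linear (f a :: _ \<Rightarrow> complex)" "\<And>a c x. f a (c *s x) = c * f a x"
    "\<And>a c. a \<in> ?w ` B \<Longrightarrow> c \<in> ?w ` B \<Longrightarrow> f a c = (if a = c then 1 else 0)"
    by (rule real_linear_extend_coordinate) metis
  have "linear (\<lambda>x. f (?w b) (?w x))"
    using linear_compose[OF linear_eigencomp f(1)] by (simp add: o_def)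
  then have "bounded_linear (\<lambda>x. f (?w b) (?w x))" by (simp add: linear_conv_bounded_linear)
  then obtain K where K: "\<And>x. cmod (f (?w b) (?w x)) \<le> norm x * K" using bounded_linear.bounded by blast
  have "\<phi> b \<mu> x = f (?w b) (?w x)" if "x \<in> zspan G" for x
  proof -
    have "f (?w b) (?w x) = (\<Sum>c\<in>B. \<phi> c \<mu> x * f (?w b) (?w c))"
      unfolding eigencomp_phi[OF that] by (simp add: linear_sum[OF f(1)] f(2))
    also have "\<dots> = (\<Sum>c\<in>B. if c = b then \<phi> c \<mu> x else 0)"
      using inj b f(3) by (intro sum.cong) (auto simp: inj_on_eq_iff)
    also have "\<dots> = \<phi> b \<mu> x" using b finite_B by simp
    finally show ?thesis by simp
  qed
  then show ?thesis using K by (intro exI[of _ K]) (simp add: mult.commute)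
qed

end

section \<open>Control points\<close>

text \<open>\<open>C_Q\<close> leads outwards and \<open>parent\<close> back, up to a digit from
  \<open>\<Delta>\<close>. Going back is what bounds the coordinates at contracting
  conjugates.\<close>

locale control_points = diagonalized Q S S' D
  for Q :: "real^'n::finite^'n" and S S' D +
  fixes C :: "(real^'n) set" and R :: real and \<Delta> :: "(real^'n) set"
  assumes expanding: "\<And>k. cmod (D k) > 1"
    and C_Q: "\<And>x. x \<in> C \<Longrightarrow> Q *v x \<in> C"
    and finite_digits: "finite \<Delta>"
    and parent: "\<And>c. c \<in> C \<Longrightarrow> \<exists>c'\<in>C. c - Q *v c' \<in> \<Delta>"
    and R_pos: "R > 0"
    and relatively_dense: "\<And>z. \<exists>c\<in>C. norm (c - z) \<le> R"
    and locally_finite: "\<And>r. finite {c - c' | c c'. c \<in> C \<and> c' \<in> C \<and> norm (c - c') \<le> r}"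
    and repetitive: "\<And>F. finite F \<Longrightarrow> F \<subseteq> C \<Longrightarrow> \<exists>R'. \<forall>z. \<exists>y. \<forall>x\<in>F. x + y \<in> C \<and> norm (x + y - z) \<le> R'"
begin

text \<open>Enough differences to join any two points of \<open>C\<close>: steps of length at most 1
  on the segment, each division point replaced by a point of \<open>C\<close> within
  \<open>R\<close>.\<close>

definition G :: "(real^'n) set" where
  "G = {c - c' | c c'. c \<in> C \<and> c' \<in> C \<and> norm (c - c') \<le> 1 + 2 * R}"

lemma G_finite: "finite G"
  unfolding G_def by (rule locally_finite)

lemma diff_in_zspan:
  assumes "x \<in> C" "y \<in> C"
  shows "y - x \<in> zspan G"
proof -
  define n where "n = nat \<lceil>norm (y - x)\<rceil> + 1"
  have n: "norm (y - x) \<le> real n" "n > 0" unfolding n_def by linarith+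
  define l where "l i = x + (real i / real n) *\<^sub>R (y - x)" for i
  obtain c where c: "\<And>z. c z \<in> C \<and> norm (c z - z) \<le> R" using relatively_dense by metis
  define u where "u i = (if i = 0 then x else if i = n then y else c (l i))" for i
  have u: "u i \<in> C" "norm (u i - l i) \<le> R" for i
    using assms c R_pos n(2) by (auto simp: u_def l_def)
  have "u (Suc i) - u i \<in> G" for i
  proof -
    have "l (Suc i) - l i = (1 / real n) *\<^sub>R (y - x)"
      by (simp add: l_def add_divide_distrib scaleR_left_distrib)
    then have "norm (l (Suc i) - l i) \<le> 1" using n by simp
    then have "norm (u (Suc i) - u i) \<le> 1 + 2 * R"
      using norm_diff_le_via[of "u (Suc i)" "u i" "l (Suc i)" "l i"] u(2)[of i] u(2)[of "Suc i"] by linarith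
    then show ?thesis unfolding G_def using u(1) by blast
  qed
  then have "(\<Sum>i<n. u (Suc i) - u i) \<in> zspan G"
    by (intro zspan_sum zspan_superset G_finite)
  then show ?thesis unfolding sum_lessThan_telescope using n(2) by (simp add: u_def)
qed

lemma G_Q': "g \<in> G \<Longrightarrow> Q *v g \<in> zspan G"
proof -
  assume "g \<in> G"
  then obtain c c' where c: "c \<in> C" "c' \<in> C" "g = c - c'" unfolding G_def by blast
  then have "Q *v g = Q *v c - Q *v c'" by (simp add: matrix_vector_mult_diff_distrib)
  then show ?thesis using diff_in_zspan[OF C_Q[OF c(2)] C_Q[OF c(1)]] by simp
qed

text \<open>A relatively dense set does not stay in a hyperplane: \<open>t\<close> is chosen to move
  by \<open>R + 1\<close> in the orthogonal direction \<open>a\<close>, more than an error of size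
  \<open>R\<close> can undo.\<close>

lemma span_G': "span G = UNIV"
proof (rule ccontr)
  assume "span G \<noteq> UNIV"
  then obtain a :: "real^'n" where a: "a \<noteq> 0" "\<And>x. x \<in> span G \<Longrightarrow> a \<bullet> x = 0"
    using span_not_UNIV_orthogonal[of G] by blast
  obtain c0 where c0: "c0 \<in> C" using relatively_dense by blast
  define t where "t = (R + 1) / norm a"
  obtain c where c: "c \<in> C" "norm (c - (c0 + t *\<^sub>R a)) \<le> R" using relatively_dense by blast
  define e where "e = c - (c0 + t *\<^sub>R a)"
  have "c - c0 = t *\<^sub>R a + e" by (simp add: e_def)
  moreover have "c - c0 \<in> span G" using diff_in_zspan[OF c0 c(1)] zspan_subset_span by blast
  ultimately have "a \<bullet> (t *\<^sub>R a + e) = 0" using a(2) by metis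
  then have "t * (norm a)\<^sup>2 = - (a \<bullet> e)" by (simp add: inner_add_right power2_norm_eq_inner)
  also have "\<dots> \<le> norm a * norm e" using Cauchy_Schwarz_ineq2[of a e] by linarith
  also have "\<dots> \<le> norm a * R" using c(2) by (simp add: e_def mult_left_mono)
  finally have "(R + 1) * norm a \<le> norm a * R" using a(1) by (simp add: t_def power2_eq_square)
  then show False using a(1) by (simp add: algebra_simps)
qed

end

locale pisot_control_points = control_points Q S S' D C R \<Delta>
  for Q :: "real^'n::finite^'n" and S S' D C R \<Delta> +
  fixes p :: "rat poly"
  assumes irr: "irreducible p"
    and p_root: "\<And>k. poly (cpoly p) (D k) = 0"
    and pisot: "\<And>\<mu>. poly (cpoly p) \<mu> = 0 \<Longrightarrow> \<mu> \<notin> range D \<Longrightarrow> cmod \<mu> < 1"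
    and same_mult: "\<And>i j. card {k. D k = D i} = card {k. D k = D j}"
begin

sublocale field_module Q S S' D p G
  by unfold_locales (use irr p_root G_finite G_Q' span_G' in auto)

section \<open>Bounds for the coordinates of control points\<close>

lemma phi_scale_int:
  assumes "x \<in> zspan G" "b \<in> B" "poly (cpoly p) \<mu> = 0"
  shows "\<phi> b \<mu> (real_of_int n *\<^sub>R x) = of_int n * \<phi> b \<mu> x"
proof -
  have "real_of_int n *\<^sub>R x = (\<Sum>b\<in>B. pact (smult (of_int n) (cf x b)) b)"
    using cf_sum[OF assms(1)] by (simp add: pact_of_int scaleR_sum_right[symmetric])
  from phi_eqI[OF zspan_scale[OF assms(1)] this assms(2,3)]
  show ?thesis by (simp add: \<phi>_def map_poly_smult of_rat_mult)
qed

lemma phi_zero: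
  assumes "b \<in> B" "poly (cpoly p) \<mu> = 0"
  shows "\<phi> b \<mu> 0 = 0"
  using phi_diff[OF zspan_0 zspan_0 assms] by simp

lemma phi_sum:
  assumes "\<And>i. i \<in> I \<Longrightarrow> f i \<in> zspan G" "b \<in> B" "poly (cpoly p) \<mu> = 0"
  shows "\<phi> b \<mu> (sum f I) = (\<Sum>i\<in>I. \<phi> b \<mu> (f i))"
  using assms(1)
proof (induction I rule: infinite_finite_induct)
  case (insert i I)
  then show ?case by (simp add: phi_add[OF _ zspan_sum assms(2,3)])
qed (simp_all add: phi_zero assms)

lemma zspan_iterate: "x \<in> zspan G \<Longrightarrow> ((*v) Q ^^ k) x \<in> zspan G"
  by (induction k) (auto intro: zspan_Q)

lemma phi_iterate:
  assumes "x \<in> zspan G" "b \<in> B" "poly (cpoly p) \<mu> = 0"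
  shows "\<phi> b \<mu> (((*v) Q ^^ k) x) = \<mu> ^ k * \<phi> b \<mu> x"
  by (induction k) (auto simp: phi_Q[OF zspan_iterate] assms)

lemma phi_cocycle:
  assumes "c0 \<in> C" "x \<in> C" "y \<in> C" "b \<in> B" "poly (cpoly p) \<mu> = 0"
  shows "\<phi> b \<mu> (x - c0) - \<phi> b \<mu> (y - c0) = \<phi> b \<mu> (x - y)"
proof -
  have eq: "(x - c0) - (y - c0) = x - y" by simp
  from phi_diff[OF diff_in_zspan[OF assms(1,2)] diff_in_zspan[OF assms(1,3)] assms(4,5)]
  show ?thesis unfolding eq by (rule sym)
qed

lemma phi_real:
  assumes "\<mu> \<in> \<real>"
  shows "\<phi> b \<mu> x \<in> \<real>"
proof -
  have "of_rat q \<in> (\<real> :: complex set)" for q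
    by (metis Reals_of_real of_real_of_rat)
  then show ?thesis unfolding \<phi>_def poly_altdef
    using assms by (auto intro!: sum_in_Reals Reals_mult Reals_power)
qed

text \<open>Differences of points of \<open>C\<close> of bounded length are finitely many, so any
  function is bounded on them; \<open>\<beta>\<close> converts the bound on \<open>\<psi>\<close>
  into one on vectors.\<close>

lemma bounded_variation:
  assumes "b \<in> B" "poly (cpoly p) \<mu> = 0"
  shows "\<exists>K. \<forall>x\<in>C. \<forall>y\<in>C. norm (\<psi> x - \<psi> y) \<le> r \<longrightarrow> cmod (\<phi> b \<mu> (x - y)) \<le> K"
proof -
  obtain \<beta> where \<beta>: "\<beta> > 0" "\<And>x. \<beta> * norm x \<le> norm (\<psi> x)"
    using psi_bounded_below by blast
  let ?F = "(\<lambda>d. cmod (\<phi> b \<mu> d)) ` {c - c' | c c'. c \<in> C \<and> c' \<in> C \<and> norm (c - c') \<le> r / \<beta>}"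
  have "finite ?F" using locally_finite by blast
  then have K: "z \<in> ?F \<Longrightarrow> z \<le> Max ?F" for z by (rule Max_ge)
  have "cmod (\<phi> b \<mu> (x - y)) \<le> Max ?F" if "x \<in> C" "y \<in> C" "norm (\<psi> x - \<psi> y) \<le> r" for x y
  proof (rule K, rule imageI)
    have "\<beta> * norm (x - y) \<le> r" using \<beta>(2)[of "x - y"] that by (simp add: psi_diff)
    then have "norm (x - y) \<le> r / \<beta>" using \<beta>(1) by (simp add: field_simps)
    then show "x - y \<in> {c - c' | c c'. c \<in> C \<and> c' \<in> C \<and> norm (c - c') \<le> r / \<beta>}" using that by blast
  qed
  then show ?thesis by blast
qed

text \<open>At an eigenvalue of largest modulus both expansion factors are \<open>cmod lam\<close>,
  as the theorem on cocycles requires. The base point \<open>c0\<close> turns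
  \<open>\<phi> b lam\<close>, which is defined on differences, into a function on
  \<open>C\<close>.\<close>

lemma phi_linear_of_max:
  assumes lam: "lam \<in> range D" and max: "\<And>k. cmod (D k) \<le> cmod lam" and b: "b \<in> B"
  shows "\<exists>L. linear L \<and> (\<forall>x\<in>zspan G. \<phi> b lam x = L x)"
proof -
  have root: "poly (cpoly p) lam = 0" using lam p_root by auto
  have rho: "cmod lam > 1" using lam expanding by auto
  obtain c0 where c0: "c0 \<in> C" using relatively_dense by blast
  define f where "f x = \<phi> b lam (x - c0)" for x
  have f: "f x - f y = \<phi> b lam (x - y)" if "x \<in> C" "y \<in> C" for x y
    unfolding f_def using phi_cocycle[OF c0 that b root] .
  have "bounded_linear \<psi>" using linear_psi by (simp add: linear_conv_bounded_linear)
  then obtain K where K: "K > 0" "\<And>x. norm (\<psi> x) \<le> norm x * K" using bounded_linear.pos_bounded by blast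
  interpret self_similar_cocycle C \<psi> "(*v) Q" f "cmod lam" "K * R"
  proof (rule self_similar_cocycle.intro)
    show "linear \<psi>" by (rule linear_psi)
    show "Q *v x \<in> C" if "x \<in> C" for x by (rule C_Q[OF that])
    show "norm (\<psi> (Q *v x) - \<psi> (Q *v y)) \<le> cmod lam * norm (\<psi> x - \<psi> y)" for x y
      using norm_psi_Q_le[OF max, of "x - y"] by (simp add: matrix_vector_mult_diff_distrib psi_diff)
    show "cmod lam > 1" by (rule rho)
    show "cmod (f (Q *v x) - f (Q *v y)) = cmod lam * cmod (f x - f y)" if "x \<in> C" "y \<in> C" for x y
      using phi_Q[OF diff_in_zspan[OF that(2,1)] b root]
      by (simp add: f C_Q that matrix_vector_mult_diff_distrib norm_mult)
    show "K * R > 0" using K(1) R_pos by simp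
    show "\<exists>c\<in>C. norm (\<psi> c - (\<psi> x + t *\<^sub>R (\<psi> y - \<psi> x))) \<le> K * R" for x y t
    proof -
      obtain c where c: "c \<in> C" "norm (c - (x + t *\<^sub>R (y - x))) \<le> R" using relatively_dense by blast
      have "norm (\<psi> (c - (x + t *\<^sub>R (y - x)))) \<le> norm (c - (x + t *\<^sub>R (y - x))) * K" by (rule K(2))
      also have "\<dots> \<le> K * R" using c(2) K(1) by (simp add: mult.commute)
      finally show ?thesis using c(1) by (auto simp: psi_diff psi_add psi_scaleR)
    qed
    show "\<exists>K. \<forall>x\<in>C. \<forall>y\<in>C. norm (\<psi> x - \<psi> y) \<le> r \<longrightarrow> cmod (f x - f y) \<le> K" for r
    proof -
      obtain K where "\<forall>x\<in>C. \<forall>y\<in>C. norm (\<psi> x - \<psi> y) \<le> r \<longrightarrow> cmod (\<phi> b lam (x - y)) \<le> K"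
        using bounded_variation[OF b root] by blast
      then show ?thesis using f by (intro exI[of _ K]) auto
    qed
    show "\<exists>R'. \<forall>c\<in>C. \<exists>y. \<forall>x\<in>F. x + y \<in> C \<and> norm (\<psi> (x + y) - \<psi> c) \<le> R'"
      if F: "finite F" "F \<subseteq> C" for F
    proof -
      obtain R' where R': "\<forall>z. \<exists>y. \<forall>x\<in>F. x + y \<in> C \<and> norm (x + y - z) \<le> R'"
        using repetitive[OF F] by blast
      have "norm (\<psi> u - \<psi> c) \<le> R' * K" if "norm (u - c) \<le> R'" for u c
      proof -
        have "norm (\<psi> u - \<psi> c) \<le> norm (u - c) * K" using K(2)[of "u - c"] by (simp add: psi_diff)
        also have "\<dots> \<le> R' * K" using that K(1) by simp
        finally show ?thesis .
      qed
      then show ?thesis using R' by (intro exI[of _ "R' * K"]) blast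
    qed
    show "f (x + y) - f (x' + y) = f x - f x'"
      if "x \<in> C" "x' \<in> C" "x + y \<in> C" "x' + y \<in> C" for x x' y
      using f[OF that(1,2)] f[OF that(3,4)] by simp
  qed
  define \<Omega> :: "complex set" where "\<Omega> = (if lam \<in> \<real> then {1, -1} else UNIV)"
  have "closed \<Omega>" by (simp add: \<Omega>_def)
  moreover have "C \<noteq> {}" using c0 by blast
  moreover have "\<exists>\<omega>\<in>\<Omega>. cmod \<omega> = 1 \<and> Re (\<omega> * (f x - f y)) = cmod (f x - f y)" for x y
  proof (cases "lam \<in> \<real>")
    case True
    then have "f x - f y \<in> \<real>" unfolding f_def by (intro Reals_diff phi_real)
    then obtain t where t: "f x - f y = complex_of_real t" by (elim Reals_cases)
    show ?thesis
      unfolding t \<Omega>_def using True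
      by (intro bexI[of _ "if t \<ge> 0 then 1 else -1"]) auto
  next
    case False
    show ?thesis
    proof (cases "f x - f y = 0")
      case True
      then show ?thesis using False by (intro bexI[of _ 1]) (auto simp: \<Omega>_def)
    next
      case nz: False
      have "cnj (sgn (f x - f y)) * (f x - f y) = complex_of_real (cmod (f x - f y))"
      proof -
        have "f x - f y = complex_of_real (cmod (f x - f y)) * sgn (f x - f y)"
          using nz by (simp add: sgn_div_norm scaleR_conv_of_real)
        then have "cnj (sgn (f x - f y)) * (f x - f y)
            = complex_of_real (cmod (f x - f y)) * (sgn (f x - f y) * cnj (sgn (f x - f y)))"
          by (metis mult.commute mult.left_commute)
        also have "sgn (f x - f y) * cnj (sgn (f x - f y)) = 1"
          using nz complex_norm_square[of "sgn (f x - f y)"] by (simp add: norm_sgn)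
        finally show ?thesis by simp
      qed
      then show ?thesis using False nz
        by (intro bexI[of _ "cnj (sgn (f x - f y))"]) (auto simp: \<Omega>_def norm_sgn)
    qed
  qed
  ultimately obtain \<omega> v where om: "\<omega> \<in> \<Omega>" "cmod \<omega> = 1"
    and aff: "\<And>x y. x \<in> C \<Longrightarrow> y \<in> C \<Longrightarrow> Re (\<omega> * (f x - f y)) = (\<psi> x - \<psi> y) \<bullet> v"
    using affine[of \<Omega>] by blast
  define h where "h x = \<psi> x \<bullet> v" for x
  have h_add: "h (x + y) = h x + h y" and h_scale: "h (c *\<^sub>R x) = c * h x" for x y c
    by (simp_all add: h_def psi_add psi_scaleR inner_add_left)
  have hG: "Re (\<omega> * \<phi> b lam g) = h g" if "g \<in> G" for g
    using that aff f unfolding G_def h_def by (auto simp: psi_diff)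
  have hZ: "Re (\<omega> * \<phi> b lam x) = h x" if "x \<in> zspan G" for x
  proof -
    obtain n where n: "x = (\<Sum>g\<in>G. real_of_int (n g) *\<^sub>R g)" using \<open>x \<in> zspan G\<close> by (rule zspanE)
    have zG: "g \<in> zspan G" if "g \<in> G" for g by (rule zspan_superset[OF G_finite that])
    have "\<phi> b lam x = (\<Sum>g\<in>G. of_int (n g) * \<phi> b lam g)"
      unfolding n using zG by (subst phi_sum[OF zspan_scale b root]) (auto simp: phi_scale_int b root)
    then have "Re (\<omega> * \<phi> b lam x) = (\<Sum>g\<in>G. real_of_int (n g) * Re (\<omega> * \<phi> b lam g))"
      by (simp add: sum_distrib_left mult.left_commute[of \<omega>] Re_sum)
    also have "\<dots> = (\<Sum>g\<in>G. h (real_of_int (n g) *\<^sub>R g))"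
      using hG by (intro sum.cong) (auto simp: h_scale)
    also have "\<dots> = h x" unfolding n h_def by (simp add: psi_sum inner_sum_left)
    finally show ?thesis .
  qed
  show ?thesis
  proof (cases "lam \<in> \<real>")
    case True
    then obtain s where s: "\<omega> = complex_of_real s" "s * s = 1"
      using om(1) by (auto simp: \<Omega>_def intro: that[of 1] that[of "-1"])
    have "linear (\<lambda>x. complex_of_real (s * h x))"
      by (rule linearI) (simp_all add: h_add h_scale algebra_simps scaleR_conv_of_real[where 'a = complex])
    moreover have "\<phi> b lam x = complex_of_real (s * h x)" if "x \<in> zspan G" for x
    proof -
      obtain t where t: "\<phi> b lam x = complex_of_real t" using phi_real[OF True, of b x] by (elim Reals_cases)
      have "s * t = h x" using hZ[OF that] by (simp add: t s(1))
      then have "s * h x = t" using s(2) by (metis mult.assoc mult_1)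
      then show ?thesis by (simp add: t)
    qed
    ultimately show ?thesis by blast
  next
    case False
    (* Only the real part of the function is known to be linear; the imaginary part follows from
       the real part at Q x. *)
    then have im: "Im lam \<noteq> 0" by (simp add: complex_is_Real_iff)
    have om0: "\<omega> \<noteq> 0" using om(2) by auto
    define L where "L x = Complex (h x) ((Re lam * h x - h (Q *v x)) / Im lam) / \<omega>" for x
    have "linear L"
    proof (rule linearI)
      show "L (x + y) = L x + L y" for x y
      proof -
        have "Complex (h (x + y)) ((Re lam * h (x + y) - h (Q *v (x + y))) / Im lam)
          = Complex (h x) ((Re lam * h x - h (Q *v x)) / Im lam) + Complex (h y) ((Re lam * h y - h (Q *v y)) / Im lam)"
          using im by (simp add: matrix_vector_right_distrib h_add complex_eq_iff field_simps)
        then show ?thesis by (simp only: L_def add_divide_distrib)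
      qed
      show "L (c *\<^sub>R x) = c *\<^sub>R L x" for c x
      proof -
        have "Complex (h (c *\<^sub>R x)) ((Re lam * h (c *\<^sub>R x) - h (Q *v (c *\<^sub>R x))) / Im lam)
          = c *\<^sub>R Complex (h x) ((Re lam * h x - h (Q *v x)) / Im lam)"
          using im by (simp add: matrix_vector_mult_scaleR h_scale complex_eq_iff field_simps)
        then show ?thesis by (simp add: L_def scaleR_conv_of_real[where 'a = complex])
      qed
    qed
    moreover have "\<phi> b lam x = L x" if x: "x \<in> zspan G" for x
    proof -
      let ?z = "\<omega> * \<phi> b lam x"
      have "h (Q *v x) = Re (lam * ?z)"
        using hZ[OF zspan_Q[OF x]] by (simp add: phi_Q[OF x b root] mult.left_commute)
      also have "\<dots> = Re lam * h x - Im lam * Im ?z" using hZ[OF x] by simp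
      finally have "Im ?z = (Re lam * h x - h (Q *v x)) / Im lam" using im by (simp add: field_simps)
      then have "?z = Complex (h x) ((Re lam * h x - h (Q *v x)) / Im lam)"
        using hZ[OF x] by (intro complex_eqI) simp_all
      then show ?thesis using om0 unfolding L_def by (metis nonzero_mult_div_cancel_left)
    qed
    ultimately show ?thesis by blast
  qed
qed

lemma phi_expanding_bounded:
  assumes "\<mu> \<in> range D" "b \<in> B"
  shows "\<exists>K. \<forall>x\<in>zspan G. cmod (\<phi> b \<mu> x) \<le> K * norm x"
proof -
  have "finite (range (\<lambda>k. cmod (D k)))" by simp
  then have "Max (range (\<lambda>k. cmod (D k))) \<in> range (\<lambda>k. cmod (D k))" by (rule Max_in) simp
  then obtain k where k: "Max (range (\<lambda>k. cmod (D k))) = cmod (D k)" by (rule rangeE)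
  have max: "cmod (D j) \<le> cmod (D k)" for j
    unfolding k[symmetric] by (intro Max_ge) auto
  have "card B \<le> card {j. D j = D k}"
    using phi_linear_of_max[OF _ max] by (intro card_B_le p_root) auto
  also have "\<dots> = card {j. D j = \<mu>}" using assms(1) same_mult by auto
  finally show ?thesis using phi_bounded assms by blast
qed

text \<open>The value at \<open>c\<close> is \<open>\<mu>\<close> times the value at its parent plus
  one of finitely many terms, so a large enough bound reproduces itself. The induction runs over the
  norm of \<open>\<psi> c\<close>, which drops by at least 1 at a parent as long as \<open>c\<close>
  is outside a ball.\<close>

lemma phi_contracting_bounded:
  assumes mu: "poly (cpoly p) \<mu> = 0" "cmod \<mu> < 1" and b: "b \<in> B" and c0: "c0 \<in> C"
  shows "\<exists>K. \<forall>c\<in>C. cmod (\<phi> b \<mu> (c - c0)) \<le> K"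
proof -
  obtain \<kappa> where k1: "\<kappa> > 1" and expand: "\<And>x. \<kappa> * norm (\<psi> x) \<le> norm (\<psi> (Q *v x))"
    using expansion_constant[OF expanding] by blast
  define d where "d = (\<Sum>\<delta>\<in>\<Delta>. norm (\<psi> \<delta>))"
  have d: "norm (\<psi> \<delta>) \<le> d" if "\<delta> \<in> \<Delta>" for \<delta>
    unfolding d_def using that finite_digits by (intro member_le_sum) auto
  have d0: "d \<ge> 0" unfolding d_def by (intro sum_nonneg) auto
  \<comment> \<open>Positions are relative to \<open>c0\<close>, which \<open>Q\<close> moves; this
    adds \<open>Q *v c0 - c0\<close> to the digit.\<close>
  define e where "e = (\<Sum>\<delta>\<in>\<Delta>. cmod (\<phi> b \<mu> (\<delta> + (Q *v c0 - c0))))"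
  have e: "cmod (\<phi> b \<mu> (\<delta> + (Q *v c0 - c0))) \<le> e" if "\<delta> \<in> \<Delta>" for \<delta>
    unfolding e_def using that finite_digits by (intro member_le_sum) auto
  \<comment> \<open>\<open>R1\<close> solves \<open>(t + d) / \<kappa> = t - 1\<close>, where the
    left side bounds the norm of a parent.\<close>
  define R1 where "R1 = (d + \<kappa>) / (\<kappa> - 1)"
  obtain B1 where B1: "\<forall>x\<in>C. \<forall>y\<in>C. norm (\<psi> x - \<psi> y) \<le> R1 + norm (\<psi> c0) \<longrightarrow> cmod (\<phi> b \<mu> (x - y)) \<le> B1"
    using bounded_variation[OF b mu(1)] by blast
  \<comment> \<open>\<open>B1\<close> covers the ball of radius \<open>R1\<close>; the other entry
    is the fixed point of the map taking t to \<open>cmod \<mu> * t + e\<close>.\<close>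
  define K where "K = max B1 (e / (1 - cmod \<mu>))"
  have K: "cmod \<mu> * K + e \<le> K"
  proof -
    have "e / (1 - cmod \<mu>) \<le> K" by (simp add: K_def)
    then show ?thesis using mu(2) by (simp add: field_simps)
  qed
  have main: "\<forall>c\<in>C. norm (\<psi> c) \<le> R1 + real n \<longrightarrow> cmod (\<phi> b \<mu> (c - c0)) \<le> K" for n
  proof (induction n)
    case 0
    have "cmod (\<phi> b \<mu> (c - c0)) \<le> B1" if "c \<in> C" "norm (\<psi> c) \<le> R1" for c
      using B1 that c0 norm_triangle_ineq4[of "\<psi> c" "\<psi> c0"] by fastforce
    then show ?case by (fastforce simp: K_def)
  next
    case (Suc n)
    show ?case
    proof (intro ballI impI)
      fix c assume c: "c \<in> C" "norm (\<psi> c) \<le> R1 + real (Suc n)"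
      show "cmod (\<phi> b \<mu> (c - c0)) \<le> K"
      proof (cases "norm (\<psi> c) \<le> R1")
        case True
        then show ?thesis using Suc c(1) by fastforce
      next
        case False
        obtain c' where c': "c' \<in> C" "c - Q *v c' \<in> \<Delta>" using parent[OF c(1)] by blast
        have "\<kappa> * norm (\<psi> c') \<le> norm (\<psi> (Q *v c'))" by (rule expand)
        also have "\<dots> = norm (\<psi> c - \<psi> (c - Q *v c'))" by (simp add: psi_diff)
        also have "\<dots> \<le> norm (\<psi> c) + d"
          using norm_triangle_ineq4[of "\<psi> c" "\<psi> (c - Q *v c')"] d[OF c'(2)] by linarith
        also have "\<dots> \<le> \<kappa> * (norm (\<psi> c) - 1)"
        proof -
          have "d + \<kappa> \<le> norm (\<psi> c) * (\<kappa> - 1)"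
            using False k1 by (simp add: R1_def divide_less_eq not_le)
          then show ?thesis by (simp add: algebra_simps)
        qed
        finally have "norm (\<psi> c') \<le> norm (\<psi> c) - 1" using k1 by simp
        then have IH: "cmod (\<phi> b \<mu> (c' - c0)) \<le> K" using Suc c c'(1) by simp
        have z: "c - c0 \<in> zspan G" "c' - c0 \<in> zspan G" using diff_in_zspan c0 c(1) c'(1) by auto
        have "c - c0 - Q *v (c' - c0) = (c - Q *v c') + (Q *v c0 - c0)"
          by (simp add: matrix_vector_mult_diff_distrib)
        then have "\<phi> b \<mu> (c - c0) - \<mu> * \<phi> b \<mu> (c' - c0) = \<phi> b \<mu> ((c - Q *v c') + (Q *v c0 - c0))"
          using phi_diff[OF z(1) zspan_Q[OF z(2)] b mu(1)] phi_Q[OF z(2) b mu(1)] by metis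
        then have "cmod (\<phi> b \<mu> (c - c0)) \<le> cmod (\<mu> * \<phi> b \<mu> (c' - c0)) + e"
          using e[OF c'(2)] norm_triangle_sub[of "\<phi> b \<mu> (c - c0)" "\<mu> * \<phi> b \<mu> (c' - c0)"] by simp
        also have "cmod (\<mu> * \<phi> b \<mu> (c' - c0)) \<le> cmod \<mu> * K"
          using IH by (simp add: norm_mult mult_left_mono)
        finally show ?thesis using K by linarith
      qed
    qed
  qed
  have "cmod (\<phi> b \<mu> (c - c0)) \<le> K" if "c \<in> C" for c
  proof -
    obtain n where "norm (\<psi> c) - R1 \<le> real n" using real_arch_simple by blast
    then show ?thesis using main[of n] that by simp
  qed
  then show ?thesis by blast
qed

text \<open>The order of quantifiers is the point: \<open>K\<close> precedes the box size
  \<open>N\<close>, while \<open>k0\<close> may depend on it. At an eigenvalue the length of the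
  offset bounds its coordinate. At a contracting conjugate the control point has a bounded
  coordinate, and that of the lattice point is at most \<open>real N * s * cmod \<mu> ^ k\<close>,
  below 1 for large \<open>k\<close>.\<close>

lemma phi_offsets_bounded:
  fixes v :: "'n \<Rightarrow> real^'n"
  assumes c0: "c0 \<in> C" and v: "\<And>j. v j \<in> zspan G"
    and b: "b \<in> B" and root: "poly (cpoly p) \<mu> = 0" and R1: "R1 \<ge> 0"
  shows "\<exists>K\<ge>0. \<forall>N::nat. \<exists>k0. \<forall>k\<ge>k0. \<forall>l::int^'n. (\<forall>j. \<bar>l $ j\<bar> \<le> int N) \<longrightarrow>
     (\<forall>c\<in>C. norm (c - (c0 + (\<Sum>j\<in>UNIV. real_of_int (l $ j) *\<^sub>R ((*v) Q ^^ k) (v j)))) \<le> R1 \<longrightarrow>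
       cmod (\<phi> b \<mu> (c - (c0 + (\<Sum>j\<in>UNIV. real_of_int (l $ j) *\<^sub>R ((*v) Q ^^ k) (v j))))) \<le> K)"
proof -
  define x where "x k l = (\<Sum>j\<in>UNIV. real_of_int (l $ j) *\<^sub>R ((*v) Q ^^ k) (v j))" for k and l :: "int^'n"
  have x: "x k l \<in> zspan G" for k l
    unfolding x_def using v by (intro zspan_sum zspan_scale zspan_iterate)
  have e: "c - (c0 + x k l) = (c - c0) - x k l" for c k l by simp
  have ez: "c - (c0 + x k l) \<in> zspan G" if "c \<in> C" for c k l
    unfolding e by (intro zspan_diff x diff_in_zspan c0 that)
  show ?thesis
    unfolding x_def[symmetric]
  proof (cases "\<mu> \<in> range D")
    case True
    then obtain K where K: "\<forall>x\<in>zspan G. cmod (\<phi> b \<mu> x) \<le> K * norm x"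
      using phi_expanding_bounded b by blast
    have "cmod (\<phi> b \<mu> (c - (c0 + x k l))) \<le> \<bar>K\<bar> * R1"
      if "c \<in> C" "norm (c - (c0 + x k l)) \<le> R1" for c k l
    proof -
      have "cmod (\<phi> b \<mu> (c - (c0 + x k l))) \<le> K * norm (c - (c0 + x k l))" using K ez[OF that(1)] by blast
      also have "\<dots> \<le> \<bar>K\<bar> * norm (c - (c0 + x k l))" by (intro mult_right_mono) auto
      also have "\<dots> \<le> \<bar>K\<bar> * R1" using that(2) by (intro mult_left_mono) auto
      finally show ?thesis .
    qed
    then show "\<exists>K\<ge>0. \<forall>N::nat. \<exists>k0. \<forall>k\<ge>k0. \<forall>l. (\<forall>j. \<bar>l $ j\<bar> \<le> int N) \<longrightarrow>
     (\<forall>c\<in>C. norm (c - (c0 + x k l)) \<le> R1 \<longrightarrow> cmod (\<phi> b \<mu> (c - (c0 + x k l))) \<le> K)"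
      using R1 by (intro exI[of _ "\<bar>K\<bar> * R1"]) auto
  next
    case False
    then have small: "cmod \<mu> < 1" using pisot root by blast
    obtain K where K: "\<forall>c\<in>C. cmod (\<phi> b \<mu> (c - c0)) \<le> K"
      using phi_contracting_bounded[OF root small b c0] by blast
    define s where "s = (\<Sum>j\<in>UNIV. cmod (\<phi> b \<mu> (v j)))"
    have s: "s \<ge> 0" unfolding s_def by (intro sum_nonneg) auto
    have ex: "\<exists>k0. \<forall>k\<ge>k0. \<forall>l. (\<forall>j. \<bar>l $ j\<bar> \<le> int N) \<longrightarrow>
       (\<forall>c\<in>C. norm (c - (c0 + x k l)) \<le> R1 \<longrightarrow> cmod (\<phi> b \<mu> (c - (c0 + x k l))) \<le> \<bar>K\<bar> + 1)" for N :: nat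
    proof -
      have "(\<lambda>k. real N * s * cmod \<mu> ^ k) \<longlonglongrightarrow> real N * s * 0"
        using small by (intro tendsto_intros LIMSEQ_power_zero) auto
      then have "eventually (\<lambda>k. real N * s * cmod \<mu> ^ k < 1) sequentially"
        by (rule order_tendstoD) simp
      then obtain k0 where k0: "\<And>k. k \<ge> k0 \<Longrightarrow> real N * s * cmod \<mu> ^ k < 1"
        by (auto simp: eventually_sequentially)
      have "cmod (\<phi> b \<mu> (c - (c0 + x k l))) \<le> \<bar>K\<bar> + 1"
        if k: "k \<ge> k0" and l: "\<forall>j. \<bar>l $ j\<bar> \<le> int N" and c: "c \<in> C" for k l c
      proof -
        have "\<phi> b \<mu> (x k l) = (\<Sum>j\<in>UNIV. of_int (l $ j) * (\<mu> ^ k * \<phi> b \<mu> (v j)))"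
          unfolding x_def
          by (subst phi_sum[OF zspan_scale[OF zspan_iterate[OF v]] b root])
            (simp add: phi_scale_int[OF zspan_iterate[OF v] b root] phi_iterate[OF v b root])
        also have "cmod \<dots> \<le> (\<Sum>j\<in>UNIV. real N * (cmod \<mu> ^ k * cmod (\<phi> b \<mu> (v j))))"
        proof (rule sum_norm_le)
          fix j
          have "\<bar>real_of_int (l $ j)\<bar> \<le> real N" using l by (metis of_int_abs of_int_le_iff of_int_of_nat_eq)
          then show "cmod (of_int (l $ j) * (\<mu> ^ k * \<phi> b \<mu> (v j))) \<le> real N * (cmod \<mu> ^ k * cmod (\<phi> b \<mu> (v j)))"
            by (simp add: norm_mult norm_power mult_right_mono)
        qed
        also have "\<dots> = real N * s * cmod \<mu> ^ k"
          by (simp add: s_def sum_distrib_left sum_distrib_right mult_ac)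
        also have "\<dots> \<le> 1" using k0[OF k] by simp
        finally have "cmod (\<phi> b \<mu> (x k l)) \<le> 1" .
        moreover have "\<phi> b \<mu> (c - (c0 + x k l)) = \<phi> b \<mu> (c - c0) - \<phi> b \<mu> (x k l)"
          unfolding e by (rule phi_diff[OF diff_in_zspan[OF c0 c] x b root])
        ultimately show ?thesis
          using K c norm_triangle_ineq4[of "\<phi> b \<mu> (c - c0)" "\<phi> b \<mu> (x k l)"] by fastforce
      qed
      then show ?thesis by blast
    qed
    show "\<exists>K\<ge>0. \<forall>N::nat. \<exists>k0. \<forall>k\<ge>k0. \<forall>l. (\<forall>j. \<bar>l $ j\<bar> \<le> int N) \<longrightarrow>
     (\<forall>c\<in>C. norm (c - (c0 + x k l)) \<le> R1 \<longrightarrow> cmod (\<phi> b \<mu> (c - (c0 + x k l))) \<le> K)"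
      by (rule exI[of _ "\<bar>K\<bar> + 1"], rule conjI, simp, rule allI, rule ex)
  qed
qed

text \<open>Sums over the finite set \<open>I\<close> of pairs of a basis vector and a root serve as
  common upper bounds for the constants \<open>K\<close> and for the exponents \<open>k0\<close>;
  then \<open>phi_finite\<close> applies.\<close>

theorem finite_offsets:
  fixes v :: "'n \<Rightarrow> real^'n"
  assumes c0: "c0 \<in> C" and v: "\<And>j. v j \<in> zspan G" and R1: "R1 \<ge> 0"
  shows "\<exists>F. finite F \<and> (\<forall>N::nat. \<exists>k. \<forall>l::int^'n. (\<forall>j. \<bar>l $ j\<bar> \<le> int N) \<longrightarrow>
     (\<forall>c\<in>C. norm (c - (c0 + (\<Sum>j\<in>UNIV. real_of_int (l $ j) *\<^sub>R ((*v) Q ^^ k) (v j)))) \<le> R1 \<longrightarrow>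
       c - (c0 + (\<Sum>j\<in>UNIV. real_of_int (l $ j) *\<^sub>R ((*v) Q ^^ k) (v j))) \<in> F))"
proof -
  define x where "x k l = (\<Sum>j\<in>UNIV. real_of_int (l $ j) *\<^sub>R ((*v) Q ^^ k) (v j))" for k and l :: "int^'n"
  have xz: "c - (c0 + x k l) \<in> zspan G" if "c \<in> C" for c k l
  proof -
    have "x k l \<in> zspan G" unfolding x_def using v by (intro zspan_sum zspan_scale zspan_iterate)
    then have "(c - c0) - x k l \<in> zspan G" by (intro zspan_diff diff_in_zspan c0 that)
    then show ?thesis by (simp add: diff_diff_eq)
  qed
  define I where "I = B \<times> {\<mu>. poly (cpoly p) \<mu> = 0}"
  have "finite {\<mu>. poly (cpoly p) \<mu> = 0}" using irr by (intro poly_roots_finite) auto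
  then have I: "finite I" unfolding I_def using finite_B by simp
  have "\<forall>i\<in>I. \<exists>K\<ge>0. \<forall>N::nat. \<exists>k0. \<forall>k\<ge>k0. \<forall>l. (\<forall>j. \<bar>l $ j\<bar> \<le> int N) \<longrightarrow>
     (\<forall>c\<in>C. norm (c - (c0 + x k l)) \<le> R1 \<longrightarrow> cmod (\<phi> (fst i) (snd i) (c - (c0 + x k l))) \<le> K)"
    unfolding x_def using phi_offsets_bounded[OF c0 v _ _ R1] by (auto simp: I_def)
  then obtain K where K: "\<forall>i\<in>I. K i \<ge> 0 \<and> (\<forall>N::nat. \<exists>k0. \<forall>k\<ge>k0. \<forall>l. (\<forall>j. \<bar>l $ j\<bar> \<le> int N) \<longrightarrow>
     (\<forall>c\<in>C. norm (c - (c0 + x k l)) \<le> R1 \<longrightarrow> cmod (\<phi> (fst i) (snd i) (c - (c0 + x k l))) \<le> K i))"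
    using bchoice[of I "\<lambda>i K. K \<ge> 0 \<and> (\<forall>N::nat. \<exists>k0. \<forall>k\<ge>k0. \<forall>l. (\<forall>j. \<bar>l $ j\<bar> \<le> int N) \<longrightarrow>
     (\<forall>c\<in>C. norm (c - (c0 + x k l)) \<le> R1 \<longrightarrow> cmod (\<phi> (fst i) (snd i) (c - (c0 + x k l))) \<le> K))"] by blast
  define F where "F = {x \<in> zspan G. \<forall>b\<in>B. \<forall>\<mu>. poly (cpoly p) \<mu> = 0 \<longrightarrow> cmod (\<phi> b \<mu> x) \<le> sum K I}"
  have finF: "finite F" unfolding F_def by (rule phi_finite)
  have main: "\<exists>k. \<forall>l. (\<forall>j. \<bar>l $ j\<bar> \<le> int N) \<longrightarrow>
     (\<forall>c\<in>C. norm (c - (c0 + x k l)) \<le> R1 \<longrightarrow> c - (c0 + x k l) \<in> F)" for N :: nat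
  proof -
    have "\<forall>i\<in>I. \<exists>k0. \<forall>k\<ge>k0. \<forall>l. (\<forall>j. \<bar>l $ j\<bar> \<le> int N) \<longrightarrow>
       (\<forall>c\<in>C. norm (c - (c0 + x k l)) \<le> R1 \<longrightarrow> cmod (\<phi> (fst i) (snd i) (c - (c0 + x k l))) \<le> K i)"
      using K by blast
    then obtain k0 where k0: "\<forall>i\<in>I. \<forall>k\<ge>k0 i. \<forall>l. (\<forall>j. \<bar>l $ j\<bar> \<le> int N) \<longrightarrow>
       (\<forall>c\<in>C. norm (c - (c0 + x k l)) \<le> R1 \<longrightarrow> cmod (\<phi> (fst i) (snd i) (c - (c0 + x k l))) \<le> K i)"
      using bchoice[of I "\<lambda>i k0. \<forall>k\<ge>k0. \<forall>l. (\<forall>j. \<bar>l $ j\<bar> \<le> int N) \<longrightarrow>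
       (\<forall>c\<in>C. norm (c - (c0 + x k l)) \<le> R1 \<longrightarrow> cmod (\<phi> (fst i) (snd i) (c - (c0 + x k l))) \<le> K i)"] by blast
    have "c - (c0 + x (sum k0 I) l) \<in> F"
      if l: "\<forall>j. \<bar>l $ j\<bar> \<le> int N" and c: "c \<in> C" "norm (c - (c0 + x (sum k0 I) l)) \<le> R1" for l c
    proof -
      have "cmod (\<phi> b \<mu> (c - (c0 + x (sum k0 I) l))) \<le> sum K I" if "b \<in> B" "poly (cpoly p) \<mu> = 0" for b \<mu>
      proof -
        have i: "(b, \<mu>) \<in> I" using that by (simp add: I_def)
        then have "k0 (b, \<mu>) \<le> sum k0 I" using I by (intro member_le_sum) auto
        then have "cmod (\<phi> b \<mu> (c - (c0 + x (sum k0 I) l))) \<le> K (b, \<mu>)"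
          using k0[rule_format, OF i _ l[rule_format] c] by simp
        also have "\<dots> \<le> sum K I" using i I K by (intro member_le_sum) auto
        finally show ?thesis .
      qed
      then show ?thesis using xz[OF c(1)] by (simp add: F_def)
    qed
    then show ?thesis by blast
  qed
  show ?thesis
    by (intro exI[of _ F] conjI finF allI) (rule main[unfolded x_def])
qed

section \<open>Boxes of patch positions\<close>

lemma Q_iterate_linear: "linear ((*v) Q ^^ k)"
proof (induction k)
  case (Suc k)
  then show ?case using linear_compose[OF Suc matrix_vector_mul_linear[of Q]] by (simp add: o_def)
qed (auto intro: linearI)

lemma Q_iterate_inj: "inj ((*v) Q ^^ k)"
proof (rule injI)
  fix x y assume eq: "((*v) Q ^^ k) x = ((*v) Q ^^ k) y"
  have "\<psi> x $ i = \<psi> y $ i" for i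
  proof -
    have "D i ^ k * \<psi> x $ i = D i ^ k * \<psi> y $ i" using eq by (metis psi_iterate)
    moreover have "D i \<noteq> 0" using expanding[of i] by auto
    ultimately show ?thesis by simp
  qed
  then show "x = y" by (rule psi_eqI)
qed

text \<open>\<open>Y\<close> stands for the positions of a patch, which the shift \<open>q\<close>
  takes to control points. Equal offsets over a homothetic image of the box mean that the positions
  themselves form a box.\<close>

theorem arithmetic_boxes:
  assumes Y: "\<And>y. y \<in> Y \<Longrightarrow> y + q \<in> C" and dense: "\<And>z. \<exists>y\<in>Y. norm (y - z) \<le> R1"
  shows "\<exists>b :: 'n \<Rightarrow> real^'n. inj b \<and> independent (range b) \<and> span (range b) = UNIV \<and>
     (\<exists>y0. \<forall>l :: 'n \<Rightarrow> nat. (\<forall>j. l j \<in> {1..n}) \<longrightarrow> y0 + (\<Sum>j\<in>UNIV. real (l j) *\<^sub>R b j) \<in> Y)"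
proof -
  obtain c0 where c0: "c0 \<in> C" using relatively_dense by blast
  have R1: "R1 \<ge> 0" using dense[of 0] by (meson norm_ge_zero order_trans)
  obtain A where A: "A \<subseteq> G" "independent A" "G \<subseteq> span A" using maximal_independent_subset by blast
  have spanA: "span A = UNIV" using span_mono[OF A(3)] span_G' by (simp add: span_span top.extremum_unique)
  have cardA: "card A = CARD('n)" using basis_card_eq_dim[of A UNIV] A(2) spanA by (simp add: dim_UNIV)
  then obtain v where v: "bij_betw v (UNIV :: 'n set) A"
    using finite_same_card_bij[of "UNIV :: 'n set" A] A(2) by (auto simp: independent_imp_finite)
  have vG: "v j \<in> zspan G" for j
    using v A(1) zspan_superset[OF G_finite] by (auto simp: bij_betw_def)
  obtain F where F: "finite F" and Fk: "\<forall>N::nat. \<exists>k. \<forall>l::int^'n. (\<forall>j. \<bar>l $ j\<bar> \<le> int N) \<longrightarrow>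
     (\<forall>c\<in>C. norm (c - (c0 + (\<Sum>j\<in>UNIV. real_of_int (l $ j) *\<^sub>R ((*v) Q ^^ k) (v j)))) \<le> R1 \<longrightarrow>
       c - (c0 + (\<Sum>j\<in>UNIV. real_of_int (l $ j) *\<^sub>R ((*v) Q ^^ k) (v j))) \<in> F)"
    using finite_offsets[of c0 v R1, OF c0 vG R1] by (elim exE conjE)
  define s where "s l = (\<chi> j. int (l j))" for l :: "'n \<Rightarrow> nat"
  define box where "box = s ` {l. \<forall>j. l j \<in> {1..n}}"
  have "{l :: 'n \<Rightarrow> nat. \<forall>j. l j \<in> {1..n}} = PiE UNIV (\<lambda>_. {1..n})" by (auto simp: PiE_def extensional_def)
  then have "finite {l :: 'n \<Rightarrow> nat. \<forall>j. l j \<in> {1..n}}" by (simp add: finite_PiE)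
  then have box: "finite box" by (simp add: box_def)
  obtain H where H: "finite H" "\<forall>(a,k)\<in>H. k > 0"
    and Hm: "\<forall>c :: int^'n \<Rightarrow> nat. (\<forall>x. c x < card F + 1) \<longrightarrow>
      (\<exists>(a,k)\<in>H. \<forall>s\<in>box. \<forall>t\<in>box. c (a + of_nat k * s) = c (a + of_nat k * t))"
    using gallai_pairs[OF box, of "card F + 1"] by (elim exE conjE)
  define W where "W = (\<lambda>((a,k),s). a + of_nat k * s) ` (H \<times> box)"
  have finW: "finite W" unfolding W_def using H box by simp
  define N where "N = (\<Sum>w\<in>W. \<Sum>j\<in>UNIV. nat \<bar>w $ j\<bar>)"
  have N: "\<bar>w $ j\<bar> \<le> int N" if "w \<in> W" for w j
  proof -
    have "nat \<bar>w $ j\<bar> \<le> (\<Sum>j\<in>UNIV. nat \<bar>w $ j\<bar>)" by (intro member_le_sum) auto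
    also have "\<dots> \<le> N" unfolding N_def using that finW by (intro member_le_sum) auto
    finally show ?thesis by linarith
  qed
  obtain k where k: "\<forall>l::int^'n. (\<forall>j. \<bar>l $ j\<bar> \<le> int N) \<longrightarrow>
     (\<forall>c\<in>C. norm (c - (c0 + (\<Sum>j\<in>UNIV. real_of_int (l $ j) *\<^sub>R ((*v) Q ^^ k) (v j)))) \<le> R1 \<longrightarrow>
       c - (c0 + (\<Sum>j\<in>UNIV. real_of_int (l $ j) *\<^sub>R ((*v) Q ^^ k) (v j))) \<in> F)"
    using Fk[rule_format, of N] by (rule exE)
  define u where "u j = ((*v) Q ^^ k) (v j)" for j
  define x where "x l = c0 + (\<Sum>j\<in>UNIV. real_of_int (l $ j) *\<^sub>R u j)" for l :: "int^'n"
  \<comment> \<open>Aiming at \<open>x l - q\<close> brings the control point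
    \<open>y l + q\<close>, rather than the position \<open>y l\<close>, close to the lattice point
    \<open>x l\<close>.\<close>
  have "\<forall>l. \<exists>y. y \<in> Y \<and> norm (y - (x l - q)) \<le> R1" using dense by blast
  then obtain y where y: "\<And>l. y l \<in> Y" "\<And>l. norm (y l - (x l - q)) \<le> R1" by metis
  define e where "e l = y l + q - x l" for l
  have eF: "e w \<in> F" if "w \<in> W" for w
  proof -
    have "norm (y w + q - x w) \<le> R1" using y(2)[of w] by (simp add: algebra_simps)
    then show ?thesis
      using k[rule_format, OF N[OF that] Y[OF y(1)[of w]]] unfolding e_def x_def u_def by blast
  qed
  obtain enc where enc: "bij_betw enc F {..<card F}"
    using ex_bij_betw_finite_nat[OF F] by (auto simp: atLeast0LessThan)
  \<comment> \<open>Offsets are known to lie in \<open>F\<close> only over \<open>W\<close>; the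
    extra colour \<open>card F\<close> makes the colouring total. Homotheties from \<open>H\<close>
    keep the box inside \<open>W\<close>.\<close>
  define c where "c w = (if w \<in> W then enc (e w) else card F)" for w
  have "c w < card F + 1" for w
    using bij_betwE[OF enc] eF by (force simp: c_def less_Suc_eq)
  then obtain a m where am: "(a, m) \<in> H" "\<forall>s\<in>box. \<forall>t\<in>box. c (a + of_nat m * s) = c (a + of_nat m * t)"
    using Hm[rule_format, of c] by blast
  have m: "m > 0" using H(2) am(1) by auto
  have inW: "a + of_nat m * t \<in> W" if "t \<in> box" for t
    unfolding W_def using am(1) that by (intro image_eqI[of _ _ "((a,m),t)"]) auto
  have same: "e (a + of_nat m * t) = e (a + of_nat m * t')" if "t \<in> box" "t' \<in> box" for t t'
  proof -
    have "enc (e (a + of_nat m * t)) = enc (e (a + of_nat m * t'))"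
      using am(2) inW that unfolding c_def by fastforce
    then show ?thesis using enc eF inW that by (meson bij_betw_def inj_onD)
  qed
  define f where "f z = real m *\<^sub>R ((*v) Q ^^ k) z" for z
  have linf: "linear f"
    unfolding f_def using linear_compose_scale_right[OF Q_iterate_linear] by blast
  have injf: "inj f" using Q_iterate_inj[of k] m unfolding f_def inj_def by simp
  define b where "b j = f (v j)" for j
  have rb: "range b = f ` A" using v unfolding b_def bij_betw_def by auto
  have "inj b" using v injf unfolding b_def bij_betw_def inj_def by blast
  moreover have "independent (range b)"
    unfolding rb by (rule linear_independent_injective_image[OF linf A(2) inj_on_subset[OF injf subset_UNIV]])
  moreover have "span (range b) = UNIV"
  proof -
    have "span (f ` A) = f ` span A" using linear_span_image[OF linf] .
    also have "\<dots> = UNIV" using linear_injective_imp_surjective[OF linf injf] spanA by simp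
    finally show ?thesis by (simp add: rb)
  qed
  moreover have "\<exists>y0. \<forall>l. (\<forall>j. l j \<in> {1..n}) \<longrightarrow> y0 + (\<Sum>j\<in>UNIV. real (l j) *\<^sub>R b j) \<in> Y"
  proof (cases "box = {}")
    case True
    then have "\<not> (\<forall>j. l j \<in> {1..n})" for l unfolding box_def by blast
    then show ?thesis by blast
  next
    case False
    then obtain t0 where t0: "t0 \<in> box" by blast
    define y0 where "y0 = e (a + of_nat m * t0) - q + x a"
    have "y0 + (\<Sum>j\<in>UNIV. real (l j) *\<^sub>R b j) \<in> Y" if l: "\<forall>j. l j \<in> {1..n}" for l
    proof -
      have sl: "s l \<in> box" using l by (simp add: box_def)
      have "x (a + of_nat m * s l) = x a + (\<Sum>j\<in>UNIV. real (l j) *\<^sub>R b j)"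
        unfolding x_def b_def f_def u_def s_def
        by (simp add: scaleR_left_distrib sum.distrib of_nat_index mult.commute)
      moreover have "y (a + of_nat m * s l) = e (a + of_nat m * s l) - q + x (a + of_nat m * s l)"
        by (simp add: e_def)
      ultimately have "y (a + of_nat m * s l) = y0 + (\<Sum>j\<in>UNIV. real (l j) *\<^sub>R b j)"
        unfolding y0_def using same[OF sl t0] by simp
      then show ?thesis using y(1) by metis
    qed
    then show ?thesis by blast
  qed
  ultimately show ?thesis by blast
qed

end

section \<open>Control points of self-affine tilings\<close>

lemma bounded_uniform_discrete_imp_finite:
  fixes S :: "'a::heine_borel set"
  assumes "uniform_discrete S" "bounded S"
  shows "finite S"
proof (rule ccontr)
  assume "infinite S"
  then obtain x where x: "x islimpt S" using bounded_infinite_imp_islimpt[OF order_refl assms(2)] by blast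
  then have "x \<in> S" using uniform_discrete_imp_closed[OF assms(1)] by (simp add: closed_limpt)
  then show False
    using x discreteD[OF uniform_discrete_imp_discrete[OF assms(1)]] by (simp add: isolated_in_islimpt_iff)
qed

section \<open>Translates of tiles and packing\<close>

lemma translate_translate: "translate x (translate y T) = translate (y + x) T"
  by (auto simp: translate_def image_image add.assoc)

lemma translate_0 [simp]: "translate 0 T = T"
  by (simp add: translate_def)

lemma supp_translate: "supp_tile (translate x T) = (\<lambda>y. y + x) ` supp_tile T"
  by (simp add: translate_def supp_tile_def)

text \<open>A nonempty compact set is not a proper translate of itself: a point that is extremal in
  direction \<open>x - y\<close> would be moved further in that direction.\<close>

lemma translate_inject:
  assumes "is_tile T" "translate x T = translate y T"
  shows "x = y"
proof -
  let ?S = "supp_tile T"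
  have S: "compact ?S" "?S \<noteq> {}" using assms(1) by (auto simp: is_tile_def)
  have eq: "(\<lambda>z. z + x) ` ?S = (\<lambda>z. z + y) ` ?S"
    using assms(2) by (metis supp_translate)
  have "continuous_on ?S (\<lambda>z. z \<bullet> (x - y))" by (intro continuous_intros)
  then obtain s where s: "s \<in> ?S" "\<And>t. t \<in> ?S \<Longrightarrow> t \<bullet> (x - y) \<le> s \<bullet> (x - y)"
    using continuous_attains_sup[OF S] by blast
  obtain t where t: "t \<in> ?S" "s + x = t + y" using eq s(1) by (metis imageE imageI)
  then have "t = s + (x - y)" by (simp add: algebra_simps)
  then have "(x - y) \<bullet> (x - y) \<le> 0" using s(2)[OF t(1)] by (simp add: inner_add_left)
  then have "(norm (x - y))\<^sup>2 \<le> 0" by (simp add: power2_norm_eq_inner)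
  then show ?thesis by simp
qed

lemma finite_positions:
  assumes "is_tile T" "finite P"
  shows "finite {x. translate x T \<in> P}"
proof -
  have "inj_on (\<lambda>x. translate x T) {x. translate x T \<in> P}"
    using translate_inject[OF assms(1)] by (auto simp: inj_on_def)
  moreover have "(\<lambda>x. translate x T) ` {x. translate x T \<in> P} \<subseteq> P" by auto
  ultimately show ?thesis using assms(2) finite_subset finite_imageD by metis
qed

text \<open>With a ball of radius \<open>e\<close> in the interior, copies shifted by less than
  \<open>e\<close> overlap in their interiors.\<close>

lemma uniform_discrete_positions:
  assumes "is_tile T" "is_patch P"
  shows "uniform_discrete {x. translate x T \<in> P}"
proof -
  let ?I = "interior (supp_tile T)"
  have "?I \<noteq> {}" using assms(1) by (metis closure_empty is_tile_def)
  then obtain p where p: "p \<in> ?I" by blast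
  then obtain e where e: "e > 0" "ball p e \<subseteq> ?I" using open_contains_ball[of ?I] by auto
  show ?thesis
  proof (rule uniformI1[OF e(1)])
    fix x y assume xy: "x \<in> {x. translate x T \<in> P}" "y \<in> {x. translate x T \<in> P}" "dist x y < e"
    show "x = y"
    proof (rule ccontr)
      assume "x \<noteq> y"
      then have "translate x T \<noteq> translate y T" using translate_inject[OF assms(1)] by blast
      then have dis: "interior (supp_tile (translate x T)) \<inter> interior (supp_tile (translate y T)) = {}"
        using assms(2) xy unfolding is_patch_def by blast
      have int: "interior (supp_tile (translate z T)) = (\<lambda>u. u + z) ` ?I" for z
        unfolding supp_translate using interior_translation[of z "supp_tile T"] by (simp add: add.commute)
      have "p + (x - y) \<in> ball p e" using xy(3) by (simp add: dist_norm norm_minus_commute)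
      then have "p + (x - y) \<in> ?I" using e(2) by blast
      then have "p + x \<in> (\<lambda>u. u + y) ` ?I" by (intro image_eqI[of _ _ "p + (x - y)"]) auto
      moreover have "p + x \<in> (\<lambda>u. u + x) ` ?I" using p by blast
      ultimately show False using dis unfolding int by blast
    qed
  qed
qed

locale self_affine = 
  fixes A :: "('n::finite, 'l) tile set" and Q :: "real^'n^'n"
    and \<omega> :: "('n, 'l) tile \<Rightarrow> ('n, 'l) tile set" and \<T> :: "('n, 'l) tile set"
  assumes sat: "self_affine_tiling A Q \<omega> \<T>"
begin

lemma finite_A: "finite A"
  and tile_A: "P \<in> A \<Longrightarrow> is_tile P"
  and finite_omega: "P \<in> A \<Longrightarrow> finite (\<omega> P)"
  and omega_translate: "P \<in> A \<Longrightarrow> T \<in> \<omega> P \<Longrightarrow> \<exists>P'\<in>A. \<exists>x. T = translate x P'"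
  and supp_omega: "P \<in> A \<Longrightarrow> supp (\<omega> P) = (\<lambda>y. Q *v y) ` supp_tile P"
  and patch_T: "is_patch \<T>" and supp_T: "supp \<T> = UNIV"
  and T_translate: "T \<in> \<T> \<Longrightarrow> \<exists>P\<in>A. \<exists>x. T = translate x P"
  and omega_T: "omega_patch A Q \<omega> \<T> = \<T>"
  and FLC: "tiling_FLC \<T>" and rep: "repetitive \<T>" and exp: "expansive Q"
  using sat by (auto simp: self_affine_tiling_def substitution_rule_def is_tiling_def)

lemma ex_child:
  assumes "P \<in> A"
  shows "\<exists>P'\<in>A. \<exists>d. translate d P' \<in> \<omega> P"
proof -
  have "supp_tile P \<noteq> {}" using tile_A[OF assms] by (simp add: is_tile_def)
  then have "\<omega> P \<noteq> {}" using supp_omega[OF assms] by (auto simp: supp_def)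
  then show ?thesis using omega_translate[OF assms] by blast
qed

lemma omega_child:
  assumes "P \<in> A" "translate x P \<in> \<T>" "T \<in> \<omega> P"
  shows "translate (Q *v x) T \<in> \<T>"
proof -
  have "translate (Q *v x) T \<in> omega_tile A Q \<omega> (translate x P)"
    unfolding omega_tile_def translate_patch_def using assms(1,3) by blast
  then have "translate (Q *v x) T \<in> omega_patch A Q \<omega> \<T>"
    unfolding omega_patch_def using assms(2) by blast
  then show ?thesis by (simp add: omega_T)
qed

lemma omega_parent:
  assumes "T \<in> \<T>"
  obtains P x T' where "P \<in> A" "translate x P \<in> \<T>" "T' \<in> \<omega> P" "T = translate (Q *v x) T'"
proof -
  have "T \<in> omega_patch A Q \<omega> \<T>" using assms by (simp add: omega_T)
  then show ?thesis
    unfolding omega_patch_def omega_tile_def translate_patch_def using that by blast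
qed

text \<open>Finite local complexity counts patches up to translation without bounding their size.
  Finiteness of a single one comes from packing: the positions of each prototile are uniformly
  discrete, and those meeting \<open>K\<close> are bounded.\<close>

lemma finite_patch_meet:
  assumes "bounded K"
  shows "finite (patch_meet \<T> K)"
proof -
  have "finite {x. translate x P \<in> patch_meet \<T> K}" if P: "P \<in> A" for P
  proof (rule bounded_uniform_discrete_imp_finite)
    show "uniform_discrete {x. translate x P \<in> patch_meet \<T> K}"
      by (rule uniform_discrete_subset[OF uniform_discrete_positions[OF tile_A[OF P] patch_T]])
        (auto simp: patch_meet_def)
    have "bounded (supp_tile P)" using tile_A[OF P] by (simp add: is_tile_def compact_imp_bounded)
    then obtain \<beta> where \<beta>: "\<And>s. s \<in> supp_tile P \<Longrightarrow> norm s \<le> \<beta>" by (auto simp: bounded_iff)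
    obtain \<alpha> where \<alpha>: "\<And>k. k \<in> K \<Longrightarrow> norm k \<le> \<alpha>" using assms by (auto simp: bounded_iff)
    have "norm (k - s) \<le> \<alpha> + \<beta>" if "k \<in> K" "s \<in> supp_tile P" for k s
      using \<alpha>[OF that(1)] \<beta>[OF that(2)] norm_triangle_ineq4[of k s] by linarith
    then have "bounded {k - s | k s. k \<in> K \<and> s \<in> supp_tile P}"
      unfolding bounded_iff by blast
    moreover have "{x. translate x P \<in> patch_meet \<T> K} \<subseteq> {k - s | k s. k \<in> K \<and> s \<in> supp_tile P}"
    proof clarify
      fix x assume "translate x P \<in> patch_meet \<T> K"
      then obtain s where "s \<in> supp_tile P" "s + x \<in> K" by (auto simp: patch_meet_def supp_translate)
      then show "\<exists>k s. x = k - s \<and> k \<in> K \<and> s \<in> supp_tile P"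
        by (intro exI[of _ "s + x"] exI[of _ s]) auto
    qed
    ultimately show "bounded {x. translate x P \<in> patch_meet \<T> K}" by (rule bounded_subset)
  qed
  then have "finite (\<Union>P\<in>A. (\<lambda>x. translate x P) ` {x. translate x P \<in> patch_meet \<T> K})"
    using finite_A by blast
  moreover have "patch_meet \<T> K \<subseteq> (\<Union>P\<in>A. (\<lambda>x. translate x P) ` {x. translate x P \<in> patch_meet \<T> K})"
  proof
    fix T assume T: "T \<in> patch_meet \<T> K"
    then have "T \<in> \<T>" by (simp add: patch_meet_def)
    then obtain P x where "P \<in> A" "T = translate x P" using T_translate by blast
    then show "T \<in> (\<Union>P\<in>A. (\<lambda>x. translate x P) ` {x. translate x P \<in> patch_meet \<T> K})"
      using T by blast
  qed
  ultimately show ?thesis by (rule finite_subset[rotated])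
qed

text \<open>A tile that is a translate of several prototiles may contribute several points, one for
  each representation.\<close>

definition control_set :: "(('n, 'l) tile \<Rightarrow> real^'n) \<Rightarrow> (real^'n) set" where
  "control_set c = {x + c P | x P. P \<in> A \<and> translate x P \<in> \<T>}"

lemma prototile_radius:
  obtains r where "r > 0" "\<And>P s. P \<in> A \<Longrightarrow> s \<in> supp_tile P \<Longrightarrow> norm (c P - s) \<le> r"
proof -
  have "bounded (\<Union>P\<in>A. (\<lambda>s. c P - s) ` supp_tile P)"
  proof (intro bounded_UN ballI)
    fix P assume "P \<in> A"
    then have "compact (supp_tile P)" using tile_A by (simp add: is_tile_def)
    then have "compact ((\<lambda>s. c P - s) ` supp_tile P)"
      by (intro compact_continuous_image continuous_intros)
    then show "bounded ((\<lambda>s. c P - s) ` supp_tile P)" by (rule compact_imp_bounded)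
  qed (rule finite_A)
  then obtain r where "r > 0" "\<And>z. z \<in> (\<Union>P\<in>A. (\<lambda>s. c P - s) ` supp_tile P) \<Longrightarrow> norm z \<le> r"
    by (auto simp: bounded_pos)
  then show ?thesis using that by blast
qed

lemma control_set_dense:
  obtains R where "R > 0" "\<And>z. \<exists>c'\<in>control_set c. norm (c' - z) \<le> R"
proof -
  obtain r where r: "r > 0" "\<And>P s. P \<in> A \<Longrightarrow> s \<in> supp_tile P \<Longrightarrow> norm (c P - s) \<le> r"
    using prototile_radius[of c] by blast
  have "\<exists>c'\<in>control_set c. norm (c' - z) \<le> r" for z
  proof -
    have "z \<in> supp \<T>" using supp_T by simp
    then obtain T where T: "T \<in> \<T>" "z \<in> supp_tile T" unfolding supp_def by blast
    then obtain P x where Px: "P \<in> A" "T = translate x P" using T_translate by blast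
    then obtain s where s: "s \<in> supp_tile P" "z = s + x" using T(2) by (auto simp: supp_translate)
    have "x + c P \<in> control_set c" using Px T(1) unfolding control_set_def by blast
    moreover have "norm (x + c P - z) \<le> r" using r(2)[OF Px(1) s(1)] s(2) by (simp add: algebra_simps)
    ultimately show ?thesis by blast
  qed
  then show ?thesis using that r(1) by blast
qed

text \<open>Control points at distance at most \<open>r\<close> belong to tiles meeting one ball
  around the first. Such balls show finitely many patches up to translation, and differences are
  invariant under translation, so they can be read off from representatives.\<close>

lemma control_set_locally_finite:
  "finite {u - u' | u u'. u \<in> control_set c \<and> u' \<in> control_set c \<and> norm (u - u') \<le> r}"
proof -
  obtain r0 where r0: "r0 > 0" "\<And>P s. P \<in> A \<Longrightarrow> s \<in> supp_tile P \<Longrightarrow> norm (c P - s) \<le> r0"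
    using prototile_radius[of c] by blast
  define K :: "(real^'n) set" where "K = cball 0 (r0 + \<bar>r\<bar>)"
  have "compact K" by (simp add: K_def)
  then have "finite_up_to_translation {patch_meet \<T> ((\<lambda>y. y + x) ` K) | x. True}"
    by (rule FLC[unfolded tiling_FLC_def, rule_format])
  then obtain \<G> where \<G>: "finite \<G>"
    and \<G>0: "\<forall>P\<in>{patch_meet \<T> ((\<lambda>y. y + x) ` K) | x. True}. \<exists>P0\<in>\<G>. \<exists>y. P = translate_patch y P0"
    unfolding finite_up_to_translation_def by (elim exE conjE)
  have \<G>': "\<exists>P0\<in>\<G>. \<exists>y. patch_meet \<T> ((\<lambda>y. y + x) ` K) = translate_patch y P0" for x
    by (rule bspec[OF \<G>0]) (rule CollectI, rule exI[of _ x], simp)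
  define E where "E P0 = (\<lambda>((P,x),(P',x')). (x + c P) - (x' + c P')) `
     ((SIGMA P:A. {x. translate x P \<in> P0}) \<times> (SIGMA P:A. {x. translate x P \<in> P0}))" for P0
  have finE: "finite (E P0)" if "finite P0" for P0
  proof -
    have "finite (SIGMA P:A. {x. translate x P \<in> P0})"
      using finite_A finite_positions[OF tile_A that] by (intro finite_SigmaI) auto
    then show ?thesis unfolding E_def by simp
  qed
  \<comment> \<open>The representatives in \<open>\<G>\<close> are arbitrary sets; those that are
    translates of a patch seen in a ball are finite.\<close>
  have "finite (\<Union>(E ` {P0\<in>\<G>. finite P0}))" using \<G> finE by auto
  moreover have "{u - u' | u u'. u \<in> control_set c \<and> u' \<in> control_set c \<and> norm (u - u') \<le> r} \<subseteq> \<Union>(E ` {P0\<in>\<G>. finite P0})"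
  proof clarify
    fix u u' assume u: "u \<in> control_set c" and u': "u' \<in> control_set c" and n: "norm (u - u') \<le> r"
    obtain x P where P: "P \<in> A" "translate x P \<in> \<T>" "u = x + c P" using u unfolding control_set_def by blast
    obtain x' P' where P': "P' \<in> A" "translate x' P' \<in> \<T>" "u' = x' + c P'" using u' unfolding control_set_def by blast
    let ?K = "(\<lambda>y. y + u) ` K"
    have inK: "translate z T \<in> patch_meet \<T> ?K"
      if T: "T \<in> A" "translate z T \<in> \<T>" "norm (u - (z + c T)) \<le> r" for z T
    proof -
      obtain s where s: "s \<in> supp_tile T" using tile_A[OF T(1)] by (auto simp: is_tile_def)
      have "norm (s + z - u) \<le> r0 + \<bar>r\<bar>"
      proof -
        have "s + z - u = - (c T - s) - (u - (z + c T))" by simp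
        then have "norm (s + z - u) \<le> norm (c T - s) + norm (u - (z + c T))"
          by (metis norm_minus_cancel norm_triangle_ineq4)
        then show ?thesis using r0(2)[OF T(1) s] T(3) by linarith
      qed
      then have "s + z \<in> ?K" unfolding K_def by (intro image_eqI[of _ _ "s + z - u"]) auto
      moreover have "s + z \<in> supp_tile (translate z T)" using s by (simp add: supp_translate)
      ultimately have "supp_tile (translate z T) \<inter> ?K \<noteq> {}" by blast
      then show ?thesis using T(2) by (simp add: patch_meet_def)
    qed
    have "r \<ge> 0" using n norm_ge_zero order_trans by blast
    then have "norm (u - (x + c P)) \<le> r" "norm (u - (x' + c P')) \<le> r"
      using P(3) P'(3) n by simp_all
    then have m: "translate x P \<in> patch_meet \<T> ?K" "translate x' P' \<in> patch_meet \<T> ?K"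
      using inK[OF P(1,2)] inK[OF P'(1,2)] by blast+
    obtain P0 y where P0: "P0 \<in> \<G>" "patch_meet \<T> ?K = translate_patch y P0" using \<G>'[of u] by blast
    have "bounded ?K" unfolding K_def by (intro compact_imp_bounded compact_continuous_image continuous_intros) auto
    then have "finite (translate_patch y P0)" using finite_patch_meet P0(2) by metis
    moreover have inv: "translate (- y) ` translate_patch y P0 = P0"
      by (simp add: translate_patch_def image_image translate_translate)
    ultimately have finP0: "finite P0" by (metis finite_imageI)
    have shift: "translate (z - y) T \<in> P0" if "translate z T \<in> patch_meet \<T> ?K" for z T
    proof -
      have "translate (- y) (translate z T) \<in> translate (- y) ` translate_patch y P0"
        using that P0(2) by (metis imageI)
      then show ?thesis unfolding inv by (simp add: translate_translate)
    qed
    have "u - u' = (x - y + c P) - (x' - y + c P')" by (simp add: P(3) P'(3))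
    then have "u - u' \<in> E P0"
      unfolding E_def using P(1) P'(1) shift[OF m(1)] shift[OF m(2)]
      by (intro image_eqI[of _ _ "((P, x - y), (P', x' - y))"]) auto
    then show "u - u' \<in> \<Union>(E ` {P0\<in>\<G>. finite P0})" using P0(1) finP0 by blast
  qed
  ultimately show ?thesis by (rule finite_subset[rotated])
qed

lemma control_set_repetitive:
  assumes F: "finite F" "F \<subseteq> control_set c"
  shows "\<exists>R'. \<forall>z. \<exists>y. \<forall>x\<in>F. x + y \<in> control_set c \<and> norm (x + y - z) \<le> R'"
proof -
  obtain r0 where r0: "r0 > 0" "\<And>P s. P \<in> A \<Longrightarrow> s \<in> supp_tile P \<Longrightarrow> norm (c P - s) \<le> r0"
    using prototile_radius[of c] by blast
  have "\<forall>f\<in>F. \<exists>P x. P \<in> A \<and> translate x P \<in> \<T> \<and> f = x + c P"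
    using F(2) unfolding control_set_def by blast
  then obtain T x where Tx: "\<And>f. f \<in> F \<Longrightarrow> T f \<in> A \<and> translate (x f) (T f) \<in> \<T> \<and> f = x f + c (T f)"
    by metis
  define P where "P = (\<lambda>f. translate (x f) (T f)) ` F"
  have "finite P" using F(1) by (simp add: P_def)
  moreover have "legal \<T> P"
    unfolding legal_def translate_patch_def using Tx by (intro exI[of _ 0]) (auto simp: P_def)
  ultimately obtain R where R: "\<And>z. \<exists>y. translate_patch y P \<subseteq> \<T> \<and> supp (translate_patch y P) \<subseteq> ball z R"
    using rep unfolding repetitive_def by blast
  have "\<exists>y. \<forall>f\<in>F. f + y \<in> control_set c \<and> norm (f + y - z) \<le> r0 + R" for z
  proof -
    obtain y where y: "translate_patch y P \<subseteq> \<T>" "supp (translate_patch y P) \<subseteq> ball z R" using R by blast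
    have "f + y \<in> control_set c \<and> norm (f + y - z) \<le> r0 + R" if f: "f \<in> F" for f
    proof
      have mem: "translate (x f + y) (T f) \<in> translate_patch y P"
        unfolding translate_patch_def P_def translate_translate[symmetric] using f by blast
      have "f + y = x f + y + c (T f)" using Tx[OF f] by (metis add.assoc add.commute)
      then show "f + y \<in> control_set c"
        unfolding control_set_def using Tx[OF f] mem y(1) by blast
      have "is_tile (T f)" using tile_A Tx[OF f] by blast
      then obtain s where s: "s \<in> supp_tile (T f)" by (auto simp: is_tile_def)
      have "s + (x f + y) \<in> supp (translate_patch y P)"
        unfolding supp_def using mem s by (auto simp: supp_translate intro!: bexI[of _ "translate (x f + y) (T f)"])
      then have "s + (x f + y) \<in> ball z R" using y(2) by blast
      then have n: "norm (s + (x f + y) - z) < R" by (simp add: dist_norm norm_minus_commute)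
      have "f + y - z = x f + y + c (T f) - z"
        using \<open>f + y = x f + y + c (T f)\<close> by (rule arg_cong)
      also have "\<dots> = (c (T f) - s) + (s + (x f + y) - z)" by simp
      also have "norm \<dots> \<le> norm (c (T f) - s) + norm (s + (x f + y) - z)"
        by (rule norm_triangle_ineq)
      finally show "norm (f + y - z) \<le> r0 + R" using r0(2)[OF _ s] Tx[OF f] n by force
    qed
    then show ?thesis by blast
  qed
  then show ?thesis by blast
qed

lemma control_set_Q:
  assumes "\<And>P. P \<in> A \<Longrightarrow> g P \<in> A \<and> translate (d P) (g P) \<in> \<omega> P \<and> Q *v c P = d P + c (g P)"
    and "u \<in> control_set c"
  shows "Q *v u \<in> control_set c"
proof -
  obtain x P where P: "P \<in> A" "translate x P \<in> \<T>" "u = x + c P" using assms(2) unfolding control_set_def by blast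
  have "translate (Q *v x) (translate (d P) (g P)) \<in> \<T>"
    using omega_child[OF P(1,2)] assms(1)[OF P(1)] by blast
  then have "translate (d P + Q *v x) (g P) \<in> \<T>" by (simp add: translate_translate)
  moreover have "Q *v u = d P + Q *v x + c (g P)"
    using assms(1)[OF P(1)] P(3) by (simp add: matrix_vector_right_distrib)
  ultimately show ?thesis unfolding control_set_def using assms(1)[OF P(1)] by blast
qed

lemma control_set_parent:
  obtains \<Delta> where "finite \<Delta>" "\<And>u. u \<in> control_set c \<Longrightarrow> \<exists>u'\<in>control_set c. u - Q *v u' \<in> \<Delta>"
proof -
  define \<Delta> where "\<Delta> = (\<lambda>((P,P'),d). d + c P' - Q *v c P) ` (SIGMA (P,P'):A \<times> A. {d. translate d P' \<in> \<omega> P})"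
  have "finite (SIGMA (P,P'):A \<times> A. {d. translate d P' \<in> \<omega> P})"
    using finite_A finite_positions[OF tile_A finite_omega] by (intro finite_SigmaI) auto
  then have "finite \<Delta>" by (simp add: \<Delta>_def)
  moreover have "\<exists>u'\<in>control_set c. u - Q *v u' \<in> \<Delta>" if "u \<in> control_set c" for u
  proof -
    obtain x P' where P': "P' \<in> A" "translate x P' \<in> \<T>" "u = x + c P'" using \<open>u \<in> control_set c\<close> unfolding control_set_def by blast
    obtain P x0 T' where P: "P \<in> A" "translate x0 P \<in> \<T>" "T' \<in> \<omega> P" "translate x P' = translate (Q *v x0) T'"
      using omega_parent[OF P'(2)] by blast
    (* T' may be a translate of several prototiles; it is read as a translate of P'. *)
    have "translate (- (Q *v x0)) (translate x P') = translate (- (Q *v x0)) (translate (Q *v x0) T')"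
      using P(4) by simp
    then have "translate (x - Q *v x0) P' = T'" by (simp add: translate_translate)
    then have d: "translate (x - Q *v x0) P' \<in> \<omega> P" using P(3) by simp
    have "u - Q *v (x0 + c P) = (x - Q *v x0) + c P' - Q *v c P"
      by (simp add: P'(3) matrix_vector_right_distrib)
    then have "u - Q *v (x0 + c P) \<in> \<Delta>"
      unfolding \<Delta>_def using P(1) P'(1) d
      by (intro image_eqI[of _ _ "((P,P'), x - Q *v x0)"]) auto
    moreover have "x0 + c P \<in> control_set c" using P(1,2) unfolding control_set_def by blast
    ultimately show ?thesis by blast
  qed
  ultimately show ?thesis by (rule that)
qed

end

theorem theorem2p15:
  fixes A :: "('n::finite, 'l) tile set"
    and Q :: "real^'n^'n"
    and \<omega> :: "('n, 'l) tile \<Rightarrow> ('n, 'l) tile set"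
    and \<T> :: "('n, 'l) tile set"
  assumes "self_affine_tiling A Q \<omega> \<T>"
    and "primitive A \<omega>"
    and "subst_FLC A Q \<omega>"
    and "diagonalizable_over_C Q"
    and "\<forall>\<mu>\<in>spec Q. \<forall>\<nu>\<in>spec Q. alg_conjugate \<mu> \<nu>"
    and "\<forall>\<mu>\<in>spec Q. \<forall>\<nu>\<in>spec Q. eig_mult Q \<mu> = eig_mult Q \<nu>"
    and "pisot_family (spec Q)"
  shows "\<forall>P n. finite P \<and> legal \<T> P \<and> n > (0::nat) \<longrightarrow>
           (\<exists>b :: 'n \<Rightarrow> real^'n. inj b \<and> independent (range b) \<and> span (range b) = UNIV \<and>
              legal \<T> (\<Union>l\<in>{l :: 'n \<Rightarrow> nat. \<forall>j. l j \<in> {1..n}}.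
                 translate_patch (\<Sum>j\<in>UNIV. real (l j) *\<^sub>R b j) P))"
proof -
  interpret self_affine A Q \<omega> \<T> by unfold_locales (rule assms(1))
  obtain S S' :: "complex^'n^'n" where SS: "S ** S' = mat 1" "S' ** S = mat 1"
    and off: "\<And>i j. i \<noteq> j \<Longrightarrow> (S' ** complex_mat Q ** S) $ i $ j = 0"
    using assms(4) unfolding diagonalizable_over_C_def by blast
  define D where "D i = (S' ** complex_mat Q ** S) $ i $ i" for i
  interpret diagonalized Q S S' D
    by unfold_locales (use SS off in \<open>auto simp: D_def\<close>)
  have expanding: "cmod (D k) > 1" for k
    using exp by (auto simp: expansive_def spec_eq)
  obtain g d where gd: "\<And>P. P \<in> A \<Longrightarrow> g P \<in> A \<and> translate (d P) (g P) \<in> \<omega> P"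
    using ex_child by metis
  then obtain c where c: "\<forall>P\<in>A. Q *v c P = d P + c (g P)"
    using ex_control_points[OF expanding finite_A, of g d] by blast
  define C where "C = control_set c"
  obtain R where R: "R > 0" "\<And>z. \<exists>c'\<in>C. norm (c' - z) \<le> R"
    using control_set_dense[of c] unfolding C_def by blast
  obtain \<Delta> where \<Delta>: "finite \<Delta>" "\<And>u. u \<in> C \<Longrightarrow> \<exists>u'\<in>C. u - Q *v u' \<in> \<Delta>"
    using control_set_parent[of c] unfolding C_def by blast
  obtain i0 :: 'n where True by simp
  obtain p :: "rat poly" where p: "irreducible p" "poly (cpoly p) (D i0) = 0"
    using assms(5) unfolding alg_conjugate_def spec_eq by blast
  \<comment> \<open>Each pair of eigenvalues may come with its own irreducible polynomial; the
    common root \<open>D i0\<close> makes it divide \<open>p\<close>.\<close>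
  have p_root: "poly (cpoly p) (D k) = 0" for k
  proof -
    obtain q :: "rat poly" where q: "irreducible q" "poly (cpoly q) (D i0) = 0" "poly (cpoly q) (D k) = 0"
      using assms(5) unfolding alg_conjugate_def spec_eq by blast
    show ?thesis using cpoly_dvd_root[OF irreducible_dvd_of_common_root[OF q(1,2) p(2)] q(3)] .
  qed
  have pisot: "cmod \<mu> < 1" if "poly (cpoly p) \<mu> = 0" "\<mu> \<notin> range D" for \<mu>
  proof (rule ccontr)
    assume "\<not> cmod \<mu> < 1"
    moreover have "alg_conjugate (D i0) \<mu>" unfolding alg_conjugate_def using p that(1) by blast
    ultimately have "\<mu> \<in> spec Q"
      using assms(7) unfolding pisot_family_def spec_eq by (meson not_less rangeI)
    then show False using that(2) by (simp add: spec_eq)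
  qed
  interpret pisot_control_points Q S S' D C R \<Delta> p
  proof (intro_locales, goal_cases)
    case 1
    show ?case
    proof (unfold_locales)
      show "cmod (D k) > 1" for k by (rule expanding)
      show "Q *v x \<in> C" if "x \<in> C" for x
        using control_set_Q[of g d c x] gd c that unfolding C_def by blast
      show "finite \<Delta>" by (rule \<Delta>(1))
      show "\<exists>c'\<in>C. c - Q *v c' \<in> \<Delta>" if "c \<in> C" for c by (rule \<Delta>(2)[OF that])
      show "R > 0" by (rule R(1))
      show "\<exists>c\<in>C. norm (c - z) \<le> R" for z by (rule R(2))
      show "finite {c - c' | c c'. c \<in> C \<and> c' \<in> C \<and> norm (c - c') \<le> r}" for r
        unfolding C_def by (rule control_set_locally_finite)
      show "\<exists>R'. \<forall>z. \<exists>y. \<forall>x\<in>F. x + y \<in> C \<and> norm (x + y - z) \<le> R'" if "finite F" "F \<subseteq> C" for F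
        using control_set_repetitive that unfolding C_def by blast
    qed
  next
    case 2
    show ?case
    proof (unfold_locales)
      show "irreducible p" by (rule p(1))
      show "poly (cpoly p) (D k) = 0" for k by (rule p_root)
      show "cmod \<mu> < 1" if "poly (cpoly p) \<mu> = 0" "\<mu> \<notin> range D" for \<mu> using pisot that .
      show "card {k. D k = D i} = card {k. D k = D j}" for i j
        using assms(6) unfolding eig_mult_eq spec_eq by blast
    qed
  qed
  show ?thesis
  proof (intro allI impI, elim conjE)
    fix P :: "('n, 'l) tile set" and n :: nat
    assume P: "finite P" "legal \<T> P" and "n > 0"
    show "\<exists>b :: 'n \<Rightarrow> real^'n. inj b \<and> independent (range b) \<and> span (range b) = UNIV \<and>
              legal \<T> (\<Union>l\<in>{l :: 'n \<Rightarrow> nat. \<forall>j. l j \<in> {1..n}}.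
                 translate_patch (\<Sum>j\<in>UNIV. real (l j) *\<^sub>R b j) P)"
    proof (cases "P = {}")
      \<comment> \<open>The empty patch has no tile to anchor positions, yet a basis is still
        required; the control points themselves serve as positions.\<close>
      case True
      have "\<And>y. y \<in> C \<Longrightarrow> y + 0 \<in> C" by simp
      from arithmetic_boxes[OF this R(2), of n]
      obtain b :: "'n \<Rightarrow> real^'n" where "inj b" "independent (range b)" "span (range b) = UNIV" by blast
      then show ?thesis using True by (intro exI[of _ b]) (simp add: legal_def translate_patch_def)
    next
      case False
      define Y where "Y = {y. translate_patch y P \<subseteq> \<T>}"
      obtain T where T: "T \<in> P" using False by blast
      obtain y1 where y1: "translate_patch y1 P \<subseteq> \<T>" using P(2) by (auto simp: legal_def)
      then have "translate y1 T \<in> \<T>" using T by (auto simp: translate_patch_def)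
      then obtain P0 x where P0: "P0 \<in> A" "translate y1 T = translate x P0" using T_translate by blast
      have "translate (- y1) (translate y1 T) = translate (- y1) (translate x P0)" using P0(2) by simp
      then have T_eq: "T = translate (x - y1) P0" by (simp add: translate_translate)
      \<comment> \<open>\<open>T\<close> is the translate of \<open>P0\<close> by
        \<open>x - y1\<close>, so placing \<open>P\<close> at \<open>y\<close> puts a control point
        at \<open>y + (x - y1 + c P0)\<close>; this fixes the shift \<open>q\<close>.\<close>
      have YC: "y + (x - y1 + c P0) \<in> C" if "y \<in> Y" for y
      proof -
        have "translate y T \<in> \<T>" using that T by (auto simp: Y_def translate_patch_def)
        then have "translate (x - y1 + y) P0 \<in> \<T>" by (simp add: T_eq translate_translate)
        moreover have "y + (x - y1 + c P0) = x - y1 + y + c P0" by simp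
        ultimately show ?thesis using P0(1) unfolding C_def control_set_def by blast
      qed
      obtain r where r: "\<And>z. \<exists>y. translate_patch y P \<subseteq> \<T> \<and> supp (translate_patch y P) \<subseteq> ball z r"
        using rep P unfolding repetitive_def by blast
      have "is_tile (translate y1 T)" using \<open>translate y1 T \<in> \<T>\<close> patch_T by (auto simp: is_patch_def)
      then obtain s where s: "s \<in> supp_tile T" by (auto simp: is_tile_def supp_translate)
      \<comment> \<open>Repetitivity locates a copy of the patch by its support; the point
        \<open>s\<close> of the tile \<open>T\<close> converts this into its position at the cost of
        \<open>norm s\<close>.\<close>
      have dense: "\<exists>y\<in>Y. norm (y - z) \<le> r + norm s" for z
      proof -
        obtain y where y: "translate_patch y P \<subseteq> \<T>" "supp (translate_patch y P) \<subseteq> ball z r" using r by blast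
        have "s + y \<in> supp_tile (translate y T)" using s by (simp add: supp_translate)
        then have "s + y \<in> supp (translate_patch y P)"
          unfolding supp_def translate_patch_def using T by blast
        then have "s + y \<in> ball z r" using y(2) by blast
        then have "norm (s + y - z) < r" by (simp add: dist_norm norm_minus_commute)
        moreover have "norm (y - z) \<le> norm (s + y - z) + norm s"
          using norm_triangle_ineq4[of "s + y - z" s] by simp
        ultimately show ?thesis using y(1) unfolding Y_def by force
      qed
      from arithmetic_boxes[OF YC dense, of n]
      obtain b :: "'n \<Rightarrow> real^'n" and y0 where b: "inj b" "independent (range b)" "span (range b) = UNIV"
        and y0: "\<forall>l :: 'n \<Rightarrow> nat. (\<forall>j. l j \<in> {1..n}) \<longrightarrow> y0 + (\<Sum>j\<in>UNIV. real (l j) *\<^sub>R b j) \<in> Y"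
        by blast
      have "translate_patch y0 (\<Union>l\<in>{l :: 'n \<Rightarrow> nat. \<forall>j. l j \<in> {1..n}}.
                 translate_patch (\<Sum>j\<in>UNIV. real (l j) *\<^sub>R b j) P) \<subseteq> \<T>"
      proof
        fix T' assume "T' \<in> translate_patch y0 (\<Union>l\<in>{l :: 'n \<Rightarrow> nat. \<forall>j. l j \<in> {1..n}}.
                 translate_patch (\<Sum>j\<in>UNIV. real (l j) *\<^sub>R b j) P)"
        then obtain l :: "'n \<Rightarrow> nat" and T1 where l: "\<forall>j. l j \<in> {1..n}" "T1 \<in> P"
          "T' = translate y0 (translate (\<Sum>j\<in>UNIV. real (l j) *\<^sub>R b j) T1)"
          unfolding translate_patch_def by blast
        have "T' = translate (y0 + (\<Sum>j\<in>UNIV. real (l j) *\<^sub>R b j)) T1"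
          unfolding l(3) translate_translate by (simp add: add.commute)
        moreover have "y0 + (\<Sum>j\<in>UNIV. real (l j) *\<^sub>R b j) \<in> Y" using y0 l(1) by blast
        ultimately show "T' \<in> \<T>" using l(2) unfolding Y_def translate_patch_def by blast
      qed
      then show ?thesis using b unfolding legal_def by blast
    qed
  qed
qed

end
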